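(* (1) (Sliding mode control.) Assume that (i)–(iv) of the context hold, that the disturbance $d$ is measurable and uniformly bounded, i.e. $|d(t)|\le K_d$ for some $K_d>0$ and all $t\ge 0$, and that the constant $K>0$ is chosen such that $\frac{K}{|B^*\varphi|}>K_d$. Then, for any initial condition $z_0\in H$, $0\in H$ is globally asymptotically stable for the closed-loop system $$\frac{\mathrm d}{\mathrm dt} z \in A_L z+B\Big(d-\frac{1}{B^*\varphi}\big(\lambda\sigma(t)+K\,\mathrm{sign}(\sigma(t))\big)\Big),\qquad z(0)=z_0,\qquad \sigma(t)=\langle\varphi,z(t)\rangle_H. \quad (\mathrm{SM})$$ (2) (Super-twisting control.) Let $\mathbb{K}=\mathbb{R}$. Assume that (i)–(iv) of the context hold, that $d$ is globally Lipschitz over $\mathbb{R}_+$ and there is a known constant $C>0$ with $|\dot d(t)|\le C$ for a.e. $t\in\mathbb{R}_+$, and that the positive constants $\alpha,\beta$ satisfy $\beta>|B^*\varphi|\,C$ and $\alpha>\sqrt{\beta+|B^*\varphi|\,C}$. Then, for any initial condition $(z_0,w_0)\in H\times\mathbb{R}$, $(0,0)\in H\times\mathbb{R}$ is globally asymptotically stable for the closed-loop system $$\begin{cases}\frac{\mathrm d}{\mathrm dt} z = A_L z+B\Big(\frac{1}{B^*\varphi}\big(-\lambda\sigma(t)-\alpha|\sigma(t)|^{1/2}\mathrm{sign}(\sigma(t))+w(t)\big)\Big),\\ \dot w(t)\in B^*\varphi\,\dot d(t)-\beta\,\mathrm{sign}(\sigma(t)),\\ z(0)=z_0,\ w(0)=w_0,\qquad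 \sigma(t)=\langle\varphi,z(t)\rangle_H.\end{cases}\quad (\mathrm{ST})$$
   Context: Setting. $\mathbb{K}$ is $\mathbb{R}$ or $\mathbb{C}$; $(H,\langle\cdot,\cdot\rangle_H)$ is a Hilbert space over $\mathbb{K}$ with norm $\|\cdot\|_H$. $A:D(A)\subseteq H\to H$ is a linear operator with $D(A)$ dense in $H$ and adjoint $A^*$; $D(A^* )'$ is the dual of $D(A^* )$; $B\in\mathcal{L}(\mathbb{K},D(A^* )')$ has adjoint $B^*\in\mathcal{L}(D(A^* ),\mathbb{K})$. The open-loop system is $\frac{\mathrm d}{\mathrm dt}z=Az+B(u+d)$, $z(0)=z_0$, with state $z(t)\in H$, control $u(t)\in\mathbb{K}$ and unknown disturbance $d(t)\in\mathbb{K}$. Assumptions. (i) $A$ generates a strongly continuous semigroup $(\mathbb{T}(t))_{t\ge0}$ on $H$. (ii) $B$ is admissible (as a control operator) for $(\mathbb{T}(t))_{t\ge0}$. (iii) Let $T>0$. The pair $(A,B)$ is approximately controllable in $H$ in time $T$, i.e. $\forall\psi\in D(A^* )$, $\forall t\in[0,T]$, $B^*\mathbb{T}^*(T-t)\psi=0\Longrightarrow\psi=0$. (iv) There exists an operator $L:D(L)\to\mathbb{K}$ such that the operator $A_L=A+BL$, with $D(A_L)=\{z\in D(L): (A+BL)z\in H\}$, is the infinitesimal generator of a strongly continuous semigroup $(\mathbb{S}(t))_{t\ge0}$ on $H$, and the origin of $\frac{\mathrm d}{\mathrm dt}z=(A+BL)z$, $z(0)=z_0$, is globally asymptotically stable.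 Eigenfunction. $\varphi\in D(A_L^* )$ is an eigenfunction (so $\varphi\ne0$) of the adjoint operator $A_L^*$ of $A_L$ and $\lambda$ is the associated eigenvalue, $A_L^*\varphi=\lambda\varphi$. Here $D(A_L^* )=\{\psi\in H:\exists c>0,\ \forall\phi\in D(A_L),\ |\langle\psi,A_L\phi\rangle_H|\le c\|\phi\|_H\}\subset D(A^* )$ (the inclusion is as asserted by the paper). By (iii) with $t=T$, the scalar $B^*\varphi$ is nonzero. Set-valued sign. $\mathrm{sign}(s)=\frac{s}{|s|}$ if $s\ne0$, and $\mathrm{sign}(0)=[-1,1]$. Solutions are mild solutions. Mild solution of (SM): a map $z:[0,\infty)\to H$ with $z\in C([0,\infty);H)\cap\mathcal{H}^1_{loc}([0,\infty);D(A^* )')$ (the latter meaning that $z$ and its derivative are locally square integrable with values in $D(A^* )'$) such that, for all $t\ge0$, $z(t)=\mathbb{S}(t)z_0+\int_0^t\mathbb{S}(t-s)Bh(s)\,ds$, where $h:[0,\infty)\to\mathbb{K}$ is in $L^2_{loc}([0,\infty);\mathbb{K})$ and satisfies, for a.e. $t\ge0$, $h(t)\in-\frac{1}{B^*\varphi}\big(\lambda\sigma(t)+K\,\mathrm{sign}(\sigma(t))\big)+d(t)$ with $\sigma(t)=\langle\varphi,z(t)\rangle_H$. Mild solution of (ST): maps $z:[0,\infty)\to H$ and $w:[0,\infty)\to\mathbb{R}$ with $z\in C([0,\infty);H)\cap\mathcal{H}^1_{loc}([0,\infty);D(A^* )')$ and $w$ absolutely continuous, $w(0)=w_0$, such that,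 for all $t\ge0$, $z(t)=\mathbb{S}(t)z_0+\int_0^t\mathbb{S}(t-s)B\omega(s)\,ds$ and, for a.e. $t\ge0$, $\dot w(t)\in B^*\varphi\,\dot d(t)-\beta\,\mathrm{sign}(\sigma(t))$, where $\omega(t)=\frac{1}{B^*\varphi}\big(-\lambda\sigma(t)-\alpha|\sigma(t)|^{1/2}\mathrm{sign}(\sigma(t))+w(t)\big)$ and $\sigma(t)=\langle\varphi,z(t)\rangle_H$. Global asymptotic stability of the origin of a system with state space $X$ ($X=H$, or $X=H\times\mathbb{R}$ for (ST)) has its usual meaning: Lyapunov stability (for every $\varepsilon>0$ there is $\delta>0$ such that every solution with initial condition of norm less than $\delta$ has norm less than $\varepsilon$ for all $t\ge0$) together with global attractivity (every solution, from any initial condition in $X$, converges to $0$ in $X$ as $t\to\infty$). *)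

theory Defs
  imports "HOL-Analysis.Analysis"
begin

section \<open>The scalar field\<close>

text \<open>Up to the isometric embedding \<open>to_complex\<close>, a type of this class is either the field of
  real numbers or the field of complex numbers.\<close>

class real_or_complex = real_normed_field + banach + second_countable_topology +
  fixes to_complex :: "'a \<Rightarrow> complex"
  assumes to_complex_add: "to_complex (x + y) = to_complex x + to_complex y"
    and to_complex_mult: "to_complex (x * y) = to_complex x * to_complex y"
    and to_complex_scaleR: "to_complex (r *\<^sub>R x) = r *\<^sub>R to_complex x"
    and norm_to_complex: "norm (to_complex x) = norm x"
    and range_to_complex: "range to_complex = \<real> \<or> range to_complex = UNIV"

instantiation real :: real_or_complex
begin
definition to_complex_real :: "real \<Rightarrow> complex" where "to_complex_real = complex_of_real"
instance
  by standard (auto simp: to_complex_real_def Reals_def scaleR_conv_of_real)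
end

instantiation complex :: real_or_complex
begin
definition to_complex_complex :: "complex \<Rightarrow> complex" where "to_complex_complex z = z"
instance
  by standard (auto simp: to_complex_complex_def)
end

definition kcnj :: "'k::real_or_complex \<Rightarrow> 'k" where
  "kcnj x = inv to_complex (cnj (to_complex x))"

lemma kcnj_real [simp]: "kcnj (x::real) = x"
proof -
  have "inj complex_of_real" by (simp add: inj_def)
  then show ?thesis by (simp add: kcnj_def to_complex_real_def)
qed

lemma kcnj_complex [simp]: "kcnj (z::complex) = cnj z"
proof -
  have "(to_complex :: complex \<Rightarrow> complex) = id" by (auto simp: to_complex_complex_def)
  then show ?thesis by (simp add: kcnj_def)
qed

definition ksign :: "'k::real_or_complex \<Rightarrow> 'k set" where
  "ksign s = (if s \<noteq> 0 then {s / of_real (norm s)} else of_real ` {-1..1})"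

section \<open>Hilbert spaces, operators and adjoints\<close>

text \<open>The inner product is conjugate linear in its first and linear in its second argument.\<close>

locale hilbert_space = vector_space scaleK
  for scaleK :: "'k::real_or_complex \<Rightarrow> 'h::banach \<Rightarrow> 'h" +
  fixes ip :: "'h \<Rightarrow> 'h \<Rightarrow> 'k"
  assumes scaleK_of_real: "scaleK (of_real r) x = r *\<^sub>R x"
    and ip_add_right: "ip x (y + z) = ip x y + ip x z"
    and ip_scale_right: "ip x (scaleK c y) = c * ip x y"
    and ip_commute: "ip y x = kcnj (ip x y)"
    and ip_self: "ip x x = of_real ((norm x)\<^sup>2)"

lemma hilbert_space_real_inner:
  "hilbert_space (*\<^sub>R) (inner :: 'g::{real_inner,banach} \<Rightarrow> 'g \<Rightarrow> real)"
  by unfold_locales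
     (auto simp: algebra_simps inner_add_right inner_commute power2_norm_eq_inner)

lemma hilbert_space_complex: "hilbert_space (*) (\<lambda>x y. cnj x * (y::complex))"
proof unfold_locales
  show "cnj x * x = of_real ((norm x)\<^sup>2)" for x :: complex
    by (metis complex_norm_square mult.commute)
qed (auto simp: algebra_simps scaleR_conv_of_real)

definition linear_operator ::
  "('k::field \<Rightarrow> 'h::ab_group_add \<Rightarrow> 'h) \<Rightarrow> ('k \<Rightarrow> 'v::ab_group_add \<Rightarrow> 'v) \<Rightarrow> 'h set \<Rightarrow> ('h \<Rightarrow> 'v) \<Rightarrow> bool"
where
  "linear_operator sH sV D F \<longleftrightarrow>
     module.subspace sH D \<and>
     (\<forall>x\<in>D. \<forall>y\<in>D. F (x + y) = F x + F y) \<and>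
     (\<forall>c. \<forall>x\<in>D. F (sH c x) = sV c (F x))"

definition adj_dom :: "('h::real_normed_vector \<Rightarrow> 'h \<Rightarrow> 'k::real_normed_vector) \<Rightarrow> 'h set \<Rightarrow> ('h \<Rightarrow> 'h) \<Rightarrow> 'h set"
where
  "adj_dom ip D F = {\<psi>. \<exists>c>0. \<forall>x\<in>D. norm (ip \<psi> (F x)) \<le> c * norm x}"

text \<open>Meaningful for \<open>D\<close> dense and \<open>\<psi>\<close> in \<open>adj_dom ip D F\<close>; then the described vector exists
  by the Riesz representation theorem and is unique.\<close>

definition adj :: "('h \<Rightarrow> 'h \<Rightarrow> 'k) \<Rightarrow> 'h set \<Rightarrow> ('h \<Rightarrow> 'h) \<Rightarrow> 'h \<Rightarrow> 'h" where
  "adj ip D F \<psi> = (THE \<eta>. \<forall>x\<in>D. ip \<psi> (F x) = ip \<eta> x)"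

section \<open>Strongly continuous semigroups and stability\<close>

definition c0_semigroup ::
  "('k::real_or_complex \<Rightarrow> 'h::banach \<Rightarrow> 'h) \<Rightarrow> (real \<Rightarrow> 'h \<Rightarrow> 'h) \<Rightarrow> bool" where
  "c0_semigroup scaleK T \<longleftrightarrow>
     (\<forall>t\<ge>0. linear_operator scaleK scaleK UNIV (T t) \<and> (\<exists>M. \<forall>x. norm (T t x) \<le> M * norm x)) \<and>
     (\<forall>x. T 0 x = x) \<and>
     (\<forall>s\<ge>0. \<forall>t\<ge>0. \<forall>x. T (s + t) x = T s (T t x)) \<and>
     (\<forall>x. ((\<lambda>t. T t x) \<longlongrightarrow> x) (at_right 0))"

definition generates ::
  "('k::real_or_complex \<Rightarrow> 'h::banach \<Rightarrow> 'h) \<Rightarrow> 'h set \<Rightarrow> ('h \<Rightarrow> 'h) \<Rightarrow> (real \<Rightarrow> 'h \<Rightarrow> 'h) \<Rightarrow> bool" where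
  "generates scaleK D F T \<longleftrightarrow>
     c0_semigroup scaleK T \<and>
     D = {x. \<exists>y. ((\<lambda>h. (T h x - x) /\<^sub>R h) \<longlongrightarrow> y) (at_right 0)} \<and>
     (\<forall>x\<in>D. ((\<lambda>h. (T h x - x) /\<^sub>R h) \<longlongrightarrow> F x) (at_right 0))"

text \<open>\<open>Sol x0 x\<close> reads: \<open>x\<close> is a solution, on nonnegative times, with initial condition \<open>x0\<close>.\<close>

definition globally_asymptotically_stable ::
  "('x::real_normed_vector \<Rightarrow> (real \<Rightarrow> 'x) \<Rightarrow> bool) \<Rightarrow> bool" where
  "globally_asymptotically_stable Sol \<longleftrightarrow>
     (\<forall>\<epsilon>>0. \<exists>\<delta>>0. \<forall>x0 x. Sol x0 x \<and> norm x0 < \<delta> \<longrightarrow> (\<forall>t\<ge>0. norm (x t) < \<epsilon>)) \<and>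
     (\<forall>x0 x. Sol x0 x \<longrightarrow> (x \<longlongrightarrow> 0) at_top)"

section \<open>The dual of the domain of the adjoint\<close>

text \<open>Elements of the dual, with respect to the pivot space, of the domain \<open>D\<close> of an operator \<open>F\<close>
  are conjugate linear functionals on \<open>D\<close> that are bounded for the graph norm. They are
  represented by functions on the whole type of which only the values on \<open>D\<close> matter. A vector
  \<open>z\<close> is identified with the functional sending \<open>\<psi>\<close> to \<open>ip \<psi> z\<close>, which is linear in \<open>z\<close>.\<close>

definition graph_norm :: "('h::real_normed_vector \<Rightarrow> 'h) \<Rightarrow> 'h \<Rightarrow> real" where
  "graph_norm F \<psi> = sqrt ((norm \<psi>)\<^sup>2 + (norm (F \<psi>))\<^sup>2)"

definition dual_space ::
  "('k::real_or_complex \<Rightarrow> 'h::banach \<Rightarrow> 'h) \<Rightarrow> 'h set \<Rightarrow> ('h \<Rightarrow> 'h) \<Rightarrow> ('h \<Rightarrow> 'k) set" where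
  "dual_space scaleK D F =
     {f. (\<forall>\<psi>\<in>D. \<forall>\<eta>\<in>D. f (\<psi> + \<eta>) = f \<psi> + f \<eta>) \<and>
         (\<forall>c. \<forall>\<psi>\<in>D. f (scaleK c \<psi>) = kcnj c * f \<psi>) \<and>
         (\<exists>M. \<forall>\<psi>\<in>D. norm (f \<psi>) \<le> M * graph_norm F \<psi>)}"

definition dual_norm :: "'h::real_normed_vector set \<Rightarrow> ('h \<Rightarrow> 'h) \<Rightarrow> ('h \<Rightarrow> 'k::real_normed_vector) \<Rightarrow> real" where
  "dual_norm D F f = (SUP \<psi>\<in>{\<psi>\<in>D. graph_norm F \<psi> \<le> 1}. norm (f \<psi>))"

definition dual_strongly_measurable ::
  "('k::real_or_complex \<Rightarrow> 'h::banach \<Rightarrow> 'h) \<Rightarrow> 'h set \<Rightarrow> ('h \<Rightarrow> 'h) \<Rightarrow> (real \<Rightarrow> 'h \<Rightarrow> 'k) \<Rightarrow> bool" where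
  "dual_strongly_measurable scaleK D F g \<longleftrightarrow>
     (\<exists>s :: nat \<Rightarrow> real \<Rightarrow> 'h \<Rightarrow> 'k.
        (\<forall>n. finite (range (s n)) \<and> range (s n) \<subseteq> dual_space scaleK D F \<and>
             (\<forall>f. s n -` {f} \<in> sets lebesgue)) \<and>
        (AE t in lebesgue_on {0..}. (\<lambda>n. dual_norm D F (\<lambda>\<psi>. s n t \<psi> - g t \<psi>)) \<longlonglongrightarrow> 0))"

definition dual_L2_loc ::
  "('k::real_or_complex \<Rightarrow> 'h::banach \<Rightarrow> 'h) \<Rightarrow> 'h set \<Rightarrow> ('h \<Rightarrow> 'h) \<Rightarrow> (real \<Rightarrow> 'h \<Rightarrow> 'k) \<Rightarrow> bool" where
  "dual_L2_loc scaleK D F g \<longleftrightarrow>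
     (\<forall>t\<ge>0. g t \<in> dual_space scaleK D F) \<and>
     dual_strongly_measurable scaleK D F g \<and>
     (\<forall>\<tau>\<ge>0. integrable (lebesgue_on {0..\<tau>}) (\<lambda>t. (dual_norm D F (g t))\<^sup>2))"

text \<open>Integrals of dual-valued functions are computed pointwise, that is, tested against the
  elements of \<open>D\<close>. The function \<open>g\<close> is the derivative of \<open>z\<close>.\<close>

definition dual_H1_loc ::
  "('k::real_or_complex \<Rightarrow> 'h::banach \<Rightarrow> 'h) \<Rightarrow> ('h \<Rightarrow> 'h \<Rightarrow> 'k) \<Rightarrow> 'h set \<Rightarrow> ('h \<Rightarrow> 'h) \<Rightarrow> (real \<Rightarrow> 'h) \<Rightarrow> bool" where
  "dual_H1_loc scaleK ip D F z \<longleftrightarrow>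
     dual_L2_loc scaleK D F (\<lambda>t \<psi>. ip \<psi> (z t)) \<and>
     (\<exists>g. dual_L2_loc scaleK D F g \<and>
          (\<forall>t\<ge>0. \<forall>\<psi>\<in>D. ip \<psi> (z t) - ip \<psi> (z 0) = integral\<^sup>L (lebesgue_on {0..t}) (\<lambda>s. g s \<psi>)))"

section \<open>Control operators\<close>

text \<open>Bounded linear maps from the scalar field into \<open>dual_space scaleK D F\<close>.\<close>

definition control_operator ::
  "('k::real_or_complex \<Rightarrow> 'h::banach \<Rightarrow> 'h) \<Rightarrow> 'h set \<Rightarrow> ('h \<Rightarrow> 'h) \<Rightarrow> ('k \<Rightarrow> 'h \<Rightarrow> 'k) \<Rightarrow> bool" where
  "control_operator scaleK D F B \<longleftrightarrow>
     (\<forall>v. B v \<in> dual_space scaleK D F) \<and>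
     (\<forall>v w. \<forall>\<psi>\<in>D. B (v + w) \<psi> = B v \<psi> + B w \<psi>) \<and>
     (\<forall>c v. \<forall>\<psi>\<in>D. B (c * v) \<psi> = c * B v \<psi>) \<and>
     (\<exists>M. \<forall>v. dual_norm D F (B v) \<le> M * norm v)"

text \<open>The adjoint of \<open>B\<close>, characterised by \<open>B v \<psi> = adjB B \<psi> * v\<close>, i.e. the duality pairing of \<open>\<psi>\<close>
  with \<open>B v\<close> is the product of \<open>adjB B \<psi>\<close> and \<open>v\<close>. It has the same conjugate linearity in \<open>\<psi>\<close> as
  the inner product, so that the output \<open>ip \<phi> z\<close> is driven by exactly \<open>adjB B \<phi>\<close> times the input.\<close>

definition adjB :: "('k::real_or_complex \<Rightarrow> 'h \<Rightarrow> 'k) \<Rightarrow> 'h \<Rightarrow> 'k" where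
  "adjB B \<psi> = B 1 \<psi>"

text \<open>The integral from \<open>0\<close> to \<open>t\<close> of \<open>T (t - s) (B (u s))\<close> as a functional of \<open>\<psi>\<close>. The semigroup acts on
  functionals by duality, \<open>f\<close> being sent to \<open>\<lambda>\<psi>. f (T\<^sup>* \<psi>)\<close>.\<close>

definition input_map ::
  "('h \<Rightarrow> 'h \<Rightarrow> 'k) \<Rightarrow> (real \<Rightarrow> 'h \<Rightarrow> 'h) \<Rightarrow> ('k::real_or_complex \<Rightarrow> 'h \<Rightarrow> 'k) \<Rightarrow> (real \<Rightarrow> 'k) \<Rightarrow> real \<Rightarrow> 'h \<Rightarrow> 'k" where
  "input_map ip T B u t \<psi> =
     integral\<^sup>L (lebesgue_on {0..t}) (\<lambda>s. B (u s) (adj ip UNIV (T (t - s)) \<psi>))"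

definition square_integrable_on :: "(real \<Rightarrow> 'k::real_or_complex) \<Rightarrow> real set \<Rightarrow> bool" where
  "square_integrable_on u I \<longleftrightarrow>
     u \<in> borel_measurable (lebesgue_on I) \<and> integrable (lebesgue_on I) (\<lambda>s. (norm (u s))\<^sup>2)"

text \<open>The range of the input map at some positive time, a priori contained only in the dual
  of the domain of the adjoint, is contained in the state space.\<close>

definition admissible ::
  "('h::real_normed_vector \<Rightarrow> 'h \<Rightarrow> 'k) \<Rightarrow> 'h set \<Rightarrow> ('h \<Rightarrow> 'h) \<Rightarrow> (real \<Rightarrow> 'h \<Rightarrow> 'h) \<Rightarrow> ('k::real_or_complex \<Rightarrow> 'h \<Rightarrow> 'k) \<Rightarrow> bool" where
  "admissible ip DA A T B \<longleftrightarrow>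
     (\<exists>\<tau>>0. \<forall>u. square_integrable_on u {0..\<tau>} \<longrightarrow>
        (\<exists>x. \<forall>\<psi>\<in>adj_dom ip DA A. ip \<psi> x = input_map ip T B u \<tau> \<psi>))"

definition approximately_controllable ::
  "('h::real_normed_vector \<Rightarrow> 'h \<Rightarrow> 'k) \<Rightarrow> 'h set \<Rightarrow> ('h \<Rightarrow> 'h) \<Rightarrow> (real \<Rightarrow> 'h \<Rightarrow> 'h) \<Rightarrow> ('k::real_or_complex \<Rightarrow> 'h \<Rightarrow> 'k) \<Rightarrow> real \<Rightarrow> bool" where
  "approximately_controllable ip DA A T B \<tau> \<longleftrightarrow>
     (\<forall>\<psi>\<in>adj_dom ip DA A.
        (\<forall>t\<in>{0..\<tau>}. adjB B (adj ip UNIV (T (\<tau> - t)) \<psi>) = 0) \<longrightarrow> \<psi> = 0)"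

section \<open>The feedback operator\<close>

text \<open>\<open>A\<close> is extended by duality: for an arbitrary vector \<open>z\<close>, \<open>A z\<close> is the functional
  \<open>\<lambda>\<psi>. ip (A\<^sup>* \<psi>) z\<close>. The vector \<open>y\<close> below is \<open>A z + B (L z)\<close>.\<close>

definition is_feedback_value ::
  "('h::real_normed_vector \<Rightarrow> 'h \<Rightarrow> 'k) \<Rightarrow> 'h set \<Rightarrow> ('h \<Rightarrow> 'h) \<Rightarrow> ('k::real_or_complex \<Rightarrow> 'h \<Rightarrow> 'k) \<Rightarrow> ('h \<Rightarrow> 'k) \<Rightarrow> 'h \<Rightarrow> 'h \<Rightarrow> bool"
where
  "is_feedback_value ip DA A B L z y \<longleftrightarrow>
     (\<forall>\<psi>\<in>adj_dom ip DA A. ip \<psi> y = ip (adj ip DA A \<psi>) z + B (L z) \<psi>)"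

definition feedback_dom ::
  "('h::real_normed_vector \<Rightarrow> 'h \<Rightarrow> 'k) \<Rightarrow> 'h set \<Rightarrow> ('h \<Rightarrow> 'h) \<Rightarrow> ('k::real_or_complex \<Rightarrow> 'h \<Rightarrow> 'k) \<Rightarrow> 'h set \<Rightarrow> ('h \<Rightarrow> 'k) \<Rightarrow> 'h set"
where
  "feedback_dom ip DA A B DL L = {z\<in>DL. \<exists>y. is_feedback_value ip DA A B L z y}"

definition feedback_op ::
  "('h::real_normed_vector \<Rightarrow> 'h \<Rightarrow> 'k) \<Rightarrow> 'h set \<Rightarrow> ('h \<Rightarrow> 'h) \<Rightarrow> ('k::real_or_complex \<Rightarrow> 'h \<Rightarrow> 'k) \<Rightarrow> ('h \<Rightarrow> 'k) \<Rightarrow> 'h \<Rightarrow> 'h"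
where
  "feedback_op ip DA A B L z = (THE y. is_feedback_value ip DA A B L z y)"

section \<open>Standing assumptions\<close>

text \<open>The inclusion \<open>adjoint_dom_subset\<close> is what makes \<open>B\<close> act on the domain of the adjoint of the
  feedback operator; it does not follow from the other assumptions.\<close>

locale feedback_setting = hilbert_space scaleK ip
  for scaleK :: "'k::real_or_complex \<Rightarrow> 'h::banach \<Rightarrow> 'h" and ip :: "'h \<Rightarrow> 'h \<Rightarrow> 'k" +
  fixes DA :: "'h set" and A :: "'h \<Rightarrow> 'h" and T :: "real \<Rightarrow> 'h \<Rightarrow> 'h"
    and B :: "'k \<Rightarrow> 'h \<Rightarrow> 'k" and \<tau> :: real
    and DL :: "'h set" and L :: "'h \<Rightarrow> 'k" and S :: "real \<Rightarrow> 'h \<Rightarrow> 'h"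
    and \<phi> :: 'h and ev :: 'k
  assumes A_linear: "linear_operator scaleK scaleK DA A"
    and A_dense: "closure DA = UNIV"
    and B_control: "control_operator scaleK (adj_dom ip DA A) (adj ip DA A) B"
    and A_generates: "generates scaleK DA A T"
    and B_admissible: "admissible ip DA A T B"
    and \<tau>_pos: "\<tau> > 0"
    and controllable: "approximately_controllable ip DA A T B \<tau>"
    and L_linear: "linear_operator scaleK (*) DL L"
    and feedback_generates:
      "generates scaleK (feedback_dom ip DA A B DL L) (feedback_op ip DA A B L) S"
    and feedback_stable: "globally_asymptotically_stable (\<lambda>z0 z. \<forall>t\<ge>0. z t = S t z0)"
    and adjoint_dom_subset:
      "adj_dom ip (feedback_dom ip DA A B DL L) (feedback_op ip DA A B L) \<subseteq> adj_dom ip DA A"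
    and eigenvector_dom:
      "\<phi> \<in> adj_dom ip (feedback_dom ip DA A B DL L) (feedback_op ip DA A B L)"
    and eigenvector_nonzero: "\<phi> \<noteq> 0"
    and eigenvector:
      "adj ip (feedback_dom ip DA A B DL L) (feedback_op ip DA A B L) \<phi> = scaleK ev \<phi>"

section \<open>Mild solutions\<close>

text \<open>The variation of constants formula for the input \<open>u\<close>, as an identity in the dual of the
  domain of the adjoint of the feedback operator.\<close>

definition mild_trajectory ::
  "('k::real_or_complex \<Rightarrow> 'h::banach \<Rightarrow> 'h) \<Rightarrow> ('h \<Rightarrow> 'h \<Rightarrow> 'k) \<Rightarrow> 'h set \<Rightarrow> ('h \<Rightarrow> 'h) \<Rightarrow>
   ('k \<Rightarrow> 'h \<Rightarrow> 'k) \<Rightarrow> 'h set \<Rightarrow> ('h \<Rightarrow> 'k) \<Rightarrow> (real \<Rightarrow> 'h \<Rightarrow> 'h) \<Rightarrow> 'h \<Rightarrow> (real \<Rightarrow> 'k) \<Rightarrow> (real \<Rightarrow> 'h) \<Rightarrow> bool"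
where
  "mild_trajectory scaleK ip DA A B DL L S z0 u z \<longleftrightarrow>
     continuous_on {0..} z \<and>
     dual_H1_loc scaleK ip (adj_dom ip DA A) (adj ip DA A) z \<and>
     (\<forall>t\<ge>0. \<forall>\<psi>\<in>adj_dom ip (feedback_dom ip DA A B DL L) (feedback_op ip DA A B L).
        ip \<psi> (z t) = ip \<psi> (S t z0) + input_map ip S B u t \<psi>)"

definition sliding_mode_solution ::
  "('k::real_or_complex \<Rightarrow> 'h::banach \<Rightarrow> 'h) \<Rightarrow> ('h \<Rightarrow> 'h \<Rightarrow> 'k) \<Rightarrow> 'h set \<Rightarrow> ('h \<Rightarrow> 'h) \<Rightarrow>
   ('k \<Rightarrow> 'h \<Rightarrow> 'k) \<Rightarrow> 'h set \<Rightarrow> ('h \<Rightarrow> 'k) \<Rightarrow> (real \<Rightarrow> 'h \<Rightarrow> 'h) \<Rightarrow> 'h \<Rightarrow> 'k \<Rightarrow> real \<Rightarrow> (real \<Rightarrow> 'k) \<Rightarrow>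
   'h \<Rightarrow> (real \<Rightarrow> 'h) \<Rightarrow> bool"
where
  "sliding_mode_solution scaleK ip DA A B DL L S \<phi> ev K d z0 z \<longleftrightarrow>
     (\<exists>h. h \<in> borel_measurable (lebesgue_on {0..}) \<and>
          (\<forall>t\<ge>0. square_integrable_on h {0..t}) \<and>
          mild_trajectory scaleK ip DA A B DL L S z0 h z \<and>
          (AE t in lebesgue_on {0..}. \<exists>\<xi>\<in>ksign (ip \<phi> (z t)).
             h t = - (1 / adjB B \<phi>) * (ev * ip \<phi> (z t) + of_real K * \<xi>) + d t))"

definition absolutely_continuous_on :: "real set \<Rightarrow> (real \<Rightarrow> real) \<Rightarrow> bool" where
  "absolutely_continuous_on I f \<longleftrightarrow>
     (\<forall>\<epsilon>>0. \<exists>\<delta>>0. \<forall>(n::nat) a b.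
        (\<forall>i<n. a i \<in> I \<and> b i \<in> I \<and> a i \<le> b i) \<and>
        (\<forall>i<n. \<forall>j<n. i \<noteq> j \<longrightarrow> {a i<..<b i} \<inter> {a j<..<b j} = {}) \<and>
        (\<Sum>i<n. b i - a i) < \<delta> \<longrightarrow>
        (\<Sum>i<n. \<bar>f (b i) - f (a i)\<bar>) < \<epsilon>)"

text \<open>In the continuous part of the control, the square root vanishes where the sign is
  multivalued, so the single-valued \<open>sgn\<close> can be used there.\<close>

definition super_twisting_solution ::
  "('h::{real_inner,banach}) set \<Rightarrow> ('h \<Rightarrow> 'h) \<Rightarrow> (real \<Rightarrow> 'h \<Rightarrow> real) \<Rightarrow> 'h set \<Rightarrow> ('h \<Rightarrow> real) \<Rightarrow>
   (real \<Rightarrow> 'h \<Rightarrow> 'h) \<Rightarrow> 'h \<Rightarrow> real \<Rightarrow> real \<Rightarrow> real \<Rightarrow> (real \<Rightarrow> real) \<Rightarrow>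
   'h \<times> real \<Rightarrow> (real \<Rightarrow> 'h \<times> real) \<Rightarrow> bool"
where
  "super_twisting_solution DA A B DL L S \<phi> ev \<alpha> \<beta> d x0 x \<longleftrightarrow>
     (let z = fst \<circ> x; w = snd \<circ> x; \<sigma> = (\<lambda>t. \<phi> \<bullet> z t) in
        mild_trajectory (*\<^sub>R) (\<bullet>) DA A B DL L S (fst x0)
          (\<lambda>t. (1 / adjB B \<phi>) * (- ev * \<sigma> t - \<alpha> * sqrt \<bar>\<sigma> t\<bar> * sgn (\<sigma> t) + w t)) z \<and>
        (\<forall>\<tau>\<ge>0. absolutely_continuous_on {0..\<tau>} w) \<and>
        w 0 = snd x0 \<and>
        (AE t in lebesgue_on {0..}. \<exists>\<xi>\<in>ksign (\<sigma> t).
           (w has_real_derivative adjB B \<phi> * deriv d t - \<beta> * \<xi>) (at t)))"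

end

theory Submission
  imports Defs
begin

text \<open>Everything is read off the output \<open>\<sigma> t = ip \<phi> (z t)\<close>. Since \<open>\<phi>\<close> is an eigenvector of the adjoint
of the feedback operator, the output solves a scalar equation
\<open>\<sigma>' = kcnj ev * \<sigma> + b * h\<close>, where \<open>h\<close> is the total input and \<open>b = B 1 \<phi>\<close> is nonzero by
controllability. Both control laws drive \<open>\<sigma>\<close> to zero in a finite time that tends to zero with the
initial state. From then on the scalar equation says that the integral of \<open>h\<close> over every interval
vanishes, so the input is invisible to the state, which follows the stable semigroup \<open>S\<close>
(\<open>free_evolution_if_output_zero\<close>). This gives convergence. For Lyapunov stability it remains to
control the state during the short transient, where the input need not be small.

The bound on the transient (\<open>short_time_bound\<close>) has to come from the admissibility of \<open>B\<close>, which is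
an assumption on the open-loop semigroup \<open>T\<close>, whereas mild solutions are written with \<open>S\<close>.
The key to the passage from one to the other is that the inclusion of the domain of the adjoint
feedback operator in the domain of \<open>A\<^sup>*\<close>, together with \<open>b \<noteq> 0\<close>, forces \<open>L\<close> to be given by a vector
\<open>l\<close>: testing the feedback operator with \<open>\<phi>\<close> gives \<open>L z * b = ip (A\<^sub>L\<^sup>* \<phi> - A\<^sup>* \<phi>) z\<close>. Consequently
both adjoints have the same domain and differ by the rank-one term \<open>B 1 \<psi>\<close> times \<open>l\<close>, and a
closed-loop trajectory with input \<open>h\<close> is an open-loop trajectory with input \<open>h + ip l z\<close>.
Admissibility, the uniform boundedness principle and a singular weight show that the kernel
\<open>B 1 (T\<^sup>* t \<psi>)\<close> has an arbitrarily small integral near \<open>t = 0\<close>, uniformly for \<open>\<psi>\<close> in the unit ball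
(\<open>admissible_imp_small_integral\<close>). The term \<open>ip l z\<close> can therefore be absorbed, and a bounded input
moves the state only a little in a short time.

Trajectories are compared in time-integrated form, tested against vectors of the common domain:
\<open>integrated_equation_if_mild\<close> leads from a mild formula to an integrated equation and
\<open>variation_of_constants_integrated\<close> leads back. The functional \<open>B 1\<close> is represented by two vectors
of the state space through the graph of the adjoint (Riesz), which turns all kernels into
continuous scalar functions.

Extinction of the output is a statement about scalars. In the sliding mode case \<open>norm (\<sigma> t)\<close>
decreases at a rate bounded below by \<open>(K - norm b * K\<^sub>d) / 2\<close>, because \<open>kcnj ev - ev\<close> is purely
imaginary and contributes nothing. In the super-twisting case, with \<open>r\<close> the signed square root of
\<open>\<sigma>\<close>, the pair \<open>(\<sigma>, w)\<close> obeys \<open>\<sigma>' = w - \<alpha> * r\<close> and \<open>w' = - \<mu> * sgn \<sigma>\<close> with an unknown \<open>\<mu>\<close>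
between \<open>p = \<beta> - norm b * C\<close> and \<open>q = \<beta> + norm b * C\<close>. The square root of
\<open>w\<^sup>2 + 4/3 * max 0 (\<alpha> * r * (\<alpha> * r - w))\<close> then decreases at a rate bounded below, precisely because
\<open>0 < p\<close> and \<open>q < \<alpha>\<^sup>2\<close> (\<open>st_dissipation\<close>).\<close>

section \<open>The scalar field\<close>

lemma to_complex_0 [simp]: "to_complex 0 = 0"
  using to_complex_add[of 0 0] by simp

lemma to_complex_1 [simp]: "to_complex (1::'k::real_or_complex) = 1"
proof -
  have "to_complex (1::'k) \<noteq> 0"
    using norm_to_complex[of "1::'k"] by auto
  with to_complex_mult[of "1::'k" 1] show ?thesis by simp
qed

lemma to_complex_of_real [simp]: "to_complex (of_real r :: 'k::real_or_complex) = of_real r"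
  by (simp add: of_real_def to_complex_scaleR)

lemma to_complex_minus: "to_complex (- x) = - to_complex x"
  using to_complex_add[of x "- x"] by (simp add: eq_neg_iff_add_eq_0 add.commute)

lemma to_complex_diff: "to_complex (x - y) = to_complex x - to_complex y"
  using to_complex_add[of x "- y"] by (simp add: to_complex_minus)

lemma to_complex_eq_iff [simp]: "to_complex x = to_complex y \<longleftrightarrow> x = y"
proof
  assume "to_complex x = to_complex y"
  then have "norm (x - y) = 0"
    by (subst norm_to_complex[symmetric]) (simp add: to_complex_diff)
  then show "x = y" by simp
qed simp

lemma to_complex_kcnj [simp]: "to_complex (kcnj x) = cnj (to_complex x)"
proof -
  have "cnj (to_complex x) \<in> range (to_complex :: 'a \<Rightarrow> complex)"
    using range_to_complex[where 'a = 'a]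
    by (metis Reals_cnj_iff UNIV_I rangeI)
  then show ?thesis by (simp add: kcnj_def f_inv_into_f)
qed

lemma kcnj_add: "kcnj (x + y) = kcnj x + kcnj y"
  by (subst to_complex_eq_iff[symmetric]) (simp add: to_complex_add)

lemma kcnj_diff: "kcnj (x - y) = kcnj x - kcnj y"
  by (subst to_complex_eq_iff[symmetric]) (simp add: to_complex_diff)

lemma kcnj_mult: "kcnj (x * y) = kcnj x * kcnj y"
  by (subst to_complex_eq_iff[symmetric]) (simp add: to_complex_mult)

lemma kcnj_kcnj [simp]: "kcnj (kcnj x) = x"
  by (subst to_complex_eq_iff[symmetric]) simp

lemma kcnj_of_real [simp]: "kcnj (of_real r) = of_real r"
  by (subst to_complex_eq_iff[symmetric]) simp

lemma kcnj_0 [simp]: "kcnj 0 = 0"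
  by (subst to_complex_eq_iff[symmetric]) simp

lemma norm_kcnj [simp]: "norm (kcnj x) = norm x"
  by (subst (1 2) norm_to_complex[symmetric]) simp

lemma kcnj_mult_self: "kcnj x * x = of_real ((norm x)\<^sup>2)"
proof -
  have "to_complex (kcnj x * x) = of_real ((norm (to_complex x))\<^sup>2)"
    unfolding to_complex_mult to_complex_kcnj complex_norm_square by (rule mult.commute)
  then have "to_complex (kcnj x * x) = to_complex (of_real ((norm x)\<^sup>2) :: 'a)"
    unfolding norm_to_complex to_complex_of_real .
  then show ?thesis unfolding to_complex_eq_iff .
qed

lemma bounded_linear_kcnj: "bounded_linear (kcnj :: 'k::real_or_complex \<Rightarrow> 'k)"
  by (rule bounded_linear_intro[where K = 1])
     (auto simp: kcnj_add kcnj_mult scaleR_conv_of_real)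

lemma continuous_on_kcnj [continuous_intros]:
  "continuous_on A f \<Longrightarrow> continuous_on A (\<lambda>x. kcnj (f x :: 'k::real_or_complex))"
  by (rule bounded_linear.continuous_on[OF bounded_linear_kcnj])

definition kre :: "'k::real_or_complex \<Rightarrow> real" where "kre x = Re (to_complex x)"

lemma kre_le_norm: "kre x \<le> norm x"
  unfolding kre_def by (metis norm_to_complex complex_Re_le_cmod)

lemma abs_kre_le_norm: "\<bar>kre x\<bar> \<le> norm x"
  unfolding kre_def by (metis norm_to_complex abs_Re_le_cmod)

lemma bounded_linear_kre: "bounded_linear (kre :: 'k::real_or_complex \<Rightarrow> real)"
  by (rule bounded_linear_intro[where K = 1])
     (use abs_kre_le_norm in \<open>auto simp: kre_def to_complex_add to_complex_scaleR\<close>)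

lemma kre_of_real [simp]: "kre (of_real r) = r"
  by (simp add: kre_def)

lemma kre_kcnj [simp]: "kre (kcnj x) = kre x"
  by (simp add: kre_def)

lemma kre_add: "kre (x + y) = kre x + kre y"
  by (simp add: kre_def to_complex_add)

lemma kre_diff: "kre (x - y) = kre x - kre y"
  by (simp add: kre_def to_complex_diff)

lemma kre_minus: "kre (- x) = - kre x"
  using kre_diff[of 0 x] by (simp add: kre_def)

lemma kre_of_real_mult [simp]: "kre (of_real r * x) = r * kre x"
  by (simp add: kre_def to_complex_mult)

lemma norm_add_square_scalar:
  fixes x y :: "'k::real_or_complex"
  shows "(norm (x + y))\<^sup>2 = (norm x)\<^sup>2 + 2 * kre (kcnj x * y) + (norm y)\<^sup>2"
proof -
  have "kre (of_real ((norm (x + y))\<^sup>2) :: 'k) = kre (kcnj (x + y) * (x + y))"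
    by (simp only: kcnj_mult_self)
  also have "\<dots> = kre (kcnj x * x) + kre (kcnj x * y) + kre (kcnj y * x) + kre (kcnj y * y)"
    by (simp add: kcnj_add distrib_left distrib_right kre_add)
  also have "kre (kcnj y * x) = kre (kcnj x * y)"
    using kre_kcnj[of "kcnj y * x"] by (simp add: kcnj_mult mult.commute)
  finally show ?thesis by (simp only: kre_of_real kcnj_mult_self)
qed

section \<open>Hilbert spaces and the Riesz representation theorem\<close>

context hilbert_space begin

lemma ip_0_right [simp]: "ip x 0 = 0"
  using ip_add_right[of x 0 0] by simp

lemma ip_diff_right: "ip x (y - z) = ip x y - ip x z"
  using ip_add_right[of x "y - z" z] by simp

lemma ip_add_left: "ip (x + y) z = ip x z + ip y z"
  by (metis ip_commute ip_add_right kcnj_add)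

lemma ip_diff_left: "ip (x - y) z = ip x z - ip y z"
  by (metis ip_commute ip_diff_right kcnj_diff)

lemma ip_0_left [simp]: "ip 0 x = 0"
  by (metis ip_commute ip_0_right kcnj_0)

lemma ip_scale_left: "ip (scaleK c x) y = kcnj c * ip x y"
  by (metis ip_commute ip_scale_right kcnj_mult)

lemma ip_scaleR_right: "ip x (r *\<^sub>R y) = of_real r * ip x y"
  by (metis ip_scale_right scaleK_of_real)

lemma ip_scaleR_left: "ip (r *\<^sub>R x) y = of_real r * ip x y"
  by (metis ip_scale_left scaleK_of_real kcnj_of_real)

lemma norm_add_square: "(norm (x + y))\<^sup>2 = (norm x)\<^sup>2 + 2 * kre (ip x y) + (norm y)\<^sup>2"
proof -
  have "of_real ((norm (x + y))\<^sup>2) = ip x x + (ip x y + kcnj (ip x y)) + ip y y"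
    unfolding ip_self[symmetric] ip_add_left ip_add_right ip_commute[of y x, symmetric]
    by (simp add: ip_commute[symmetric])
  then have "kre (of_real ((norm (x + y))\<^sup>2) :: 'k) = kre (ip x x + (ip x y + kcnj (ip x y)) + ip y y)"
    by simp
  then show ?thesis by (simp only: kre_add kre_of_real kre_kcnj ip_self)
qed

lemma norm_scaleK: "norm (scaleK c x) = norm c * norm x"
proof -
  have "of_real ((norm (scaleK c x))\<^sup>2) = kcnj c * c * ip x x"
    unfolding ip_self[symmetric] ip_scale_left by (simp only: ip_scale_right mult.assoc)
  also have "\<dots> = (of_real ((norm c * norm x)\<^sup>2) :: 'k)"
    unfolding kcnj_mult_self ip_self of_real_mult[symmetric] power_mult_distrib ..
  finally have "(norm (scaleK c x))\<^sup>2 = (norm c * norm x)\<^sup>2" by (simp only: of_real_eq_iff)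
  then show ?thesis by (simp add: power2_eq_iff_nonneg)
qed

lemma Cauchy_Schwarz: "norm (ip x y) \<le> norm x * norm y"
proof (cases "x = 0")
  case False
  define c where "c = - ip x y / of_real ((norm x)\<^sup>2)"
  have 1: "ip y (scaleK c x) = - of_real ((norm (ip x y))\<^sup>2 / (norm x)\<^sup>2)"
    using kcnj_mult_self[of "ip x y"] unfolding ip_scale_right ip_commute[of y x] c_def
    by (simp add: mult.commute)
  have "0 \<le> (norm (y + scaleK c x))\<^sup>2" by simp
  also have "\<dots> = (norm y)\<^sup>2 + 2 * kre (ip y (scaleK c x)) + (norm (scaleK c x))\<^sup>2"
    by (rule norm_add_square)
  also have "kre (ip y (scaleK c x)) = - ((norm (ip x y))\<^sup>2 / (norm x)\<^sup>2)"
    unfolding 1 of_real_minus[symmetric] kre_of_real ..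
  also have "(norm (scaleK c x))\<^sup>2 = (norm (ip x y))\<^sup>2 / (norm x)\<^sup>2"
  proof -
    have "norm c = norm (ip x y) / (norm x)\<^sup>2" unfolding c_def norm_divide norm_minus_cancel norm_of_real by simp
    then show ?thesis using False by (simp add: norm_scaleK power_mult_distrib power_divide power2_eq_square)
  qed
  finally have "(norm (ip x y))\<^sup>2 \<le> (norm x)\<^sup>2 * (norm y)\<^sup>2"
    using False by (simp add: field_simps)
  then show ?thesis by (metis power_mult_distrib power2_le_imp_le mult_nonneg_nonneg norm_ge_zero)
qed simp

lemma bounded_linear_ip: "bounded_linear (ip x)"
  by (rule bounded_linear_intro[where K = "norm x"])
     (use Cauchy_Schwarz[of x] in \<open>auto simp: ip_add_right ip_scaleR_right scaleR_conv_of_real mult.commute[of _ "norm x"]\<close>)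

lemma continuous_on_ip [continuous_intros]:
  "continuous_on X f \<Longrightarrow> continuous_on X (\<lambda>t. ip x (f t))"
  by (rule bounded_linear.continuous_on[OF bounded_linear_ip])

lemma tendsto_ip: "(f \<longlongrightarrow> l) X \<Longrightarrow> ((\<lambda>t. ip x (f t)) \<longlongrightarrow> ip x l) X"
  by (rule bounded_linear.tendsto[OF bounded_linear_ip])

lemma ip_eq_imp_eq:
  assumes "\<And>x. ip x y = ip x z" shows "y = z"
proof -
  have "ip (y - z) (y - z) = 0" by (simp add: ip_diff_right assms)
  then have "(norm (y - z))\<^sup>2 = 0" unfolding ip_self by (simp only: of_real_eq_0_iff)
  then show ?thesis by simp
qed

lemma norm_le_if_ip_le:
  assumes "\<And>x. norm (ip x y) \<le> C * norm x" and "C \<ge> 0"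
  shows "norm y \<le> C"
proof (cases "y = 0")
  case False
  then show ?thesis using assms(1)[of y] unfolding ip_self norm_of_real by (simp add: power2_eq_square)
qed (use assms in simp)

lemma ip_minus_right: "ip x (- y) = - ip x y"
  using ip_diff_right[of x 0 y] by simp

lemma parallelogram: "(norm (x - y :: 'h))\<^sup>2 = 2 * (norm x)\<^sup>2 + 2 * (norm y)\<^sup>2 - (norm (x + y))\<^sup>2"
  using norm_add_square[of x y] norm_add_square[of x "- y"]
  by (simp add: ip_minus_right kre_minus)

text \<open>The representing vector minimises \<open>J x = (norm x)\<^sup>2 - 2 * kre (f x)\<close>: by the parallelogram law a
minimising sequence in \<open>M\<close> is Cauchy, and \<open>f x = ip x y\<close> is the vanishing of the derivative of \<open>J\<close>
at its limit \<open>y\<close>. The limit may leave \<open>M\<close>, so that \<open>M\<close> can be a dense domain or the graph of an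
operator.\<close>

theorem Riesz_representation:
  assumes M: "subspace M"
    and add: "\<And>x y. x \<in> M \<Longrightarrow> y \<in> M \<Longrightarrow> f (x + y) = f x + f y"
    and scale: "\<And>c x. x \<in> M \<Longrightarrow> f (scaleK c x) = kcnj c * f x"
    and bound: "\<And>x. x \<in> M \<Longrightarrow> norm (f x) \<le> C * norm x"
  shows "\<exists>y. \<forall>x\<in>M. f x = ip x y"
proof -
  have M_add: "x + y \<in> M" if "x \<in> M" "y \<in> M" for x y using M that by (rule_tac subspace_add)
  have M_scaleK: "scaleK c x \<in> M" if "x \<in> M" for c x using M that by (rule_tac subspace_scale)
  have M_scale: "r *\<^sub>R x \<in> M" if "x \<in> M" for r x using M_scaleK[OF that] by (metis scaleK_of_real)
  have f_scale: "f (r *\<^sub>R x) = of_real r * f x" if "x \<in> M" for r x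
    using scale[OF that] by (metis scaleK_of_real kcnj_of_real)
  define J where "J x = (norm x)\<^sup>2 - 2 * kre (f x)" for x
  define m where "m = Inf (J ` M)"
  have lower: "- C\<^sup>2 \<le> J x" if "x \<in> M" for x
  proof -
    have "kre (f x) \<le> C * norm x" using kre_le_norm bound[OF that] order_trans by blast
    moreover have "0 \<le> (norm x - C)\<^sup>2" by simp
    ultimately show ?thesis unfolding J_def by (simp add: power2_diff mult_ac)
  qed
  have "0 \<in> M" using M by (simp add: subspace_0)
  have bdd: "bdd_below (J ` M)" by (rule bdd_belowI2[OF lower])
  have m_le: "m \<le> J x" if "x \<in> M" for x unfolding m_def using bdd that by (rule cINF_lower)
  have "\<exists>x\<in>M. J x < m + 1 / real (Suc n)" for n
    using cInf_lessD[of "J ` M" "m + 1 / real (Suc n)"] \<open>0 \<in> M\<close> unfolding m_def[symmetric] by auto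
  then obtain x where x: "\<And>n. x n \<in> M" "\<And>n. J (x n) < m + 1 / real (Suc n)" by metis
  have close: "(norm (y - z))\<^sup>2 \<le> 2 * (J y - m) + 2 * (J z - m)" if "y \<in> M" "z \<in> M" for y z
  proof -
    have "m \<le> J ((1/2) *\<^sub>R (y + z))" using that by (intro m_le M_scale M_add)
    also have "\<dots> = (norm (y + z))\<^sup>2 / 4 - kre (f y) - kre (f z)"
      using that by (simp add: J_def f_scale M_add add power_divide kre_add add_divide_distrib del: of_real_divide scaleR_add_right)
    finally show ?thesis unfolding J_def parallelogram by simp
  qed
  have "Cauchy x"
  proof (rule CauchyI)
    fix e :: real assume "e > 0"
    then obtain N where N: "4 / real (Suc N) < e\<^sup>2"
      using reals_Archimedean[of "e\<^sup>2 / 4"] by (auto simp: field_simps)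
    have "norm (x i - x j) < e" if "N \<le> i" "N \<le> j" for i j
    proof -
      have "1 / real (Suc i) \<le> 1 / real (Suc N)" "1 / real (Suc j) \<le> 1 / real (Suc N)"
        using that by (auto simp: field_simps)
      then have "(norm (x i - x j))\<^sup>2 < e\<^sup>2"
        using close[OF x(1)[of i] x(1)[of j]] x(2)[of i] x(2)[of j] N by simp
      then show ?thesis using \<open>e > 0\<close> by (simp add: power_less_imp_less_base)
    qed
    then show "\<exists>N. \<forall>i\<ge>N. \<forall>j\<ge>N. norm (x i - x j) < e" by blast
  qed
  then obtain y where y: "x \<longlonglongrightarrow> y" by (auto simp: Cauchy_convergent_iff convergent_def)
  have real_part: "kre (ip z y) = kre (f z)" if "z \<in> M" for z
  proof (rule ccontr)
    assume neq: "kre (ip z y) \<noteq> kre (f z)"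
    define a where "a = kre (ip z y) - kre (f z)"
    have ineq: "0 \<le> 2 * t * a + t\<^sup>2 * (norm z)\<^sup>2" for t
    proof (rule LIMSEQ_le_const)
      have "(\<lambda>n. 2 * t * (kre (ip z (x n)) - kre (f z)) + t\<^sup>2 * (norm z)\<^sup>2 + 1 / real (Suc n))
          \<longlonglongrightarrow> 2 * t * a + t\<^sup>2 * (norm z)\<^sup>2 + 0"
        unfolding a_def
        by (intro tendsto_intros LIMSEQ_Suc[OF lim_1_over_n] tendsto_ip y
            bounded_linear.tendsto[OF bounded_linear_kre])
      then show "(\<lambda>n. 2 * t * (kre (ip z (x n)) - kre (f z)) + t\<^sup>2 * (norm z)\<^sup>2 + 1 / real (Suc n))
          \<longlonglongrightarrow> 2 * t * a + t\<^sup>2 * (norm z)\<^sup>2" by simp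
      have "0 \<le> 2 * t * (kre (ip z (x n)) - kre (f z)) + t\<^sup>2 * (norm z)\<^sup>2 + 1 / real (Suc n)" for n
      proof -
        have "J (x n) - 1 / real (Suc n) < J (t *\<^sub>R z + x n)"
          using m_le[OF M_add[OF M_scale[OF that, of t] x(1)[of n]]] x(2)[of n] by linarith
        then show ?thesis
          using that norm_add_square[of "t *\<^sub>R z" "x n"]
          by (simp add: J_def add M_scale x f_scale kre_add ip_scaleR_left
              power_mult_distrib right_diff_distrib)
      qed
      then show "\<exists>N. \<forall>n\<ge>N. 0 \<le> 2 * t * (kre (ip z (x n)) - kre (f z)) + t\<^sup>2 * (norm z)\<^sup>2 + 1 / real (Suc n)"
        by blast
    qed
    \<comment> \<open>The minimiser of \<open>2 * t * a + t\<^sup>2 * ((norm z)\<^sup>2 + 1)\<close>; the summand 1 avoids the case \<open>z = 0\<close>.\<close>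
    define t where "t = - a / ((norm z)\<^sup>2 + 1)"
    have pos: "(norm z)\<^sup>2 + 1 > 0" by (simp add: add_nonneg_pos)
    have "0 \<le> (2 * t * a + t\<^sup>2 * (norm z)\<^sup>2) * ((norm z)\<^sup>2 + 1)\<^sup>2"
      using ineq[of t] by (intro mult_nonneg_nonneg) auto
    also have "\<dots> = - a\<^sup>2 * ((norm z)\<^sup>2 + 2)"
    proof -
      define N where "N = (norm z)\<^sup>2 + 1"
      have "(2 * t * a + t\<^sup>2 * (norm z)\<^sup>2) * N\<^sup>2 = 2 * (t * N) * a * N + (t * N)\<^sup>2 * (norm z)\<^sup>2"
        by (simp add: power2_eq_square algebra_simps)
      also have "t * N = - a" using pos by (simp add: t_def N_def)
      also have "2 * (- a) * a * N + (- a)\<^sup>2 * (norm z)\<^sup>2 = - a\<^sup>2 * ((norm z)\<^sup>2 + 2)"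
        unfolding N_def by (simp add: power2_eq_square algebra_simps)
      finally show ?thesis unfolding N_def .
    qed
    also have "\<dots> < 0" using neq unfolding a_def by (simp add: add_nonneg_pos)
    finally show False by simp
  qed
  have "f z = ip z y" if "z \<in> M" for z
  proof -
    define c where "c = ip z y - f z"
    have "kre (ip (scaleK c z) y) = kre (f (scaleK c z))" by (rule real_part[OF M_scaleK[OF that]])
    then have "kre (kcnj c * c) = 0"
      unfolding ip_scale_left scale[OF that] c_def by (simp add: right_diff_distrib kre_diff)
    then have "c = 0" unfolding kcnj_mult_self kre_of_real by simp
    then show ?thesis by (simp add: c_def)
  qed
  then show ?thesis by blast
qed

text \<open>The product carries the norm that restricts to the graph norm on the graph of an operator, so the
Riesz theorem applies to functionals that are bounded for the graph norm.\<close>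

lemma hilbert_space_prod:
  "hilbert_space (\<lambda>c x. (scaleK c (fst x), scaleK c (snd x))) (\<lambda>x y. ip (fst x) (fst y) + ip (snd x) (snd y))"
proof (unfold_locales, goal_cases)
  case 5
  show ?case by (simp add: prod_eq_iff scaleK_of_real)
next
  case 6
  show ?case by (simp only: fst_add snd_add ip_add_right add_ac)
next
  case 7
  show ?case by (simp add: ip_scale_right distrib_left)
next
  case (8 x y)
  show ?case by (simp only: kcnj_add ip_commute[symmetric])
next
  case (9 x)
  show ?case by (cases x) (simp add: ip_self norm_Pair)
qed (simp_all add: scale_right_distrib scale_left_distrib scaleK_of_real ip_add_right ip_scale_right
    distrib_left prod_eq_iff add_ac plus_prod_def)

end

section \<open>The uniform boundedness principle\<close>

instance bcontfun :: (metric_space, banach) banach ..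

text \<open>The sets on which all members of the family are bounded by \<open>n\<close> are closed and cover the space,
so by Baire one of them contains a ball; differences of points of the ball give the bound.\<close>

theorem Banach_Steinhaus:
  fixes f :: "'i \<Rightarrow> 'a::banach \<Rightarrow> 'b::real_normed_vector"
  assumes lin: "\<And>i. i \<in> I \<Longrightarrow> bounded_linear (f i)"
    and bdd: "\<And>x. \<exists>C. \<forall>i\<in>I. norm (f i x) \<le> C"
  shows "\<exists>C. \<forall>i\<in>I. \<forall>x. norm (f i x) \<le> C * norm x"
proof -
  define E where "E n = (\<Inter>i\<in>I. {x. norm (f i x) \<le> real n})" for n
  have clE: "closed (E n)" for n
    unfolding E_def
    by (intro closed_INT ballI closed_Collect_le continuous_intros)
       (auto intro: linear_continuous_on lin)
  have "\<exists>n. interior (E n) \<noteq> {}"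
  proof (rule ccontr)
    assume "\<not> ?thesis"
    then have "euclidean interior_of \<Union>(range E) = {}"
      using Met_TC.metric_Baire_category_alt[where 'a = 'a, of "range E"] clE by auto
    moreover have "\<Union>(range E) = UNIV"
    proof -
      have "\<exists>n. x \<in> E n" for x
      proof -
        obtain C where "\<forall>i\<in>I. norm (f i x) \<le> C" using bdd by blast
        then have "x \<in> E (nat \<lceil>C\<rceil>)" unfolding E_def by (auto intro: order_trans real_nat_ceiling_ge)
        then show ?thesis by blast
      qed
      then show ?thesis by auto
    qed
    ultimately show False by simp
  qed
  then obtain n x0 where "x0 \<in> interior (E n)" by blast
  then obtain r where r: "r > 0" "cball x0 r \<subseteq> E n"
    by (meson interior_subset open_contains_cball open_interior order_trans)
  have "norm (f i x) \<le> (2 * real n / r) * norm x" if "i \<in> I" for i x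
  proof (cases "x = 0")
    case False
    interpret fi: bounded_linear "f i" using lin that .
    define y where "y = (r / norm x) *\<^sub>R x"
    have "x0 + y \<in> E n" "x0 \<in> E n" using r False by (auto simp: y_def dist_norm subset_iff)
    then have "norm (f i (x0 + y)) \<le> real n" "norm (f i x0) \<le> real n" using that by (auto simp: E_def)
    then have "norm (f i y) \<le> 2 * real n"
      using norm_triangle_ineq4[of "f i (x0 + y)" "f i x0"] by (simp add: fi.add)
    then show ?thesis using r False by (simp add: y_def fi.scaleR field_simps)
  qed (use lin[OF that] in \<open>simp add: bounded_linear.linear linear_0\<close>)
  then show ?thesis by blast
qed

section \<open>Difference quotients and adjoints\<close>

lemma has_vector_derivative_iff_quotient:
  "(f has_vector_derivative f') (at x within S) \<longleftrightarrow>
     ((\<lambda>y. (f y - f x) /\<^sub>R (y - x)) \<longlongrightarrow> f') (at x within S)"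
proof -
  have eq: "\<forall>\<^sub>F y in at x within S. norm (f y - f x - (y - x) *\<^sub>R f') / norm (y - x) = norm ((f y - f x) /\<^sub>R (y - x) - f')"
    unfolding eventually_at_filter
  proof (intro always_eventually allI impI)
    fix y assume "y \<noteq> x"
    then have "(f y - f x) /\<^sub>R (y - x) - f' = (f y - f x - (y - x) *\<^sub>R f') /\<^sub>R (y - x)"
      by (simp add: scaleR_diff_right)
    then show "norm (f y - f x - (y - x) *\<^sub>R f') / norm (y - x) = norm ((f y - f x) /\<^sub>R (y - x) - f')"
      by (simp add: divide_inverse mult.commute)
  qed
  have "(f has_vector_derivative f') (at x within S) \<longleftrightarrow>
      ((\<lambda>y. norm (f y - f x - (y - x) *\<^sub>R f') / norm (y - x)) \<longlongrightarrow> 0) (at x within S)"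
    unfolding has_vector_derivative_def has_derivative_iff_norm by (simp add: bounded_linear_scaleR_left)
  also have "\<dots> \<longleftrightarrow> ((\<lambda>y. norm ((f y - f x) /\<^sub>R (y - x) - f')) \<longlongrightarrow> 0) (at x within S)"
    by (rule filterlim_cong[OF refl refl eq])
  finally show ?thesis unfolding tendsto_norm_zero_iff LIM_zero_iff .
qed

lemma difference_quotient_at_right:
  assumes "(f has_vector_derivative f') (at_right r)"
  shows "((\<lambda>h. (f (r + h) - f r) /\<^sub>R h) \<longlongrightarrow> f') (at_right 0)"
  using assms[unfolded has_vector_derivative_iff_quotient]
  unfolding at_right_to_0[of r] filterlim_filtermap by (simp add: add.commute)

lemma integral_shift_banach:
  fixes f :: "real \<Rightarrow> 'a::banach"
  shows "integral {a..b} (\<lambda>x. f (c + x)) = integral {a + c..b + c} f"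
  using integral_shift_Icc_real[of a b f c] by (simp add: o_def)

context hilbert_space begin

lemma adj_dom_iff:
  "\<psi> \<in> adj_dom ip D F \<longleftrightarrow> (\<exists>c. \<forall>x\<in>D. norm (ip \<psi> (F x)) \<le> c * norm x)"
proof
  assume "\<exists>c. \<forall>x\<in>D. norm (ip \<psi> (F x)) \<le> c * norm x"
  then obtain c where c: "\<And>x. x \<in> D \<Longrightarrow> norm (ip \<psi> (F x)) \<le> c * norm x" by blast
  have "norm (ip \<psi> (F x)) \<le> max c 1 * norm x" if "x \<in> D" for x
    using c[OF that] mult_right_mono[of c "max c 1" "norm x"] by simp
  then show "\<psi> \<in> adj_dom ip D F" unfolding adj_dom_def by (auto intro!: exI[of _ "max c 1"])
qed (auto simp: adj_dom_def)

lemma ip_eqI_dense: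
  assumes "closure D = UNIV" and "\<And>x. x \<in> D \<Longrightarrow> ip y x = ip z x"
  shows "y = z"
proof -
  have "closed {x. ip y x = ip z x}"
    by (intro closed_Collect_eq continuous_intros)
  then have "closure D \<subseteq> {x. ip y x = ip z x}"
    using assms(2) by (intro closure_minimal) auto
  then have "ip y x = ip z x" for x using assms(1) by auto
  then have "ip x y = ip x z" for x by (metis ip_commute)
  then show ?thesis by (rule ip_eq_imp_eq)
qed

lemma adj_unique:
  assumes "closure D = UNIV" and "\<And>x. x \<in> D \<Longrightarrow> ip \<psi> (F x) = ip \<eta> x"
  shows "\<psi> \<in> adj_dom ip D F" and "adj ip D F \<psi> = \<eta>"
proof -
  show "\<psi> \<in> adj_dom ip D F"
    unfolding adj_dom_iff using assms(2) Cauchy_Schwarz by metis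
  show "adj ip D F \<psi> = \<eta>"
    unfolding adj_def using assms(2) by (intro the_equality ballI) (auto intro: ip_eqI_dense[OF assms(1)])
qed

text \<open>The defining property of the adjoint, for a densely defined operator. Existence of the vector that
the definite description refers to is the Riesz theorem on the domain.\<close>

lemma ip_adj:
  assumes dense: "closure D = UNIV" and lin: "linear_operator scaleK scaleK D F"
    and \<psi>: "\<psi> \<in> adj_dom ip D F" and x: "x \<in> D"
  shows "ip \<psi> (F x) = ip (adj ip D F \<psi>) x"
proof -
  obtain c where c: "\<And>x. x \<in> D \<Longrightarrow> norm (ip \<psi> (F x)) \<le> c * norm x"
    using \<psi> unfolding adj_dom_iff by blast
  have "\<exists>\<eta>. \<forall>x\<in>D. kcnj (ip \<psi> (F x)) = ip x \<eta>"
    using lin c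
    by (intro Riesz_representation[where C = c])
       (auto simp: linear_operator_def ip_add_right ip_scale_right kcnj_add kcnj_mult)
  then obtain \<eta> where "\<And>x. x \<in> D \<Longrightarrow> ip \<psi> (F x) = ip \<eta> x" by (metis ip_commute kcnj_kcnj)
  with adj_unique(2)[OF dense, of \<psi> F \<eta>] x show ?thesis by metis
qed

lemma adj_dom_subspace:
  assumes dense: "closure D = UNIV" and lin: "linear_operator scaleK scaleK D F"
  shows "subspace (adj_dom ip D F)"
    and "\<psi> \<in> adj_dom ip D F \<Longrightarrow> \<eta> \<in> adj_dom ip D F \<Longrightarrow> adj ip D F (\<psi> + \<eta>) = adj ip D F \<psi> + adj ip D F \<eta>"
    and "\<psi> \<in> adj_dom ip D F \<Longrightarrow> adj ip D F (scaleK c \<psi>) = scaleK c (adj ip D F \<psi>)"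
proof -
  note a = ip_adj[OF dense lin]
  have add: "ip (\<psi> + \<eta>) (F x) = ip (adj ip D F \<psi> + adj ip D F \<eta>) x"
    if "\<psi> \<in> adj_dom ip D F" "\<eta> \<in> adj_dom ip D F" "x \<in> D" for \<psi> \<eta> x
    using that by (simp add: ip_add_left a)
  have scale: "ip (scaleK c \<psi>) (F x) = ip (scaleK c (adj ip D F \<psi>)) x"
    if "\<psi> \<in> adj_dom ip D F" "x \<in> D" for \<psi> c x
    using that by (simp add: ip_scale_left a)
  have "0 \<in> adj_dom ip D F" by (rule adj_unique(1)[OF dense, of _ _ 0]) simp
  then show "subspace (adj_dom ip D F)"
    using adj_unique(1)[OF dense add] adj_unique(1)[OF dense scale] unfolding subspace_def by blast
  show "\<psi> \<in> adj_dom ip D F \<Longrightarrow> \<eta> \<in> adj_dom ip D F \<Longrightarrow> adj ip D F (\<psi> + \<eta>) = adj ip D F \<psi> + adj ip D F \<eta>"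
    using adj_unique(2)[OF dense add] by blast
  show "\<psi> \<in> adj_dom ip D F \<Longrightarrow> adj ip D F (scaleK c \<psi>) = scaleK c (adj ip D F \<psi>)"
    using adj_unique(2)[OF dense scale] by blast
qed

lemma bounded_linear_scaleK: "bounded_linear (scaleK c)"
proof (rule bounded_linear_intro)
  show "scaleK c (r *\<^sub>R x) = r *\<^sub>R scaleK c x" for r x
    by (metis scale_left_commute scaleK_of_real)
  show "norm (scaleK c x) \<le> norm x * norm c" for x by (simp add: norm_scaleK)
qed (simp add: scale_right_distrib)

end

section \<open>Strongly continuous semigroups and their adjoints\<close>

text \<open>\<open>F\<close> is the generator of \<open>T\<close>. This setting is entered twice below, with the open-loop and with the
closed-loop semigroup.\<close>

locale hilbert_semigroup = hilbert_space scaleK ip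
  for scaleK :: "'k::real_or_complex \<Rightarrow> 'h::banach \<Rightarrow> 'h" and ip +
  fixes D :: "'h set" and F :: "'h \<Rightarrow> 'h" and T :: "real \<Rightarrow> 'h \<Rightarrow> 'h"
  assumes generates: "generates scaleK D F T"
begin

lemma T_0: "T 0 x = x"
  using generates unfolding generates_def c0_semigroup_def by blast

lemma T_semigroup: "s \<ge> 0 \<Longrightarrow> t \<ge> 0 \<Longrightarrow> T (s + t) x = T s (T t x)"
  using generates unfolding generates_def c0_semigroup_def by blast

lemma T_linear: "t \<ge> 0 \<Longrightarrow> linear_operator scaleK scaleK UNIV (T t)"
  using generates unfolding generates_def c0_semigroup_def by blast

lemma T_scaleK: "t \<ge> 0 \<Longrightarrow> T t (scaleK c x) = scaleK c (T t x)"
  using T_linear[of t] unfolding linear_operator_def by blast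

lemma T_tendsto_0: "((\<lambda>t. T t x) \<longlongrightarrow> x) (at_right 0)"
  using generates unfolding generates_def c0_semigroup_def by blast

lemma bounded_linear_T:
  assumes "t \<ge> 0" shows "bounded_linear (T t)"
proof -
  obtain M where M: "\<And>x. norm (T t x) \<le> M * norm x"
    using generates assms unfolding generates_def c0_semigroup_def by blast
  show ?thesis
  proof (rule bounded_linear_intro)
    show "T t (x + y) = T t x + T t y" for x y
      using T_linear[OF assms] unfolding linear_operator_def by blast
    show "T t (r *\<^sub>R x) = r *\<^sub>R T t x" for r x
      using T_scaleK[OF assms, of "of_real r"] by (simp add: scaleK_of_real)
    show "norm (T t x) \<le> norm x * M" for x using M by (simp add: mult.commute)
  qed
qed

lemma mem_D_iff: "x \<in> D \<longleftrightarrow> (\<exists>y. ((\<lambda>h. (T h x - x) /\<^sub>R h) \<longlongrightarrow> y) (at_right 0))"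
  using generates unfolding generates_def by blast

lemma F_tendsto: "x \<in> D \<Longrightarrow> ((\<lambda>h. (T h x - x) /\<^sub>R h) \<longlongrightarrow> F x) (at_right 0)"
  using generates unfolding generates_def by blast

lemma F_eqI:
  assumes "((\<lambda>h. (T h x - x) /\<^sub>R h) \<longlongrightarrow> y) (at_right 0)"
  shows "x \<in> D" and "F x = y"
proof -
  show "x \<in> D" using assms mem_D_iff by blast
  then show "F x = y" using F_tendsto assms by (intro tendsto_unique[of "at_right (0::real)"]) auto
qed

lemma T_in_D:
  assumes "x \<in> D" "t \<ge> 0"
  shows "T t x \<in> D" and "F (T t x) = T t (F x)"
proof -
  interpret Tt: bounded_linear "T t" by (rule bounded_linear_T[OF assms(2)])
  have "((\<lambda>h. T t ((T h x - x) /\<^sub>R h)) \<longlongrightarrow> T t (F x)) (at_right 0)"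
    by (rule Tt.tendsto[OF F_tendsto[OF assms(1)]])
  moreover have "\<forall>\<^sub>F h in at_right 0. T t ((T h x - x) /\<^sub>R h) = (T h (T t x) - T t x) /\<^sub>R h"
    using eventually_at_right_less
    by eventually_elim (use assms(2) in \<open>simp add: Tt.scaleR Tt.diff T_semigroup[symmetric] add.commute\<close>)
  ultimately have *: "((\<lambda>h. (T h (T t x) - T t x) /\<^sub>R h) \<longlongrightarrow> T t (F x)) (at_right 0)"
    by (rule Lim_transform_eventually)
  show "T t x \<in> D" "F (T t x) = T t (F x)" using F_eqI[OF *] by auto
qed

lemma F_linear: "linear_operator scaleK scaleK D F"
proof -
  have add: "((\<lambda>h. (T h (x + y) - (x + y)) /\<^sub>R h) \<longlongrightarrow> F x + F y) (at_right 0)" if "x \<in> D" "y \<in> D" for x y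
  proof (rule Lim_transform_eventually)
    show "((\<lambda>h. (T h x - x) /\<^sub>R h + (T h y - y) /\<^sub>R h) \<longlongrightarrow> F x + F y) (at_right 0)"
      using that by (intro tendsto_add F_tendsto)
    show "\<forall>\<^sub>F h in at_right 0. (T h x - x) /\<^sub>R h + (T h y - y) /\<^sub>R h = (T h (x + y) - (x + y)) /\<^sub>R h"
      using eventually_at_right_less
      by eventually_elim (simp add: linear_add[OF bounded_linear.linear[OF bounded_linear_T]] algebra_simps)
  qed
  have scale: "((\<lambda>h. (T h (scaleK c x) - scaleK c x) /\<^sub>R h) \<longlongrightarrow> scaleK c (F x)) (at_right 0)" if "x \<in> D" for c x
  proof (rule Lim_transform_eventually)
    show "((\<lambda>h. scaleK c ((T h x - x) /\<^sub>R h)) \<longlongrightarrow> scaleK c (F x)) (at_right 0)"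
      using that by (intro bounded_linear.tendsto[OF bounded_linear_scaleK] F_tendsto)
    show "\<forall>\<^sub>F h in at_right 0. scaleK c ((T h x - x) /\<^sub>R h) = (T h (scaleK c x) - scaleK c x) /\<^sub>R h"
      using eventually_at_right_less
      by eventually_elim
        (simp add: T_scaleK linear_scale[OF bounded_linear.linear[OF bounded_linear_scaleK]] scale_right_diff_distrib)
  qed
  have "((\<lambda>h. (T h 0 - 0) /\<^sub>R h) \<longlongrightarrow> 0) (at_right 0)"
    by (rule Lim_transform_eventually[OF tendsto_const])
       (use eventually_at_right_less in \<open>eventually_elim; simp add: linear_0[OF bounded_linear.linear[OF bounded_linear_T]]\<close>)
  then have "subspace D"
    unfolding subspace_def using F_eqI(1)[OF add] F_eqI(1)[OF scale] F_eqI(1) by blast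
  then show ?thesis
    unfolding linear_operator_def using F_eqI(2)[OF add] F_eqI(2)[OF scale] by blast
qed

text \<open>Otherwise there are times \<open>t n\<close> tending to zero with operators \<open>T (t n)\<close> of unbounded norm, although
every orbit is bounded along these times by continuity at zero; this contradicts the uniform
boundedness principle.\<close>

lemma T_bounded_near_0: "\<exists>\<delta>>0. \<exists>M\<ge>1. \<forall>t\<in>{0..\<delta>}. \<forall>x. norm (T t x) \<le> M * norm x"
proof (rule ccontr)
  assume not: "\<not> ?thesis"
  have "\<exists>t\<in>{0..1 / real (Suc n)}. \<exists>x. norm (T t x) > real (Suc n) * norm x" for n
  proof (rule ccontr)
    assume "\<not> ?thesis"
    then have "\<forall>t\<in>{0..1 / real (Suc n)}. \<forall>x. norm (T t x) \<le> real (Suc n) * norm x"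
      by (auto simp: not_less)
    with not show False by (metis zero_less_divide_1_iff of_nat_0_less_iff zero_less_Suc of_nat_1 of_nat_le_iff Suc_le_eq One_nat_def)
  qed
  then obtain t where t: "\<And>n. t n \<in> {0..1 / real (Suc n)}"
    and big: "\<And>n. \<exists>x. norm (T (t n) x) > real (Suc n) * norm x" by metis
  have "t \<longlonglongrightarrow> 0"
    by (rule tendsto_sandwich[of "\<lambda>_. 0" _ _ "\<lambda>n. 1 / real (Suc n)"])
       (use t LIMSEQ_Suc[OF lim_1_over_n] in auto)
  have orbit: "\<exists>C. \<forall>n\<in>UNIV. norm (T (t n) x) \<le> C" for x
  proof -
    have "\<forall>\<^sub>F s in at_right 0. dist (T s x) x < 1"
      using T_tendsto_0[of x] by (rule tendstoD) simp
    then obtain \<delta> where \<delta>: "\<delta> > 0" "\<And>s. 0 < s \<Longrightarrow> s < \<delta> \<Longrightarrow> dist (T s x) x < 1"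
      unfolding eventually_at_right_field by auto
    have "\<forall>\<^sub>F n in sequentially. t n < \<delta>"
      using \<open>t \<longlonglongrightarrow> 0\<close> \<delta>(1) by (rule order_tendstoD)
    then have "\<forall>\<^sub>F n in sequentially. norm (T (t n) x) \<le> norm x + 1"
    proof eventually_elim
      case (elim n)
      then show ?case
        using \<delta>(2)[of "t n"] t[of n] norm_triangle_sub[of "T (t n) x" x]
        by (cases "t n = 0") (auto simp: T_0 dist_norm)
    qed
    then have "Bseq (\<lambda>n. T (t n) x)" by (rule BfunI)
    then show ?thesis unfolding Bseq_def by auto
  qed
  obtain C where C: "\<And>n x. norm (T (t n) x) \<le> C * norm x"
    using Banach_Steinhaus[of UNIV "\<lambda>n. T (t n)", OF _ orbit] bounded_linear_T t by auto
  obtain n where n: "C \<le> real (Suc n)"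
    using real_arch_simple[of C] by (metis order.trans of_nat_le_iff le_SucI order_refl)
  obtain x where "norm (T (t n) x) > real (Suc n) * norm x" using big by blast
  moreover have "C * norm x \<le> real (Suc n) * norm x" using n by (intro mult_right_mono) auto
  ultimately show False using C[of n x] by linarith
qed

lemma T_bounded_interval: "\<exists>M\<ge>1. \<forall>t\<in>{0..a}. \<forall>x. norm (T t x) \<le> M * norm x"
proof -
  obtain \<delta> M where \<delta>: "\<delta> > 0" and M: "M \<ge> 1" and bd: "\<And>t x. t \<in> {0..\<delta>} \<Longrightarrow> norm (T t x) \<le> M * norm x"
    using T_bounded_near_0 by blast
  have step: "\<forall>t\<in>{0..real n * \<delta>}. \<forall>x. norm (T t x) \<le> M ^ n * norm x" for n
  proof (induction n)
    case 0
    then show ?case by (simp add: T_0)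
  next
    case (Suc n)
    show ?case
    proof (intro ballI allI)
      fix t x assume t: "t \<in> {0..real (Suc n) * \<delta>}"
      show "norm (T t x) \<le> M ^ Suc n * norm x"
      proof (cases "t \<le> \<delta>")
        case True
        have "M * 1 \<le> M * M ^ n" using M by (intro mult_left_mono one_le_power) auto
        then have "M * norm x \<le> M ^ Suc n * norm x" by (intro mult_right_mono) auto
        with bd[of t x] t True show ?thesis by auto
      next
        case False
        have "norm (T t x) = norm (T \<delta> (T (t - \<delta>) x))"
          using T_semigroup[of \<delta> "t - \<delta>" x] False \<delta> by simp
        also have "\<dots> \<le> M * norm (T (t - \<delta>) x)" using bd \<delta> by simp
        also have "\<dots> \<le> M * (M ^ n * norm x)"
          using Suc t False M by (intro mult_left_mono) (auto simp: algebra_simps)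
        finally show ?thesis by simp
      qed
    qed
  qed
  obtain n where "a / \<delta> \<le> real n" using real_arch_simple by blast
  then have "a \<le> real n * \<delta>" using \<delta> by (simp add: field_simps)
  with step[of n] M show ?thesis by (intro exI[of _ "M ^ n"]) (auto simp: one_le_power)
qed

lemma T_diff_le:
  assumes M: "\<And>t x. t \<in> {0..a} \<Longrightarrow> norm (T t x) \<le> M * norm x" and "0 \<le> s" "s \<le> t" "t \<le> a"
  shows "norm (T t x - T s x) \<le> M * norm (T (t - s) x - x)"
proof -
  interpret Ts: bounded_linear "T s" by (rule bounded_linear_T[OF assms(2)])
  have "T t x - T s x = T s (T (t - s) x - x)"
    using T_semigroup[of s "t - s" x] assms by (simp add: Ts.diff)
  then show ?thesis using M[of s] assms by simp
qed

lemma continuous_on_T: "continuous_on {0..} (\<lambda>t. T t x)"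
proof (unfold continuous_on_iff, intro ballI allI impI)
  fix t e :: real assume t: "t \<in> {0..}" and "e > 0"
  obtain M where M: "M \<ge> 1" "\<And>s x. s \<in> {0..t + 1} \<Longrightarrow> norm (T s x) \<le> M * norm x"
    using T_bounded_interval[of "t + 1"] by blast
  have "\<forall>\<^sub>F s in at_right 0. dist (T s x) x < e / M"
    using T_tendsto_0[of x] by (rule tendstoD) (use M \<open>e > 0\<close> in simp)
  then obtain \<delta> where \<delta>: "\<delta> > 0" "\<And>s. 0 < s \<Longrightarrow> s < \<delta> \<Longrightarrow> dist (T s x) x < e / M"
    unfolding eventually_at_right_field by auto
  have small: "M * norm (T s x - x) < e" if "0 \<le> s" "s < \<delta>" for s
    using \<delta>(2)[of s] that M(1) \<open>e > 0\<close> by (cases "s = 0") (auto simp: T_0 dist_norm field_simps)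
  have "dist (T s x) (T t x) < e" if "s \<in> {0..}" "dist s t < min \<delta> 1" for s
  proof (cases "s \<le> t")
    case True
    with T_diff_le[where a = "t + 1" and M = M and s = s and t = t and x = x, OF M(2)] small[of "t - s"] that t
    show ?thesis by (auto simp: dist_norm norm_minus_commute)
  next
    case False
    with T_diff_le[where a = "t + 1" and M = M and s = t and t = s and x = x, OF M(2)] small[of "s - t"] that t
    show ?thesis by (auto simp: dist_norm norm_minus_commute)
  qed
  then show "\<exists>d>0. \<forall>s\<in>{0..}. dist s t < d \<longrightarrow> dist (T s x) (T t x) < e"
    using \<delta>(1) by (intro exI[of _ "min \<delta> 1"]) auto
qed

lemma continuous_on_T_compose [continuous_intros]:
  assumes "continuous_on X f" "\<And>t. t \<in> X \<Longrightarrow> f t \<ge> 0"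
  shows "continuous_on X (\<lambda>t. T (f t) x)"
  by (rule continuous_on_compose2[OF continuous_on_T[of x] assms(1)]) (use assms(2) in auto)

lemma T_integrable: "a \<ge> 0 \<Longrightarrow> (\<lambda>t. T t x) integrable_on {a..b}"
  by (intro integrable_continuous_real continuous_on_subset[OF continuous_on_T]) auto

definition orbit_integral :: "real \<Rightarrow> 'h \<Rightarrow> 'h" where
  "orbit_integral r x = integral {0..r} (\<lambda>t. T t x)"

lemma orbit_integral_tendsto:
  assumes "r \<ge> 0"
  shows "((\<lambda>h. (orbit_integral (r + h) x - orbit_integral r x) /\<^sub>R h) \<longlongrightarrow> T r x) (at_right 0)"
proof -
  have "((\<lambda>u. orbit_integral u x) has_vector_derivative T r x) (at r within {0..r + 1})"
    unfolding orbit_integral_def using assms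
    by (intro integral_has_vector_derivative continuous_on_subset[OF continuous_on_T]) auto
  then have "((\<lambda>u. orbit_integral u x) has_vector_derivative T r x) (at r within {r..r + 1})"
    by (rule has_vector_derivative_within_subset) (use assms in auto)
  then have "((\<lambda>u. orbit_integral u x) has_vector_derivative T r x) (at_right r)"
    by (simp add: at_within_Icc_at_right)
  then show ?thesis by (rule difference_quotient_at_right)
qed

lemma bounded_linear_orbit_integral:
  assumes "r \<ge> 0" shows "bounded_linear (orbit_integral r)"
proof -
  obtain M where M: "M \<ge> 1" "\<And>t x. t \<in> {0..r} \<Longrightarrow> norm (T t x) \<le> M * norm x"
    using T_bounded_interval[of r] by blast
  show ?thesis
  proof (rule bounded_linear_intro)
    show "orbit_integral r (x + y) = orbit_integral r x + orbit_integral r y" for x y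
      unfolding orbit_integral_def integral_add[OF T_integrable[OF order_refl] T_integrable[OF order_refl], symmetric]
      by (intro integral_cong) (simp add: linear_add[OF bounded_linear.linear[OF bounded_linear_T]])
    show "orbit_integral r (c *\<^sub>R x) = c *\<^sub>R orbit_integral r x" for c x
      unfolding orbit_integral_def integral_cmul[symmetric]
      by (intro integral_cong) (simp add: linear_scale[OF bounded_linear.linear[OF bounded_linear_T]])
    show "norm (orbit_integral r x) \<le> norm x * (M * r)" for x
      using integral_bound[of 0 r "\<lambda>t. T t x" "M * norm x"] assms M
        continuous_on_subset[OF continuous_on_T[of x], of "{0..r}"]
      unfolding orbit_integral_def by (auto simp: mult_ac)
  qed
qed

lemma orbit_integral_scaleK:
  assumes "r \<ge> 0" shows "orbit_integral r (scaleK c x) = scaleK c (orbit_integral r x)"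
proof -
  have "scaleK c (orbit_integral r x) = integral {0..r} (scaleK c \<circ> (\<lambda>t. T t x))"
    unfolding orbit_integral_def by (rule integral_linear[symmetric]) (auto intro: T_integrable bounded_linear_scaleK)
  also have "\<dots> = orbit_integral r (scaleK c x)"
    unfolding orbit_integral_def by (intro integral_cong) (simp add: T_scaleK)
  finally show ?thesis by simp
qed

lemma orbit_integral_0 [simp]: "orbit_integral 0 x = 0"
  by (simp add: orbit_integral_def)

lemma T_orbit_integral:
  assumes "r \<ge> 0" "h \<ge> 0"
  shows "T h (orbit_integral r x) = orbit_integral (r + h) x - orbit_integral h x"
proof -
  have "T h (orbit_integral r x) = integral {0..r} (T h \<circ> (\<lambda>t. T t x))"
    unfolding orbit_integral_def
    by (rule integral_linear[symmetric]) (auto intro: T_integrable bounded_linear_T assms)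
  also have "\<dots> = integral {0..r} (\<lambda>t. T (h + t) x)"
    using assms by (intro integral_cong) (simp add: T_semigroup)
  also have "\<dots> = integral {h..r + h} (\<lambda>t. T t x)"
    using integral_shift_banach[of 0 r "\<lambda>t. T t x" h] by simp
  also have "\<dots> = orbit_integral (r + h) x - orbit_integral h x"
    unfolding orbit_integral_def
    using Henstock_Kurzweil_Integration.integral_combine[of 0 h "r + h" "\<lambda>t. T t x"] assms T_integrable[of 0 x "r + h"]
    by (simp add: algebra_simps)
  finally show ?thesis .
qed

lemma orbit_integral_in_D:
  assumes "r \<ge> 0"
  shows "orbit_integral r x \<in> D" and "F (orbit_integral r x) = T r x - x"
proof -
  have "((\<lambda>h. (T h (orbit_integral r x) - orbit_integral r x) /\<^sub>R h) \<longlongrightarrow> T r x - x) (at_right 0)"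
  proof (rule Lim_transform_eventually)
    show "((\<lambda>h. (orbit_integral (r + h) x - orbit_integral r x) /\<^sub>R h
        - (orbit_integral (0 + h) x - orbit_integral 0 x) /\<^sub>R h) \<longlongrightarrow> T r x - x) (at_right 0)"
      using orbit_integral_tendsto[of 0 x, OF order_refl] unfolding T_0
      by (intro tendsto_diff orbit_integral_tendsto assms)
    show "\<forall>\<^sub>F h in at_right 0. (orbit_integral (r + h) x - orbit_integral r x) /\<^sub>R h
        - (orbit_integral (0 + h) x - orbit_integral 0 x) /\<^sub>R h = (T h (orbit_integral r x) - orbit_integral r x) /\<^sub>R h"
      using eventually_at_right_less
      by eventually_elim (use assms in \<open>simp add: T_orbit_integral algebra_simps\<close>)
  qed
  then show "orbit_integral r x \<in> D" "F (orbit_integral r x) = T r x - x" using F_eqI by blast+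
qed

text \<open>The difference quotients of \<open>T\<close> commute with the bounded operator \<open>orbit_integral r\<close>, so this
second limit of the same quotients must agree with the one in \<open>orbit_integral_in_D\<close>.\<close>

lemma orbit_integral_F:
  assumes "x \<in> D" "r \<ge> 0"
  shows "orbit_integral r (F x) = T r x - x"
proof -
  interpret r: bounded_linear "orbit_integral r" by (rule bounded_linear_orbit_integral[OF assms(2)])
  have "((\<lambda>h. orbit_integral r ((T h x - x) /\<^sub>R h)) \<longlongrightarrow> orbit_integral r (F x)) (at_right 0)"
    by (rule r.tendsto[OF F_tendsto[OF assms(1)]])
  moreover have "orbit_integral r ((T h x - x) /\<^sub>R h) = (T h (orbit_integral r x) - orbit_integral r x) /\<^sub>R h"
    if "h > 0" for h
  proof -
    have "orbit_integral r (T h x) = integral {0..r} (\<lambda>t. T (h + t) x)"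
      unfolding orbit_integral_def using that
      by (intro integral_cong) (simp add: T_semigroup[symmetric] add.commute)
    also have "\<dots> = integral {h..r + h} (\<lambda>t. T t x)"
      using integral_shift_banach[of 0 r "\<lambda>t. T t x" h] by simp
    also have "\<dots> = orbit_integral (r + h) x - orbit_integral h x"
      unfolding orbit_integral_def
      using Henstock_Kurzweil_Integration.integral_combine[of 0 h "r + h" "\<lambda>t. T t x"] assms T_integrable[of 0 x "r + h"] that
      by (simp add: algebra_simps)
    finally show ?thesis
      using T_orbit_integral[OF assms(2) less_imp_le[OF that]] by (simp add: r.diff r.scaleR)
  qed
  ultimately have "((\<lambda>h. (T h (orbit_integral r x) - orbit_integral r x) /\<^sub>R h) \<longlongrightarrow> orbit_integral r (F x)) (at_right 0)"
    by (rule_tac Lim_transform_eventually[rotated]) (auto simp: eventually_at_right_field intro: exI[of _ 1])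
  then show ?thesis using F_eqI(2) orbit_integral_in_D(2)[OF assms(2)] by metis
qed

lemma average_tendsto: "((\<lambda>r. orbit_integral r x /\<^sub>R r) \<longlongrightarrow> x) (at_right 0)"
  using orbit_integral_tendsto[of 0 x] by (simp add: T_0)

lemma D_dense: "closure D = UNIV"
proof -
  have "x \<in> closure D" for x
  proof (rule Lim_in_closed_set[OF closed_closure _ _ average_tendsto])
    have "orbit_integral r x /\<^sub>R r \<in> D" if "r > 0" for r
    proof -
      have "scaleK (of_real (inverse r)) (orbit_integral r x) \<in> D"
        using F_linear orbit_integral_in_D(1)[of r x] that
        unfolding linear_operator_def by (auto intro: subspace_scale)
      then show ?thesis by (simp only: scaleK_of_real)
    qed
    then have "orbit_integral r x /\<^sub>R r \<in> closure D" if "r > 0" for r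
      using that closure_subset by blast
    then show "\<forall>\<^sub>F r in at_right 0. orbit_integral r x /\<^sub>R r \<in> closure D"
      by (auto simp: eventually_at_right_field intro: exI[of _ 1])
  qed simp
  then show ?thesis by blast
qed

abbreviation D_adj :: "'h set" where "D_adj \<equiv> adj_dom ip D F"
abbreviation F_adj :: "'h \<Rightarrow> 'h" where "F_adj \<equiv> adj ip D F"
abbreviation T_adj :: "real \<Rightarrow> 'h \<Rightarrow> 'h" where "T_adj t \<equiv> adj ip UNIV (T t)"

lemma ip_F_adj: "\<psi> \<in> D_adj \<Longrightarrow> x \<in> D \<Longrightarrow> ip \<psi> (F x) = ip (F_adj \<psi>) x"
  by (rule ip_adj[OF D_dense F_linear])

lemma bounded_adj_dom:
  assumes "bounded_linear G" shows "\<psi> \<in> adj_dom ip UNIV G"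
proof -
  have "norm (ip \<psi> (G x)) \<le> (norm \<psi> * onorm G) * norm x" for x
    using Cauchy_Schwarz[of \<psi> "G x"] onorm[OF assms, of x]
    by (metis mult.assoc mult_left_mono norm_ge_zero order_trans)
  then show ?thesis unfolding adj_dom_iff by blast
qed

lemma ip_T_adj: "t \<ge> 0 \<Longrightarrow> ip \<psi> (T t x) = ip (T_adj t \<psi>) x"
  by (rule ip_adj[OF _ T_linear bounded_adj_dom[OF bounded_linear_T]]) auto

lemma T_adj_in_D:
  assumes "\<psi> \<in> D_adj" "t \<ge> 0"
  shows "T_adj t \<psi> \<in> D_adj" and "F_adj (T_adj t \<psi>) = T_adj t (F_adj \<psi>)"
proof -
  have "ip (T_adj t \<psi>) (F x) = ip (T_adj t (F_adj \<psi>)) x" if "x \<in> D" for x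
  proof -
    have "ip (T_adj t \<psi>) (F x) = ip \<psi> (T t (F x))"
      using ip_T_adj[OF assms(2)] by simp
    also have "\<dots> = ip \<psi> (F (T t x))"
      using T_in_D[OF that assms(2)] by simp
    also have "\<dots> = ip (F_adj \<psi>) (T t x)"
      using ip_F_adj[OF assms(1) T_in_D(1)[OF that assms(2)]] .
    finally show ?thesis using ip_T_adj[OF assms(2)] by simp
  qed
  from adj_unique[OF D_dense, of "T_adj t \<psi>" F, OF this]
  show "T_adj t \<psi> \<in> D_adj" "F_adj (T_adj t \<psi>) = T_adj t (F_adj \<psi>)" by auto
qed

lemma weak_orbit:
  assumes "\<psi> \<in> D_adj" "t \<ge> 0"
  shows "ip \<psi> (T t x) = ip \<psi> x + integral {0..t} (\<lambda>s. ip (F_adj \<psi>) (T s x))"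
proof -
  have "ip \<psi> (T t x) - ip \<psi> x = ip (F_adj \<psi>) (orbit_integral t x)"
    using ip_F_adj[OF assms(1) orbit_integral_in_D(1)[OF assms(2)], of x]
      orbit_integral_in_D(2)[OF assms(2), of x] by (simp add: ip_diff_right)
  also have "\<dots> = integral {0..t} (ip (F_adj \<psi>) \<circ> (\<lambda>s. T s x))"
    unfolding orbit_integral_def by (rule integral_linear[symmetric]) (auto intro: T_integrable bounded_linear_ip)
  finally show ?thesis by (simp add: o_def diff_eq_eq add.commute)
qed

text \<open>The adjoint of the averages \<open>orbit_integral r x /\<^sub>R r\<close>. It smooths test vectors: the result always
lies in the domain of the adjoint generator and converges weakly to \<open>\<psi>\<close> as \<open>r\<close> tends to zero.\<close>

definition average_adj :: "real \<Rightarrow> 'h \<Rightarrow> 'h" where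
  "average_adj r \<psi> = adj ip UNIV (\<lambda>x. orbit_integral r x /\<^sub>R r) \<psi>"

lemma ip_average_adj:
  assumes "r > 0" shows "ip (average_adj r \<psi>) x = ip \<psi> (orbit_integral r x /\<^sub>R r)"
proof -
  interpret r: bounded_linear "orbit_integral r"
    using bounded_linear_orbit_integral[of r] assms by simp
  have bl: "bounded_linear (\<lambda>x. orbit_integral r x /\<^sub>R r)"
    by (rule bounded_linear_compose[OF bounded_linear_scaleR_right r.bounded_linear_axioms])
  have "linear_operator scaleK scaleK UNIV (\<lambda>x. orbit_integral r x /\<^sub>R r)"
    using assms unfolding linear_operator_def
    by (auto simp: r.add scaleR_add_right orbit_integral_scaleK
        linear_scale[OF bounded_linear.linear[OF bounded_linear_scaleK]])
  from ip_adj[OF _ this bounded_adj_dom[OF bl], of x \<psi>] show ?thesis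
    unfolding average_adj_def by simp
qed

lemma average_adj_in_D:
  assumes "r > 0" shows "average_adj r \<psi> \<in> D_adj" and "\<psi> \<in> D_adj \<Longrightarrow> F_adj (average_adj r \<psi>) = average_adj r (F_adj \<psi>)"
    and "F_adj (average_adj r \<psi>) = (T_adj r \<psi> - \<psi>) /\<^sub>R r"
proof -
  have 1: "ip (average_adj r \<psi>) (F x) = ip ((T_adj r \<psi> - \<psi>) /\<^sub>R r) x" if "x \<in> D" for x
    unfolding ip_average_adj[OF assms] orbit_integral_F[OF that less_imp_le[OF assms]]
    using assms by (simp add: ip_scaleR_right ip_scaleR_left ip_diff_right ip_diff_left ip_T_adj)
  show "average_adj r \<psi> \<in> D_adj" "F_adj (average_adj r \<psi>) = (T_adj r \<psi> - \<psi>) /\<^sub>R r"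
    using adj_unique[OF D_dense, of _ F, OF 1] by auto
  assume \<psi>: "\<psi> \<in> D_adj"
  have 2: "ip (average_adj r \<psi>) (F x) = ip (average_adj r (F_adj \<psi>)) x" if "x \<in> D" for x
    unfolding ip_average_adj[OF assms] orbit_integral_F[OF that less_imp_le[OF assms]]
    using orbit_integral_in_D[of r x] assms ip_F_adj[OF \<psi>, of "orbit_integral r x"]
    by (simp add: ip_scaleR_right)
  show "F_adj (average_adj r \<psi>) = average_adj r (F_adj \<psi>)"
    using adj_unique(2)[OF D_dense, of _ F, OF 2] .
qed

lemma average_adj_tendsto: "((\<lambda>r. ip (average_adj r \<psi>) x) \<longlongrightarrow> ip \<psi> x) (at_right 0)"
proof (rule Lim_transform_eventually[OF tendsto_ip[OF average_tendsto]])
  show "\<forall>\<^sub>F r in at_right 0. ip \<psi> (orbit_integral r x /\<^sub>R r) = ip (average_adj r \<psi>) x"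
    using eventually_at_right_less by eventually_elim (simp add: ip_average_adj)
qed

lemma adj_dom_separates:
  assumes "\<And>\<psi>. \<psi> \<in> D_adj \<Longrightarrow> ip \<psi> x = ip \<psi> y" shows "x = y"
proof (rule ip_eq_imp_eq)
  fix \<psi>
  have "((\<lambda>r. ip (average_adj r \<psi>) x) \<longlongrightarrow> ip \<psi> y) (at_right 0)"
    by (rule Lim_transform_eventually[OF average_adj_tendsto])
       (use eventually_at_right_less in \<open>eventually_elim; simp add: assms average_adj_in_D\<close>)
  then show "ip \<psi> x = ip \<psi> y"
    by (intro tendsto_unique[OF _ average_adj_tendsto]) auto
qed

text \<open>Every \<open>\<psi>\<close> is the weak limit of its averages, which lie in \<open>D_adj\<close> and have norm at most \<open>M\<close> times
that of \<open>\<psi>\<close>.\<close>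

lemma adj_dom_norming:
  "\<exists>M\<ge>1. \<forall>x R. R \<ge> 0 \<longrightarrow> (\<forall>\<psi>\<in>D_adj. norm (ip \<psi> x) \<le> R * norm \<psi>) \<longrightarrow> norm x \<le> M * R"
proof -
  obtain M where M: "M \<ge> 1" "\<And>t x. t \<in> {0..1} \<Longrightarrow> norm (T t x) \<le> M * norm x"
    using T_bounded_interval[of 1] by blast
  have orbit: "norm (orbit_integral r x /\<^sub>R r) \<le> M * norm x" if "0 < r" "r < 1" for r x
    using integral_bound[of 0 r "\<lambda>t. T t x" "M * norm x"] that M(2)
        continuous_on_subset[OF continuous_on_T[of x], of "{0..r}"]
    unfolding orbit_integral_def by (auto simp: field_simps)
  have avg: "norm (average_adj r \<psi>) \<le> M * norm \<psi>" if "0 < r" "r < 1" for r \<psi>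
  proof (rule norm_le_if_ip_le)
    show "norm (ip x (average_adj r \<psi>)) \<le> M * norm \<psi> * norm x" for x
    proof -
      have "norm (ip x (average_adj r \<psi>)) = norm (ip \<psi> (orbit_integral r x /\<^sub>R r))"
        by (metis ip_average_adj[OF that(1)] ip_commute norm_kcnj)
      also have "\<dots> \<le> norm \<psi> * (M * norm x)"
        by (rule order_trans[OF Cauchy_Schwarz mult_left_mono[OF orbit[OF that]]]) simp
      finally show ?thesis by (simp add: mult_ac)
    qed
  qed (use M in simp)
  show ?thesis
  proof (intro exI[of _ M] conjI allI impI M(1))
    fix x R assume R: "R \<ge> 0" "\<forall>\<psi>\<in>D_adj. norm (ip \<psi> x) \<le> R * norm \<psi>"
    show "norm x \<le> M * R"
    proof (rule norm_le_if_ip_le)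
      fix \<psi>
      show "norm (ip \<psi> x) \<le> M * R * norm \<psi>"
      proof (rule tendsto_upperbound[OF tendsto_norm[OF average_adj_tendsto]])
        have "norm (ip (average_adj r \<psi>) x) \<le> M * R * norm \<psi>" if "0 < r" "r < 1" for r
        proof -
          have "norm (ip (average_adj r \<psi>) x) \<le> R * norm (average_adj r \<psi>)"
            using R average_adj_in_D(1) that by blast
          also have "\<dots> \<le> R * (M * norm \<psi>)" using avg[OF that] R by (intro mult_left_mono)
          finally show ?thesis by (simp add: mult_ac)
        qed
        then show "\<forall>\<^sub>F r in at_right 0. norm (ip (average_adj r \<psi>) x) \<le> M * R * norm \<psi>"
          by (auto simp: eventually_at_right_field intro: exI[of _ 1])
      qed simp
    qed (use R M in simp)
  qed
qed

end

section \<open>Integrals of scalar functions\<close>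

text \<open>Transfers results about complex-valued integrals to the scalar field.\<close>

lemma left_inverse_to_complex:
  "\<exists>g :: complex \<Rightarrow> 'k::real_or_complex. bounded_linear g \<and> (\<forall>x. g (to_complex x) = x)"
proof (cases "range (to_complex :: 'k \<Rightarrow> complex) = UNIV")
  case True
  define g :: "complex \<Rightarrow> 'k" where "g = inv to_complex"
  have g: "to_complex (g z) = z" for z
    unfolding g_def using True by (simp add: surj_f_inv_f)
  have "bounded_linear g"
  proof (rule bounded_linear_intro)
    show "g (x + y) = g x + g y" for x y
      by (subst to_complex_eq_iff[symmetric]) (simp add: to_complex_add g)
    show "g (r *\<^sub>R x) = r *\<^sub>R g x" for r x
      by (subst to_complex_eq_iff[symmetric]) (simp add: to_complex_scaleR g)
    show "norm (g x) \<le> norm x * 1" for x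
      using norm_to_complex[of "g x"] by (simp add: g)
  qed
  moreover have "g (to_complex x) = x" for x
    by (subst to_complex_eq_iff[symmetric]) (simp only: g)
  ultimately show ?thesis by blast
next
  case False
  then have real: "range (to_complex :: 'k \<Rightarrow> complex) = \<real>" using range_to_complex[where 'a = 'k] by blast
  define g :: "complex \<Rightarrow> 'k" where "g z = of_real (Re z)" for z
  have "bounded_linear g"
    unfolding g_def by (rule bounded_linear_compose[OF bounded_linear_of_real bounded_linear_Re])
  moreover have "g (to_complex x) = x" for x
  proof -
    have "to_complex x \<in> \<real>" using real by blast
    then have "to_complex (g (to_complex x)) = to_complex x" by (simp add: g_def)
    then show ?thesis unfolding to_complex_eq_iff .
  qed
  ultimately show ?thesis by blast
qed

lemma bounded_linear_to_complex: "bounded_linear (to_complex :: 'k::real_or_complex \<Rightarrow> complex)"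
  by (rule bounded_linear_intro[where K = 1]) (simp_all add: to_complex_add to_complex_scaleR norm_to_complex)

lemma lebesgue_integrable_imp_integrable_on:
  fixes f :: "real \<Rightarrow> 'k::real_or_complex"
  assumes f: "integrable (lebesgue_on S) f" and S: "S \<in> sets lebesgue"
  shows "f integrable_on S" and "integral\<^sup>L (lebesgue_on S) f = integral S f"
proof -
  obtain g :: "complex \<Rightarrow> 'k" where g: "bounded_linear g" "\<And>x. g (to_complex x) = x"
    using left_inverse_to_complex by blast
  have int: "integrable (lebesgue_on S) (\<lambda>x. to_complex (f x))"
    by (rule integrable_bounded_linear[OF bounded_linear_to_complex f])
  have hi: "((\<lambda>x. to_complex (f x)) has_integral integral\<^sup>L (lebesgue_on S) (\<lambda>x. to_complex (f x))) S"
    by (rule has_integral_integral_lebesgue_on[OF int S])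
  have "integral\<^sup>L (lebesgue_on S) (\<lambda>x. to_complex (f x)) = to_complex (integral\<^sup>L (lebesgue_on S) f)"
    by (rule integral_bounded_linear[OF bounded_linear_to_complex f])
  with has_integral_linear[OF hi g(1)] have "(f has_integral integral\<^sup>L (lebesgue_on S) f) S"
    by (simp add: o_def g(2))
  then show "f integrable_on S" "integral\<^sup>L (lebesgue_on S) f = integral S f"
    by (auto simp: integral_unique)
qed

lemma continuous_on_Icc_norm_bound:
  fixes f :: "real \<Rightarrow> 'a::real_normed_vector"
  assumes "continuous_on {a..b} f"
  obtains C where "C \<ge> 0" "\<And>s. s \<in> {a..b} \<Longrightarrow> norm (f s) \<le> C"
proof -
  obtain C where "\<forall>y\<in>f ` {a..b}. norm y \<le> C"
    using compact_imp_bounded[OF compact_continuous_image[OF assms compact_Icc]]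
    unfolding bounded_iff by blast
  then show thesis by (intro that[of "max 0 C"]) (auto simp: le_max_iff_disj)
qed

lemma integrable_mult_continuous:
  fixes f :: "real \<Rightarrow> 'k::real_or_complex"
  assumes h: "integrable (lebesgue_on {a..b}) h" and f: "continuous_on {a..b} f"
  shows "integrable (lebesgue_on {a..b}) (\<lambda>s. h s * f s)"
proof -
  obtain C where C: "C \<ge> 0" "\<And>s. s \<in> {a..b} \<Longrightarrow> norm (f s) \<le> C"
    using continuous_on_Icc_norm_bound[OF f] by blast
  show ?thesis
  proof (rule Bochner_Integration.integrable_bound)
    show "integrable (lebesgue_on {a..b}) (\<lambda>s. C *\<^sub>R norm (h s))"
      by (intro integrable_scaleR_right integrable_norm h)
    show "(\<lambda>s. h s * f s) \<in> borel_measurable (lebesgue_on {a..b})"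
      by (rule borel_measurable_times[OF borel_measurable_integrable[OF h]
            continuous_imp_measurable_on_sets_lebesgue[OF f]]) simp
    show "AE s in lebesgue_on {a..b}. norm (h s * f s) \<le> norm (C *\<^sub>R norm (h s))"
    proof (rule AE_I2)
      fix s assume "s \<in> space (lebesgue_on {a..b})"
      then have "norm (f s) \<le> C" using C(2) by simp
      then show "norm (h s * f s) \<le> norm (C *\<^sub>R norm (h s))"
        using C(1) by (simp add: norm_mult mult.commute[of "norm (h s)"] mult_right_mono)
    qed
  qed
qed

text \<open>Fubini's theorem on the triangle \<open>0 \<le> q \<le> s \<le> t\<close>: integrating a convolution in time amounts to
integrating one of its factors.\<close>

lemma integral_convolution:
  fixes f h :: "real \<Rightarrow> 'k::real_or_complex"
  assumes h: "integrable (lebesgue_on {0..t}) h" and f: "continuous_on {0..} f" and "t \<ge> 0"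
  shows "integral {0..t} (\<lambda>s. integral {0..s} (\<lambda>q. h q * f (s - q)))
       = integral {0..t} (\<lambda>q. h q * integral {0..t - q} f)"
proof -
  let ?M = "lebesgue_on {0..t}"
  interpret M: finite_measure ?M by (intro finite_measure_lebesgue_on) auto
  interpret P: pair_sigma_finite ?M ?M ..
  \<comment> \<open>A continuous extension of \<open>f\<close> to the line, for measurability on the square.\<close>
  define e where "e x = f (max 0 x)" for x
  have cont_e: "continuous_on UNIV e"
    unfolding e_def by (rule continuous_on_compose2[OF f]) (auto intro: continuous_intros)
  have e_eq: "e x = f x" if "x \<ge> 0" for x using that by (simp add: e_def max_def)
  obtain C where C: "C \<ge> 0" "\<And>x. x \<in> {-t..t} \<Longrightarrow> norm (e x) \<le> C"
    using continuous_on_Icc_norm_bound[OF continuous_on_subset[OF cont_e]] by blast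
  define G where "G s q = (if q \<le> s then h q * e (s - q) else 0)" for s q
  have [measurable]: "(\<lambda>x. x) \<in> borel_measurable ?M" 
    by (intro measurable_restrict_space1 measurable_completion) simp
  have [measurable]: "h \<in> borel_measurable ?M" using h by (rule borel_measurable_integrable)
  have [measurable]: "e \<in> borel_measurable borel" using cont_e by (rule borel_measurable_continuous_onI)
  have [measurable]: "fst \<in> borel_measurable (?M \<Otimes>\<^sub>M ?M)" "snd \<in> borel_measurable (?M \<Otimes>\<^sub>M ?M)"
    using measurable_compose[OF measurable_fst \<open>(\<lambda>x. x) \<in> borel_measurable ?M\<close>, of ?M]
      measurable_compose[OF measurable_snd \<open>(\<lambda>x. x) \<in> borel_measurable ?M\<close>, of ?M] by simp_all
  have meas: "case_prod G \<in> borel_measurable (?M \<Otimes>\<^sub>M ?M)"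
    unfolding G_def case_prod_beta by measurable
  have G_le: "norm (G s q) \<le> C * norm (h q)" if "s \<in> {0..t}" "q \<in> {0..t}" for s q
  proof (cases "q \<le> s")
    case True
    then have "norm (e (s - q)) \<le> C" using that by (intro C(2)) auto
    then have "norm (h q) * norm (e (s - q)) \<le> norm (h q) * C" by (intro mult_left_mono) auto
    then show ?thesis using True by (simp add: G_def norm_mult mult.commute)
  qed (use C(1) in \<open>simp add: G_def\<close>)
  have int_Ch: "integrable ?M (\<lambda>q. C * norm (h q))" using h by auto
  have int_Gs: "integrable ?M (G s)" if "s \<in> {0..t}" for s
    by (rule Bochner_Integration.integrable_bound[OF int_Ch])
       (use that measurable_compose_Pair1[OF _ meas, of s] G_le C(1) in auto)
  have int_G: "integrable (?M \<Otimes>\<^sub>M ?M) (case_prod G)"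
  proof (rule P.Fubini_integrable[OF meas])
    show "AE s in ?M. integrable ?M (\<lambda>q. case_prod G (s, q))"
      by (rule AE_I2) (use int_Gs in simp)
    show "integrable ?M (\<lambda>s. \<integral>q. norm (case_prod G (s, q)) \<partial>?M)"
    proof (rule Bochner_Integration.integrable_bound[OF M.integrable_const[of "\<integral>q. C * norm (h q) \<partial>?M"]])
      show "(\<lambda>s. \<integral>q. norm (case_prod G (s, q)) \<partial>?M) \<in> borel_measurable ?M"
        using meas by measurable
      have "(\<integral>q. norm (G s q) \<partial>?M) \<le> (\<integral>q. C * norm (h q) \<partial>?M)" if "s \<in> {0..t}" for s
        by (rule integral_mono[OF integrable_norm[OF int_Gs[OF that]] int_Ch]) (use G_le that in auto)
      then show "AE s in ?M. norm (\<integral>q. norm (case_prod G (s, q)) \<partial>?M) \<le> norm (\<integral>q. C * norm (h q) \<partial>?M)"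
        by (intro AE_I2) (auto intro!: order_trans[OF _ abs_ge_self])
    qed
  qed
  have inner1: "(\<integral>q. G s q \<partial>?M) = integral {0..s} (\<lambda>q. h q * f (s - q))" if "s \<in> {0..t}" for s
  proof -
    have "(\<integral>q. G s q \<partial>?M) = integral {0..t} (G s)"
      using lebesgue_integrable_imp_integrable_on(2)[OF int_Gs[OF that]] by simp
    also have "\<dots> = integral {0..t} (\<lambda>q. if q \<in> {..s} then h q * e (s - q) else 0)"
      unfolding G_def by simp
    also have "\<dots> = integral ({0..t} \<inter> {..s}) (\<lambda>q. h q * e (s - q))"
      by (subst Int_commute, rule integral_restrict_Int)
    also have "{0..t} \<inter> {..s} = {0..s}" using that by auto
    also have "integral {0..s} (\<lambda>q. h q * e (s - q)) = integral {0..s} (\<lambda>q. h q * f (s - q))"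
      by (intro integral_cong) (simp add: e_eq)
    finally show ?thesis .
  qed
  have inner2: "(\<integral>s. G s q \<partial>?M) = h q * integral {0..t - q} f" if "q \<in> {0..t}" for q
  proof -
    have "integrable ?M (\<lambda>s. if s \<in> {q..} then h q * e (s - q) else 0)"
    proof (rule Bochner_Integration.integrable_bound[OF M.integrable_const[of "C * norm (h q)"]])
      show "(\<lambda>s. if s \<in> {q..} then h q * e (s - q) else 0) \<in> borel_measurable ?M" by measurable
      show "AE s in ?M. norm (if s \<in> {q..} then h q * e (s - q) else 0) \<le> norm (C * norm (h q))"
      proof (rule AE_I2)
        fix s assume "s \<in> space ?M"
        then have "norm (G s q) \<le> C * norm (h q)" using that by (intro G_le) auto
        then show "norm (if s \<in> {q..} then h q * e (s - q) else 0) \<le> norm (C * norm (h q))"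
          using C(1) by (simp add: G_def)
      qed
    qed
    then have "(\<integral>s. G s q \<partial>?M) = integral {0..t} (\<lambda>s. if s \<in> {q..} then h q * e (s - q) else 0)"
      unfolding G_def by (simp add: lebesgue_integrable_imp_integrable_on(2))
    also have "\<dots> = integral ({0..t} \<inter> {q..}) (\<lambda>s. h q * e (s - q))"
      by (subst Int_commute, rule integral_restrict_Int)
    also have "{0..t} \<inter> {q..} = {0 + q..(t - q) + q}" using that by auto
    also have "integral {0 + q..(t - q) + q} (\<lambda>s. h q * e (s - q)) = integral {0..t - q} (\<lambda>s. h q * e (q + s - q))"
      using integral_shift_banach[of 0 "t - q" "\<lambda>s. h q * e (s - q)" q] by (simp only:)
    also have "\<dots> = h q * integral {0..t - q} e" by simp
    also have "integral {0..t - q} e = integral {0..t - q} f"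
      by (intro integral_cong) (simp add: e_eq)
    finally show ?thesis .
  qed
  have "integral {0..t} (\<lambda>s. integral {0..s} (\<lambda>q. h q * f (s - q))) = integral {0..t} (\<lambda>s. \<integral>q. G s q \<partial>?M)"
    by (intro integral_cong) (simp add: inner1)
  also have "\<dots> = (\<integral>s. (\<integral>q. G s q \<partial>?M) \<partial>?M)"
    using P.integrable_fst[OF int_G] by (simp add: lebesgue_integrable_imp_integrable_on(2))
  also have "\<dots> = (\<integral>q. (\<integral>s. G s q \<partial>?M) \<partial>?M)"
    using P.Fubini_integral[OF int_G] by simp
  also have "\<dots> = integral {0..t} (\<lambda>q. \<integral>s. G s q \<partial>?M)"
    using P.integrable_snd[OF int_G] by (simp add: lebesgue_integrable_imp_integrable_on(2))
  also have "\<dots> = integral {0..t} (\<lambda>q. h q * integral {0..t - q} f)"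
    by (intro integral_cong) (simp add: inner2)
  finally show ?thesis .
qed

lemma integral_reflect_shift:
  fixes f :: "real \<Rightarrow> 'a::banach"
  shows "integral {a..b} (\<lambda>s. f (c - s)) = integral {c - b..c - a} f"
proof -
  have "integral {c - b..c - a} f = integral {- (c - a)..- (c - b)} (\<lambda>s. f (- s))"
    by (rule Henstock_Kurzweil_Integration.integral_reflect_real[symmetric])
  also have "\<dots> = integral {a - c..b - c} (\<lambda>s. f (c - (c + s)))" by simp
  also have "\<dots> = integral {a - c + c..b - c + c} (\<lambda>s. f (c - s))"
    by (rule integral_shift_banach)
  finally show ?thesis by simp
qed

lemma AE_lebesgue_on_subset:
  assumes "AE x in lebesgue_on X. P x" "Y \<subseteq> X" "X \<in> sets lebesgue" "Y \<in> sets lebesgue"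
  shows "AE x in lebesgue_on Y. P x"
  using assms by (auto simp: AE_restrict_space_iff elim!: eventually_mono)

lemma integrable_lebesgue_on_subset:
  fixes f :: "real \<Rightarrow> 'b::{banach, second_countable_topology}"
  assumes "integrable (lebesgue_on X) f" "Y \<subseteq> X" "X \<in> sets lebesgue" "Y \<in> sets lebesgue"
  shows "integrable (lebesgue_on Y) f"
  using assms set_integrable_subset[of lebesgue X f Y]
  unfolding set_integrable_def by (simp add: integrable_restrict_space)

lemma norm_integral_le_AE:
  fixes h :: "real \<Rightarrow> 'k::real_or_complex"
  assumes h: "integrable (lebesgue_on {a..b}) h" and bound: "AE s in lebesgue_on {a..b}. norm (h s) \<le> C" and "a \<le> b"
  shows "norm (integral {a..b} h) \<le> C * (b - a)"
proof -
  let ?M = "lebesgue_on {a..b}"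
  interpret finite_measure ?M by (intro finite_measure_lebesgue_on) auto
  have int: "integrable ?M (\<lambda>s. C)" by simp
  have "norm (integral {a..b} h) = norm (integral\<^sup>L ?M h)"
    using lebesgue_integrable_imp_integrable_on(2)[OF h] by simp
  also have "\<dots> \<le> (\<integral>s. norm (h s) \<partial>?M)" by (rule integral_norm_bound)
  also have "\<dots> \<le> (\<integral>s. C \<partial>?M)"
    using h bound by (intro integral_mono_AE) auto
  also have "\<dots> = C * (b - a)"
    using lebesgue_integrable_imp_integrable_on(2)[OF int] \<open>a \<le> b\<close> by (simp add: mult.commute)
  finally show ?thesis .
qed

lemma integral_diff_eq:
  fixes f :: "real \<Rightarrow> 'a::banach"
  assumes "f integrable_on {a..c}" "a \<le> b" "b \<le> c"
  shows "integral {a..c} f - integral {a..b} f = integral {b..c} f"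
  using Henstock_Kurzweil_Integration.integral_combine[OF assms(2,3,1)] by (simp add: algebra_simps)

lemma integral_le_AE:
  fixes f :: "real \<Rightarrow> real"
  assumes f: "integrable (lebesgue_on {a..b}) f" and bound: "AE s in lebesgue_on {a..b}. f s \<le> C" and "a \<le> b"
  shows "integral {a..b} f \<le> C * (b - a)"
proof -
  let ?M = "lebesgue_on {a..b}"
  interpret finite_measure ?M by (intro finite_measure_lebesgue_on) auto
  have int: "integrable ?M (\<lambda>s. C)" by simp
  have "integral {a..b} f = integral\<^sup>L ?M f"
    using lebesgue_integrable_imp_integrable_on(2)[OF f] by simp
  also have "\<dots> \<le> (\<integral>s. C \<partial>?M)"
    using f bound by (intro integral_mono_AE) auto
  also have "\<dots> = C * (b - a)"
    using lebesgue_integrable_imp_integrable_on(2)[OF int] \<open>a \<le> b\<close> by (simp add: mult.commute)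
  finally show ?thesis .
qed

lemma square_integrable_imp_integrable:
  assumes "square_integrable_on u {a..b}" shows "integrable (lebesgue_on {a..b}) u"
proof (rule Bochner_Integration.integrable_bound)
  interpret finite_measure "lebesgue_on {a..b}" by (intro finite_measure_lebesgue_on) auto
  show "integrable (lebesgue_on {a..b}) (\<lambda>s. 1 + (norm (u s))\<^sup>2)"
    using assms unfolding square_integrable_on_def by (intro Bochner_Integration.integrable_add) auto
  show "u \<in> borel_measurable (lebesgue_on {a..b})"
    using assms unfolding square_integrable_on_def by blast
  have "norm (u s) \<le> 1 + (norm (u s))\<^sup>2" for s
  proof -
    have "0 \<le> (norm (u s) - 1)\<^sup>2 + norm (u s)" by simp
    then show ?thesis by (simp add: power2_diff)
  qed
  then show "AE s in lebesgue_on {a..b}. norm (u s) \<le> norm (1 + (norm (u s))\<^sup>2)"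
    by (intro AE_I2) (auto intro: order_trans[OF _ abs_ge_self])
qed

lemma continuous_square_integrable:
  fixes u :: "real \<Rightarrow> real"
  assumes "continuous_on {a..b} u" shows "square_integrable_on u {a..b}"
  unfolding square_integrable_on_def
proof
  show "u \<in> borel_measurable (lebesgue_on {a..b})"
    by (rule continuous_imp_measurable_on_sets_lebesgue[OF assms]) simp
  have "continuous_on {a..b} (\<lambda>s. (norm (u s))\<^sup>2)" by (intro continuous_intros assms)
  then have "(\<lambda>s. (norm (u s))\<^sup>2) absolutely_integrable_on {a..b}"
    by (intro nonnegative_absolutely_integrable_1 integrable_continuous_real) auto
  then show "integrable (lebesgue_on {a..b}) (\<lambda>s. (norm (u s))\<^sup>2)"
    by (rule absolutely_integrable_imp_integrable) simp
qed

lemma AE_lebesgue_on_negligible: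
  assumes "AE x in lebesgue_on X. P x" "X \<in> sets lebesgue"
  obtains N where "negligible N" "\<And>x. x \<in> X \<Longrightarrow> x \<notin> N \<Longrightarrow> P x"
proof -
  have "AE x in lebesgue. x \<in> X \<longrightarrow> P x" using assms by (simp add: AE_restrict_space_iff)
  then obtain N where "{x \<in> space lebesgue. \<not> (x \<in> X \<longrightarrow> P x)} \<subseteq> N" "N \<in> null_sets lebesgue"
    unfolding eventually_ae_filter by blast
  then show thesis by (intro that[of N]) (auto simp: negligible_iff_null_sets)
qed

section \<open>Mild solutions and integrated equations\<close>

text \<open>The functional \<open>\<kappa>\<close> plays the role of \<open>B 1\<close>. Its representation by two vectors says that \<open>\<kappa>\<close> is bounded
for the graph norm of the adjoint generator; it makes \<open>\<kappa> (T_adj t \<psi>)\<close> a continuous function of time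
that is explicit in terms of orbits of \<open>T\<close>.\<close>

locale controlled_semigroup = hilbert_semigroup scaleK ip D F T
  for scaleK :: "'k::real_or_complex \<Rightarrow> 'h::banach \<Rightarrow> 'h" and ip D F T +
  fixes \<kappa> :: "'h \<Rightarrow> 'k" and b\<^sub>1 b\<^sub>2 :: 'h
  assumes \<kappa>_eq: "\<psi> \<in> D_adj \<Longrightarrow> \<kappa> \<psi> = ip \<psi> b\<^sub>1 + ip (F_adj \<psi>) b\<^sub>2"
begin

lemma \<kappa>_T_adj:
  assumes "\<psi> \<in> D_adj" "t \<ge> 0"
  shows "\<kappa> (T_adj t \<psi>) = ip \<psi> (T t b\<^sub>1) + ip (F_adj \<psi>) (T t b\<^sub>2)"
  using assms by (simp add: \<kappa>_eq T_adj_in_D ip_T_adj)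

lemma continuous_on_\<kappa>_T_adj:
  assumes "\<psi> \<in> D_adj" shows "continuous_on {0..} (\<lambda>t. \<kappa> (T_adj t \<psi>))"
proof (rule continuous_on_eq)
  show "continuous_on {0..} (\<lambda>t. ip \<psi> (T t b\<^sub>1) + ip (F_adj \<psi>) (T t b\<^sub>2))"
    by (intro continuous_intros continuous_on_T)
qed (simp add: \<kappa>_T_adj assms)

lemma \<kappa>_T_adj_integral:
  assumes "\<psi> \<in> D_adj" "F_adj \<psi> \<in> D_adj" "t \<ge> 0"
  shows "\<kappa> (T_adj t \<psi>) = \<kappa> \<psi> + integral {0..t} (\<lambda>s. \<kappa> (T_adj s (F_adj \<psi>)))"
proof -
  have int: "(\<lambda>s. ip \<eta> (T s x)) integrable_on {0..t}" for \<eta> x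
    by (intro integrable_continuous_real continuous_intros) auto
  have "integral {0..t} (\<lambda>s. \<kappa> (T_adj s (F_adj \<psi>)))
      = integral {0..t} (\<lambda>s. ip (F_adj \<psi>) (T s b\<^sub>1) + ip (F_adj (F_adj \<psi>)) (T s b\<^sub>2))"
    by (intro integral_cong) (simp add: \<kappa>_T_adj assms)
  also have "\<dots> = integral {0..t} (\<lambda>s. ip (F_adj \<psi>) (T s b\<^sub>1)) + integral {0..t} (\<lambda>s. ip (F_adj (F_adj \<psi>)) (T s b\<^sub>2))"
    by (intro Henstock_Kurzweil_Integration.integral_add int)
  finally show ?thesis
    using assms weak_orbit[of \<psi> t b\<^sub>1] weak_orbit[of "F_adj \<psi>" t b\<^sub>2] by (simp add: \<kappa>_T_adj \<kappa>_eq)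
qed

text \<open>For \<open>\<psi>\<close> in the domain of the square of the adjoint generator the kernel \<open>\<kappa> (T_adj t \<psi>)\<close> is the
integral of the kernel of \<open>F_adj \<psi>\<close>. Inserting this into the mild formula and exchanging the
integrals turns the convolution into a time integral of the mild formula for \<open>F_adj \<psi>\<close>.\<close>

theorem integrated_equation_if_mild:
  assumes z: "continuous_on {0..} z"
    and h: "\<And>t. t \<ge> 0 \<Longrightarrow> integrable (lebesgue_on {0..t}) h"
    and mild: "\<And>t \<psi>. t \<ge> 0 \<Longrightarrow> \<psi> \<in> D_adj \<Longrightarrow>
      ip \<psi> (z t) = ip \<psi> (T t z0) + integral {0..t} (\<lambda>s. h s * \<kappa> (T_adj (t - s) \<psi>))"
    and "t \<ge> 0" "\<psi> \<in> D_adj"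
  shows "ip \<psi> (z t) = ip \<psi> z0 + ip (F_adj \<psi>) (integral {0..t} z) + \<kappa> \<psi> * integral {0..t} h"
proof -
  have regular: "ip \<psi> (z t) = ip \<psi> z0 + ip (F_adj \<psi>) (integral {0..t} z) + \<kappa> \<psi> * integral {0..t} h"
    if \<psi>: "\<psi> \<in> D_adj" "F_adj \<psi> \<in> D_adj" for \<psi>
  proof -
    define k where "k s = \<kappa> (T_adj s (F_adj \<psi>))" for s
    have k: "continuous_on {0..} k"
      unfolding k_def by (rule continuous_on_\<kappa>_T_adj[OF \<psi>(2)])
    have "continuous_on {0..t} (\<lambda>r. integral {0..r} k)"
      by (intro indefinite_integral_continuous_1 integrable_continuous_real continuous_on_subset[OF k]) auto
    then have K: "continuous_on {0..t} (\<lambda>s. integral {0..t - s} k)"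
      by (rule continuous_on_compose2) (auto intro!: continuous_intros)
    have int_h: "h integrable_on {0..t}"
      using lebesgue_integrable_imp_integrable_on[OF h[OF \<open>t \<ge> 0\<close>]] by simp
    have int_z: "z integrable_on {0..t}"
      by (intro integrable_continuous_real continuous_on_subset[OF z]) auto
    have "integral {0..t} (\<lambda>s. h s * \<kappa> (T_adj (t - s) \<psi>))
        = integral {0..t} (\<lambda>s. \<kappa> \<psi> * h s + h s * integral {0..t - s} k)"
      using \<kappa>_T_adj_integral[OF \<psi>] by (intro integral_cong) (simp add: k_def[abs_def] algebra_simps)
    also have "\<dots> = integral {0..t} (\<lambda>s. \<kappa> \<psi> * h s) + integral {0..t} (\<lambda>s. h s * integral {0..t - s} k)"
      using lebesgue_integrable_imp_integrable_on(1)[OF integrable_mult_continuous[OF h[OF \<open>t \<ge> 0\<close>] K]] int_h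
      by (intro Henstock_Kurzweil_Integration.integral_add integrable_on_mult_right) auto
    also have "integral {0..t} (\<lambda>s. h s * integral {0..t - s} k)
        = integral {0..t} (\<lambda>s. integral {0..s} (\<lambda>q. h q * k (s - q)))"
      by (rule integral_convolution[OF h[OF \<open>t \<ge> 0\<close>] k \<open>t \<ge> 0\<close>, symmetric])
    also have "\<dots> = integral {0..t} (\<lambda>s. ip (F_adj \<psi>) (z s) - ip (F_adj \<psi>) (T s z0))"
      using mild[OF _ \<psi>(2)] by (intro integral_cong) (simp add: k_def)
    also have "\<dots> = integral {0..t} (\<lambda>s. ip (F_adj \<psi>) (z s)) - integral {0..t} (\<lambda>s. ip (F_adj \<psi>) (T s z0))"
      by (intro Henstock_Kurzweil_Integration.integral_diff integrable_continuous_real continuous_intros continuous_on_subset[OF z]) auto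
    also have "integral {0..t} (\<lambda>s. ip (F_adj \<psi>) (z s)) = ip (F_adj \<psi>) (integral {0..t} z)"
      using integral_linear[OF int_z bounded_linear_ip, of "F_adj \<psi>"] by (simp add: o_def)
    finally show ?thesis
      using mild[OF \<open>t \<ge> 0\<close> \<psi>(1)] weak_orbit[OF \<psi>(1) \<open>t \<ge> 0\<close>, of z0] by (simp add: algebra_simps)
  qed
  \<comment> \<open>An arbitrary test vector is replaced by its averages, which satisfy the regularity
    just used; the representation of \<open>\<kappa>\<close> makes both sides converge.\<close>
  let ?R = "\<lambda>\<psi>. ip \<psi> z0 + ip (F_adj \<psi>) (integral {0..t} z) + \<kappa> \<psi> * integral {0..t} h"
  have "((\<lambda>r. ip (average_adj r \<psi>) z0 + ip (average_adj r (F_adj \<psi>)) (integral {0..t} z)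
      + (ip (average_adj r \<psi>) b\<^sub>1 + ip (average_adj r (F_adj \<psi>)) b\<^sub>2) * integral {0..t} h)
      \<longlongrightarrow> ?R \<psi>) (at_right 0)"
    unfolding \<kappa>_eq[OF \<open>\<psi> \<in> D_adj\<close>] by (intro tendsto_intros average_adj_tendsto)
  moreover have "\<forall>\<^sub>F r in at_right 0. ip (average_adj r \<psi>) z0 + ip (average_adj r (F_adj \<psi>)) (integral {0..t} z)
      + (ip (average_adj r \<psi>) b\<^sub>1 + ip (average_adj r (F_adj \<psi>)) b\<^sub>2) * integral {0..t} h = ip (average_adj r \<psi>) (z t)"
    using eventually_at_right_less
  proof eventually_elim
    case (elim r)
    then show ?case
      using regular[of "average_adj r \<psi>"] average_adj_in_D[of r] \<kappa>_eq[of "average_adj r \<psi>"] \<open>\<psi> \<in> D_adj\<close> by simp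
  qed
  ultimately have "((\<lambda>r. ip (average_adj r \<psi>) (z t)) \<longlongrightarrow> ?R \<psi>) (at_right 0)"
    by (rule Lim_transform_eventually)
  then show ?thesis by (rule tendsto_unique[OF trivial_limit_at_right_real average_adj_tendsto])
qed

lemma weak_orbit_has_vector_derivative:
  assumes "\<psi> \<in> D_adj" "s \<in> {0..t}"
  shows "((\<lambda>s. ip \<psi> (T (t - s) x)) has_vector_derivative - ip (F_adj \<psi>) (T (t - s) x)) (at s within {0..t})"
proof -
  let ?f = "\<lambda>s. ip (F_adj \<psi>) (T s x)"
  have "((\<lambda>r. ip \<psi> x + integral {0..r} ?f) has_vector_derivative 0 + ?f (t - s)) (at (t - s) within {0..t})"
    using assms
    by (intro has_vector_derivative_add integral_has_vector_derivative continuous_intros) auto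
  then have "((\<lambda>r. ip \<psi> (T r x)) has_vector_derivative ?f (t - s)) (at (t - s) within {0..t})"
    using assms weak_orbit[OF assms(1), of _ x]
    by (rule_tac has_vector_derivative_transform[where f = "\<lambda>r. ip \<psi> x + integral {0..r} ?f"]) auto
  then have "((\<lambda>r. ip \<psi> (T r x)) has_vector_derivative ?f (t - s)) (at (t - s) within (\<lambda>s. t - s) ` {0..t})"
    by (rule has_vector_derivative_within_subset) auto
  moreover have "((\<lambda>s. t - s) has_vector_derivative 0 - 1) (at s within {0..t})"
    by (intro derivative_intros)
  ultimately show ?thesis
    using vector_diff_chain_within[of "\<lambda>s. t - s" "0 - 1" s "{0..t}" "\<lambda>r. ip \<psi> (T r x)" "?f (t - s)"]
    by (simp add: o_def)
qed

text \<open>Differentiate \<open>ip \<psi> (T (t - s) (integral {0..s} z))\<close> in \<open>s\<close>: with \<open>T_adj (t - s) \<psi>\<close> as test vector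
in the equation, the terms with the generator cancel. The integral of \<open>z\<close> is used in place of \<open>z\<close>
because it is differentiable.\<close>

theorem variation_of_constants_integrated:
  assumes z: "continuous_on {0..t} z" and G: "continuous_on {0..t} G" and "t \<ge> 0" and \<psi>: "\<psi> \<in> D_adj"
    and eq: "\<And>s \<psi>. s \<in> {0..t} \<Longrightarrow> \<psi> \<in> D_adj \<Longrightarrow>
      ip \<psi> (z s) = ip \<psi> z0 + ip (F_adj \<psi>) (integral {0..s} z) + \<kappa> \<psi> * G s"
  shows "ip \<psi> (integral {0..t} z) = ip \<psi> (orbit_integral t z0) + integral {0..t} (\<lambda>s. \<kappa> (T_adj (t - s) \<psi>) * G s)"
proof -
  define W where "W s = integral {0..s} z" for s
  define m where "m s = ip \<psi> (T (t - s) (W s))" for s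
  obtain M where M: "M \<ge> 1" "\<And>s x. s \<in> {0..t} \<Longrightarrow> norm (T s x) \<le> M * norm x"
    using T_bounded_interval[of t] by blast
  have deriv: "(m has_vector_derivative ip \<psi> (T (t - s) z0) + \<kappa> (T_adj (t - s) \<psi>) * G s) (at s within {0..t})"
    if s: "s \<in> {0..t}" for s
    unfolding has_vector_derivative_iff_quotient
  proof (rule Lim_transform_within[OF _ zero_less_one])
    have W': "((\<lambda>y. (W y - W s) /\<^sub>R (y - s)) \<longlongrightarrow> z s) (at s within {0..t})"
      unfolding W_def using integral_has_vector_derivative[OF z s]
      by (simp add: has_vector_derivative_iff_quotient)
    have null: "((\<lambda>y. T (t - y) ((W y - W s) /\<^sub>R (y - s) - z s)) \<longlongrightarrow> 0) (at s within {0..t})"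
    proof (rule Lim_null_comparison)
      show "\<forall>\<^sub>F y in at s within {0..t}. norm (T (t - y) ((W y - W s) /\<^sub>R (y - s) - z s))
          \<le> M * norm ((W y - W s) /\<^sub>R (y - s) - z s)"
        unfolding eventually_at_filter by (intro always_eventually allI impI M(2)) auto
      show "((\<lambda>y. M * norm ((W y - W s) /\<^sub>R (y - s) - z s)) \<longlongrightarrow> 0) (at s within {0..t})"
        using tendsto_mult_left[OF tendsto_norm_zero[OF LIM_zero[OF W']], of M] by simp
    qed
    have "continuous_on {0..t} (\<lambda>y. T (t - y) (z s))"
      by (intro continuous_intros) auto
    then have "((\<lambda>y. T (t - y) (z s)) \<longlongrightarrow> T (t - s) (z s)) (at s within {0..t})"
      using s unfolding continuous_on_def by blast
    from tendsto_add[OF null this]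
    have "((\<lambda>y. ip \<psi> (T (t - y) ((W y - W s) /\<^sub>R (y - s) - z s) + T (t - y) (z s)))
        \<longlongrightarrow> ip \<psi> (0 + T (t - s) (z s))) (at s within {0..t})"
      by (rule tendsto_ip)
    moreover have "((\<lambda>y. (ip \<psi> (T (t - y) (W s)) - ip \<psi> (T (t - s) (W s))) /\<^sub>R (y - s))
        \<longlongrightarrow> - ip (F_adj \<psi>) (T (t - s) (W s))) (at s within {0..t})"
      using weak_orbit_has_vector_derivative[OF \<psi> s, of "W s"] by (simp add: has_vector_derivative_iff_quotient)
    ultimately have "((\<lambda>y. ip \<psi> (T (t - y) ((W y - W s) /\<^sub>R (y - s) - z s) + T (t - y) (z s))
        + (ip \<psi> (T (t - y) (W s)) - ip \<psi> (T (t - s) (W s))) /\<^sub>R (y - s))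
        \<longlongrightarrow> ip \<psi> (0 + T (t - s) (z s)) + - ip (F_adj \<psi>) (T (t - s) (W s))) (at s within {0..t})"
      by (rule tendsto_add)
    also have "ip \<psi> (0 + T (t - s) (z s)) + - ip (F_adj \<psi>) (T (t - s) (W s))
        = ip \<psi> (T (t - s) z0) + \<kappa> (T_adj (t - s) \<psi>) * G s"
      using eq[OF s, of "T_adj (t - s) \<psi>"] s T_adj_in_D[OF \<psi>, of "t - s"] by (simp add: W_def ip_T_adj)
    finally show "((\<lambda>y. ip \<psi> (T (t - y) ((W y - W s) /\<^sub>R (y - s) - z s) + T (t - y) (z s))
        + (ip \<psi> (T (t - y) (W s)) - ip \<psi> (T (t - s) (W s))) /\<^sub>R (y - s))
        \<longlongrightarrow> ip \<psi> (T (t - s) z0) + \<kappa> (T_adj (t - s) \<psi>) * G s) (at s within {0..t})" .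
    fix y assume "y \<in> {0..t}" "0 < dist y s"
    then interpret Ty: bounded_linear "T (t - y)" by (intro bounded_linear_T) simp
    show "ip \<psi> (T (t - y) ((W y - W s) /\<^sub>R (y - s) - z s) + T (t - y) (z s))
        + (ip \<psi> (T (t - y) (W s)) - ip \<psi> (T (t - s) (W s))) /\<^sub>R (y - s) = (m y - m s) /\<^sub>R (y - s)"
      unfolding m_def
      by (simp add: Ty.diff Ty.scaleR ip_scaleR_right ip_diff_right scaleR_conv_of_real right_diff_distrib)
  qed
  have "((\<lambda>s. ip \<psi> (T (t - s) z0) + \<kappa> (T_adj (t - s) \<psi>) * G s) has_integral m t - m 0) {0..t}"
    by (rule fundamental_theorem_of_calculus[OF \<open>t \<ge> 0\<close> deriv])
  moreover have "m t = ip \<psi> (W t)" "m 0 = 0"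
    using \<open>t \<ge> 0\<close> linear_0[OF bounded_linear.linear[OF bounded_linear_T]] by (simp_all add: m_def W_def T_0)
  moreover have "integral {0..t} (\<lambda>s. ip \<psi> (T (t - s) z0)) = ip \<psi> (orbit_integral t z0)"
  proof -
    have "ip \<psi> (orbit_integral t z0) = integral {0..t} (\<lambda>s. ip \<psi> (T s z0))"
      unfolding orbit_integral_def
      using integral_linear[OF T_integrable[where a = 0 and b = t and x = z0] bounded_linear_ip[of \<psi>]] by (simp add: o_def)
    also have "\<dots> = integral {- t..- 0} (\<lambda>s. ip \<psi> (T (- s) z0))"
      by (rule Henstock_Kurzweil_Integration.integral_reflect_real[symmetric])
    also have "\<dots> = integral {- t + t..- 0 + t} (\<lambda>s. ip \<psi> (T (t - s) z0))"
      using integral_shift_banach[of "- t" "- 0" "\<lambda>s. ip \<psi> (T (t - s) z0)" t] by simp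
    finally show ?thesis by simp
  qed
  moreover have "integral {0..t} (\<lambda>s. ip \<psi> (T (t - s) z0) + \<kappa> (T_adj (t - s) \<psi>) * G s)
      = integral {0..t} (\<lambda>s. ip \<psi> (T (t - s) z0)) + integral {0..t} (\<lambda>s. \<kappa> (T_adj (t - s) \<psi>) * G s)"
  proof (intro Henstock_Kurzweil_Integration.integral_add integrable_continuous_real)
    show "continuous_on {0..t} (\<lambda>s. ip \<psi> (T (t - s) z0))" by (intro continuous_intros) auto
    have "continuous_on {0..t} (\<lambda>s. \<kappa> (T_adj (t - s) \<psi>))"
      by (rule continuous_on_compose2[OF continuous_on_\<kappa>_T_adj[OF \<psi>]]) (auto intro: continuous_intros)
    then show "continuous_on {0..t} (\<lambda>s. \<kappa> (T_adj (t - s) \<psi>) * G s)"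
      using G by (rule continuous_on_mult)
  qed
  ultimately show ?thesis unfolding W_def by (simp add: integral_unique)
qed

end

section \<open>The structure of the feedback operator\<close>

text \<open>The function \<open>exp (- c * t) * integral {0..t} k\<close> has derivative zero.\<close>

lemma linear_integral_equation_zero:
  fixes k :: "real \<Rightarrow> 'k::{real_normed_field,banach}"
  assumes k: "continuous_on {0..} k" and eq: "\<And>t. t \<ge> 0 \<Longrightarrow> k t = c * integral {0..t} k" and "t \<ge> 0"
  shows "k t = 0"
proof -
  define g where "g t = exp (t *\<^sub>R (- c)) * integral {0..t} k" for t
  have "(g has_vector_derivative 0) (at s within {0..t})" if s: "s \<in> {0..t}" for s
  proof -
    have "(g has_vector_derivative exp (s *\<^sub>R (- c)) * k s + (exp (s *\<^sub>R (- c)) * (- c)) * integral {0..s} k)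
        (at s within {0..t})"
      unfolding g_def
      by (intro has_vector_derivative_mult integral_has_vector_derivative s continuous_on_subset[OF k]
          exp_scaleR_has_vector_derivative_right[THEN has_vector_derivative_at_within]) auto
    moreover have "exp (s *\<^sub>R (- c)) * k s + (exp (s *\<^sub>R (- c)) * (- c)) * integral {0..s} k = 0"
      using eq[of s] s by simp
    ultimately show ?thesis by simp
  qed
  then obtain a where "\<And>s. s \<in> {0..t} \<Longrightarrow> g s = a"
    using has_vector_derivative_zero_constant[of "{0..t}" g] by (metis convex_closed_interval cbox_interval convex_box(1))
  then have "g t = g 0" using \<open>t \<ge> 0\<close> by simp
  then have "integral {0..t} k = 0" by (simp add: g_def)
  with eq[OF \<open>t \<ge> 0\<close>] show ?thesis by simp
qed

context hilbert_semigroup begin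

text \<open>The Riesz theorem on the graph of the adjoint generator, a subspace of the product space.\<close>

lemma dual_space_representation:
  assumes "f \<in> dual_space scaleK D_adj F_adj"
  shows "\<exists>b\<^sub>1 b\<^sub>2. \<forall>\<psi>\<in>D_adj. f \<psi> = ip \<psi> b\<^sub>1 + ip (F_adj \<psi>) b\<^sub>2"
proof -
  interpret P: hilbert_space "\<lambda>c x. (scaleK c (fst x), scaleK c (snd x))"
    "\<lambda>x y. ip (fst x) (fst y) + ip (snd x) (snd y)"
    by (rule hilbert_space_prod)
  note sub = adj_dom_subspace[OF D_dense F_linear]
  obtain M where M: "\<And>\<psi>. \<psi> \<in> D_adj \<Longrightarrow> norm (f \<psi>) \<le> M * graph_norm F_adj \<psi>"
    and add: "\<And>\<psi> \<eta>. \<psi> \<in> D_adj \<Longrightarrow> \<eta> \<in> D_adj \<Longrightarrow> f (\<psi> + \<eta>) = f \<psi> + f \<eta>"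
    and scale: "\<And>c \<psi>. \<psi> \<in> D_adj \<Longrightarrow> f (scaleK c \<psi>) = kcnj c * f \<psi>"
    using assms unfolding dual_space_def by blast
  let ?G = "(\<lambda>\<psi>. (\<psi>, F_adj \<psi>)) ` D_adj"
  have "\<exists>y. \<forall>x\<in>?G. f (fst x) = ip (fst x) (fst y) + ip (snd x) (snd y)"
  proof (rule P.Riesz_representation[where C = M])
    have "F_adj 0 = 0" using sub(3)[of 0 0] subspace_0[OF sub(1)] by simp
    then show "P.subspace ?G"
      unfolding P.subspace_def
      using sub(2,3) subspace_0[OF sub(1)] subspace_add[OF sub(1)] subspace_scale[OF sub(1)]
      by (auto simp: image_iff zero_prod_def intro!: bexI)
    show "f (fst (x + y)) = f (fst x) + f (fst y)" if "x \<in> ?G" "y \<in> ?G" for x y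
      using that add by auto
    show "f (fst (scaleK c (fst x), scaleK c (snd x))) = kcnj c * f (fst x)" if "x \<in> ?G" for c x
      using that scale by auto
    show "norm (f (fst x)) \<le> M * norm x" if "x \<in> ?G" for x
      using that M by (auto simp: graph_norm_def norm_Pair)
  qed
  then show ?thesis by fastforce
qed

end

context feedback_setting begin

abbreviation DAL where "DAL \<equiv> feedback_dom ip DA A B DL L"
abbreviation AL where "AL \<equiv> feedback_op ip DA A B L"

text \<open>The prefixes stand for the open and the closed loop.\<close>

sublocale ol: hilbert_semigroup scaleK ip DA A T
  by unfold_locales (rule A_generates)

sublocale cl: hilbert_semigroup scaleK ip DAL AL S
  by unfold_locales (rule feedback_generates)

lemma B_eq: "\<psi> \<in> ol.D_adj \<Longrightarrow> B v \<psi> = v * B 1 \<psi>"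
  using B_control unfolding control_operator_def by (metis mult.right_neutral)

lemma B_1_dual: "B 1 \<in> dual_space scaleK ol.D_adj ol.F_adj"
  using B_control unfolding control_operator_def by blast

lemma ip_AL:
  assumes "z \<in> DAL" "\<psi> \<in> ol.D_adj"
  shows "ip \<psi> (AL z) = ip (ol.F_adj \<psi>) z + L z * B 1 \<psi>"
proof -
  obtain y where y: "is_feedback_value ip DA A B L z y"
    using assms(1) unfolding feedback_dom_def by blast
  have "AL z = y"
    unfolding feedback_op_def
  proof (rule the_equality[of "is_feedback_value ip DA A B L z", OF y])
    fix y' assume "is_feedback_value ip DA A B L z y'"
    with y show "y' = y"
      unfolding is_feedback_value_def by (intro ol.adj_dom_separates) metis
  qed
  with y assms(2) show ?thesis unfolding is_feedback_value_def by (simp add: B_eq[of _ "L z"])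
qed

lemma eigenvector_D: "\<phi> \<in> ol.D_adj"
  using eigenvector_dom adjoint_dom_subset by blast

lemma L_eigenvector: "z \<in> DAL \<Longrightarrow> L z * B 1 \<phi> = ip (scaleK ev \<phi> - ol.F_adj \<phi>) z"
  using ip_AL[OF _ eigenvector_D] cl.ip_F_adj[OF eigenvector_dom] eigenvector
  by (simp add: ip_diff_left)

text \<open>If \<open>B 1 \<phi>\<close> vanished, the rank-one perturbation would not be seen by \<open>\<phi>\<close>, so \<open>\<phi>\<close> would be an
eigenvector of \<open>A\<^sup>*\<close> as well. Then \<open>B 1 (T\<^sup>* t \<phi>)\<close> solves a homogeneous linear equation with initial
value zero, hence vanishes for all times, and approximate controllability gives \<open>\<phi> = 0\<close>.\<close>

lemma B_eigenvector_nonzero: "B 1 \<phi> \<noteq> 0"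
proof
  assume zero: "B 1 \<phi> = 0"
  obtain b1 b2 where "\<And>\<psi>. \<psi> \<in> ol.D_adj \<Longrightarrow> B 1 \<psi> = ip \<psi> b1 + ip (ol.F_adj \<psi>) b2"
    using ol.dual_space_representation[OF B_1_dual] by blast
  then interpret c: controlled_semigroup scaleK ip DA A T "B 1" b1 b2
    by unfold_locales
  have "scaleK ev \<phi> - ol.F_adj \<phi> = 0"
    by (rule ip_eqI_dense[OF cl.D_dense]) (use L_eigenvector zero in force)
  then have eig: "ol.F_adj \<phi> = scaleK ev \<phi>" by simp
  define k where "k t = B 1 (ol.T_adj t \<phi>)" for t
  have ev_D: "ol.F_adj \<phi> \<in> ol.D_adj"
    unfolding eig by (rule subspace_scale[OF adj_dom_subspace(1)[OF ol.D_dense ol.F_linear] eigenvector_D])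
  have k_ev: "B 1 (ol.T_adj t (ol.F_adj \<phi>)) = kcnj ev * k t" if "t \<ge> 0" for t
  proof -
    have "ol.T_adj t (scaleK ev \<phi>) = scaleK ev (ol.T_adj t \<phi>)"
      by (rule adj_dom_subspace(3)[OF _ ol.T_linear[OF that] ol.bounded_adj_dom[OF ol.bounded_linear_T[OF that]]]) simp
    then show ?thesis
      using B_1_dual ol.T_adj_in_D(1)[OF eigenvector_D that] unfolding eig k_def dual_space_def by simp
  qed
  have "k t = 0" if "t \<ge> 0" for t
  proof (rule linear_integral_equation_zero[OF _ _ that])
    show "continuous_on {0..} k"
      unfolding k_def by (rule c.continuous_on_\<kappa>_T_adj[OF eigenvector_D])
    show "k t = kcnj ev * integral {0..t} k" if "t \<ge> 0" for t
    proof -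
      have "k t = integral {0..t} (\<lambda>s. B 1 (ol.T_adj s (ol.F_adj \<phi>)))"
        using c.\<kappa>_T_adj_integral[OF eigenvector_D ev_D that] zero by (simp add: k_def)
      also have "\<dots> = integral {0..t} (\<lambda>s. kcnj ev * k s)"
        by (intro integral_cong) (simp add: k_ev)
      finally show ?thesis by simp
    qed
  qed
  then have "\<phi> = 0"
    using controllable eigenvector_D unfolding approximately_controllable_def adjB_def k_def by simp
  then show False using eigenvector_nonzero by simp
qed

text \<open>The vector that represents \<open>L\<close>. It exists because, for \<open>z\<close> in the domain of the feedback operator,
the two expressions for \<open>ip \<phi> (AL z)\<close> differ by \<open>L z * B 1 \<phi>\<close>.\<close>

definition feedback_vector :: 'h where "feedback_vector = scaleK (kcnj (inverse (B 1 \<phi>))) (scaleK ev \<phi> - ol.F_adj \<phi>)"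

lemma L_eq: "z \<in> DAL \<Longrightarrow> L z = ip feedback_vector z"
  unfolding feedback_vector_def ip_scale_left kcnj_kcnj
  using B_eigenvector_nonzero by (simp add: L_eigenvector[symmetric])

text \<open>As \<open>L\<close> is bounded on the domain of the feedback operator, so is \<open>ip \<psi> (AL z)\<close> as a function of \<open>z\<close>
for every \<open>\<psi>\<close> in the domain of \<open>A\<^sup>*\<close>. This is the inclusion converse to the assumed one.\<close>

lemma D_adj_eq: "cl.D_adj = ol.D_adj"
  and F_adj_eq: "\<psi> \<in> ol.D_adj \<Longrightarrow> cl.F_adj \<psi> = ol.F_adj \<psi> + scaleK (kcnj (B 1 \<psi>)) feedback_vector"
proof -
  have *: "ip \<psi> (AL z) = ip (ol.F_adj \<psi> + scaleK (kcnj (B 1 \<psi>)) feedback_vector) z" if "\<psi> \<in> ol.D_adj" "z \<in> DAL" for \<psi> z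
    using ip_AL[OF that(2,1)] L_eq[OF that(2)] by (simp add: ip_add_left ip_scale_left mult.commute)
  show "\<psi> \<in> ol.D_adj \<Longrightarrow> cl.F_adj \<psi> = ol.F_adj \<psi> + scaleK (kcnj (B 1 \<psi>)) feedback_vector"
    by (rule adj_unique(2)[OF cl.D_dense *])
  show "cl.D_adj = ol.D_adj"
    using adjoint_dom_subset adj_unique(1)[OF cl.D_dense *] by blast
qed

text \<open>Rewriting a representation \<open>b1, b2\<close> with respect to \<open>A\<^sup>*\<close> in terms of the adjoint feedback operator
multiplies the left-hand side by \<open>1 + ip feedback_vector b2\<close>. This factor could vanish, but \<open>b2\<close> may
be shifted by any \<open>x\<close> in \<open>DA\<close> if \<open>b1\<close> is corrected by \<open>A x\<close>, and \<open>DA\<close> is dense.\<close>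

lemma B_representations:
  "\<exists>b\<^sub>1 b\<^sub>2 c\<^sub>1 c\<^sub>2. controlled_semigroup scaleK ip DA A T (B 1) b\<^sub>1 b\<^sub>2 \<and> controlled_semigroup scaleK ip DAL AL S (B 1) c\<^sub>1 c\<^sub>2"
proof -
  obtain b1 b2 where b: "\<And>\<psi>. \<psi> \<in> ol.D_adj \<Longrightarrow> B 1 \<psi> = ip \<psi> b1 + ip (ol.F_adj \<psi>) b2"
    using ol.dual_space_representation[OF B_1_dual] by blast
  have "\<exists>x\<in>DA. 1 + ip feedback_vector (b2 + x) \<noteq> 0"
  proof (rule ccontr)
    assume "\<not> ?thesis"
    then have eq: "\<And>x. x \<in> DA \<Longrightarrow> 1 + ip feedback_vector b2 + ip feedback_vector x = 0" by (simp add: ip_add_right add.assoc)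
    have "0 \<in> DA" using A_linear by (simp add: linear_operator_def subspace_0)
    then have "feedback_vector = 0" using eq eq[of 0] by (intro ip_eqI_dense[OF A_dense]) (auto simp: add_eq_0_iff)
    then show False using eq[OF \<open>0 \<in> DA\<close>] by simp
  qed
  then obtain x where x: "x \<in> DA" "1 + ip feedback_vector (b2 + x) \<noteq> 0" by blast
  define e where "e = 1 + ip feedback_vector (b2 + x)"
  have "B 1 \<psi> = ip \<psi> (scaleK (inverse e) (b1 - A x)) + ip (cl.F_adj \<psi>) (scaleK (inverse e) (b2 + x))"
    if "\<psi> \<in> cl.D_adj" for \<psi>
  proof -
    have \<psi>: "\<psi> \<in> ol.D_adj" using that D_adj_eq by simp
    have "B 1 \<psi> = ip \<psi> (b1 - A x) + ip (ol.F_adj \<psi>) (b2 + x)"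
      using b[OF \<psi>] ol.ip_F_adj[OF \<psi> x(1)] by (simp add: ip_diff_right ip_add_right)
    also have "ip (ol.F_adj \<psi>) (b2 + x) = ip (cl.F_adj \<psi>) (b2 + x) - B 1 \<psi> * ip feedback_vector (b2 + x)"
      by (simp add: F_adj_eq[OF \<psi>] ip_add_left ip_scale_left)
    finally have "B 1 \<psi> + B 1 \<psi> * ip feedback_vector (b2 + x)
        = ip \<psi> (b1 - A x) + (ip (cl.F_adj \<psi>) (b2 + x) - B 1 \<psi> * ip feedback_vector (b2 + x)) + B 1 \<psi> * ip feedback_vector (b2 + x)"
      by (rule arg_cong[where f = "\<lambda>a. a + B 1 \<psi> * ip feedback_vector (b2 + x)"])
    then have *: "B 1 \<psi> * e = ip \<psi> (b1 - A x) + ip (cl.F_adj \<psi>) (b2 + x)"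
      by (simp only: e_def distrib_left mult_1_right add_diff_eq diff_add_cancel)
    show ?thesis
      unfolding ip_scale_right distrib_left[symmetric] *[symmetric] using x(2) by (simp add: e_def[symmetric])
  qed
  then have "controlled_semigroup scaleK ip DAL AL S (B 1) (scaleK (inverse e) (b1 - A x)) (scaleK (inverse e) (b2 + x))"
    by unfold_locales
  moreover have "controlled_semigroup scaleK ip DA A T (B 1) b1 b2" by unfold_locales (rule b)
  ultimately show ?thesis by blast
qed

end

section \<open>Admissibility near time zero\<close>

text \<open>The function \<open>(a - s) powr (- 1/4)\<close> on \<open>s < a\<close>: square integrable, but unbounded at \<open>a\<close>.\<close>

definition singular_weight :: "real \<Rightarrow> real \<Rightarrow> real" where
  "singular_weight a s = (if s < a then 1 / sqrt (sqrt (a - s)) else 0)"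

lemma singular_weight_nonneg [simp]: "0 \<le> singular_weight a s"
  by (simp add: singular_weight_def)

lemma borel_measurable_singular_weight [measurable]: "singular_weight a \<in> borel_measurable borel"
  unfolding singular_weight_def[abs_def] by measurable

lemma integrable_singular_weight_square:
  assumes "a > 0" shows "integrable (lebesgue_on {0..a}) (\<lambda>s. (singular_weight a s)\<^sup>2)"
proof (rule absolutely_integrable_imp_integrable[OF nonnegative_absolutely_integrable_1])
  have "((\<lambda>s. (singular_weight a s)\<^sup>2) has_integral (- 2 * sqrt (a - a) - - 2 * sqrt (a - 0))) {0..a}"
  proof (rule fundamental_theorem_of_calculus_interior)
    show "continuous_on {0..a} (\<lambda>s. - 2 * sqrt (a - s))" by (intro continuous_intros)
    fix s assume s: "s \<in> {0<..<a}"
    have "((\<lambda>s. - 2 * sqrt (a - s)) has_real_derivative 1 / sqrt (a - s)) (at s)"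
      using s by (auto intro!: derivative_eq_intros simp: field_simps)
    moreover have "1 / sqrt (a - s) = (singular_weight a s)\<^sup>2"
      using s by (simp add: singular_weight_def power_divide)
    ultimately show "((\<lambda>s. - 2 * sqrt (a - s)) has_vector_derivative (singular_weight a s)\<^sup>2) (at s)"
      by (simp add: has_real_derivative_iff_has_vector_derivative)
  qed (use assms in simp)
  then show "(\<lambda>s. (singular_weight a s)\<^sup>2) integrable_on {0..a}" by blast
qed auto

context controlled_semigroup begin

text \<open>Admissibility bounds the pairing of \<open>\<kappa> (T_adj (\<tau> - s) \<psi>)\<close> with every square integrable input, for
\<open>\<psi>\<close> in the unit ball. Only the inputs \<open>singular_weight \<tau> s * v s\<close> with \<open>v\<close> bounded and continuous are
tested: these \<open>v\<close> form a Banach space, so the uniform boundedness principle bounds the integral of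
\<open>singular_weight \<tau> s * norm (\<kappa> (T_adj (\<tau> - s) \<psi>))\<close>. Since the weight is large near \<open>s = \<tau>\<close>, the
integral of the kernel over short times is small.\<close>

theorem admissible_imp_small_integral:
  assumes \<tau>: "\<tau> > 0"
    and adm: "\<And>u. square_integrable_on u {0..\<tau>} \<Longrightarrow>
      \<exists>x. \<forall>\<psi>\<in>D_adj. ip \<psi> x = integral\<^sup>L (lebesgue_on {0..\<tau>}) (\<lambda>s. u s * \<kappa> (T_adj (\<tau> - s) \<psi>))"
    and "\<epsilon> > 0"
  shows "\<exists>a>0. \<forall>\<psi>\<in>D_adj. integral {0..a} (\<lambda>s. norm (\<kappa> (T_adj s \<psi>))) \<le> \<epsilon> * norm \<psi>"
proof -
  let ?M = "lebesgue_on {0..\<tau>}"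
  let ?w = "singular_weight \<tau>"
  define k where "k \<psi> s = \<kappa> (T_adj (\<tau> - s) \<psi>)" for \<psi> s
  have cont_k: "continuous_on {0..\<tau>} (k \<psi>)" if "\<psi> \<in> D_adj" for \<psi>
    unfolding k_def
    by (rule continuous_on_compose2[OF continuous_on_\<kappa>_T_adj[OF that]]) (auto intro: continuous_intros)
  have meas_w: "?w \<in> borel_measurable ?M"
    by (intro measurable_restrict_space1 measurable_completion) simp
  have meas_v: "v \<in> borel_measurable ?M" if "continuous_on UNIV v" for v :: "real \<Rightarrow> 'k"
    using that by (intro measurable_restrict_space1 measurable_completion) (simp add: borel_measurable_continuous_onI)
  have sq_v: "square_integrable_on (\<lambda>s. of_real (?w s) * v s) {0..\<tau>}"
    if v: "continuous_on UNIV v" "\<And>s. norm (v s) \<le> C" for v :: "real \<Rightarrow> 'k" and C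
    unfolding square_integrable_on_def
  proof
    show meas: "(\<lambda>s. of_real (?w s) * v s) \<in> borel_measurable ?M"
      using meas_w meas_v[OF v(1)] by measurable
    show "integrable ?M (\<lambda>s. (norm (of_real (?w s) * v s))\<^sup>2)"
    proof (rule Bochner_Integration.integrable_bound)
      show "integrable ?M (\<lambda>s. (?w s)\<^sup>2 * C\<^sup>2)"
        using integrable_singular_weight_square[OF \<tau>] by simp
      show "(\<lambda>s. (norm (of_real (?w s) * v s))\<^sup>2) \<in> borel_measurable ?M" using meas by measurable
      show "AE s in ?M. norm ((norm (of_real (?w s) * v s))\<^sup>2) \<le> norm ((?w s)\<^sup>2 * C\<^sup>2)"
        using v(2) by (intro AE_I2) (auto simp: norm_mult power_mult_distrib intro!: mult_left_mono power_mono)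
    qed
  qed
  define \<Lambda> where "\<Lambda> \<psi> v = integral {0..\<tau>} (\<lambda>s. of_real (?w s) * apply_bcontfun v s * k \<psi> s)"
    for \<psi> and v :: "(real, 'k) bcontfun"
  have int_v: "integrable ?M (\<lambda>s. of_real (?w s) * apply_bcontfun v s * k \<psi> s)" if "\<psi> \<in> D_adj" for \<psi> v
    by (intro integrable_mult_continuous square_integrable_imp_integrable sq_v[where C = "norm v"] cont_k that norm_bounded) auto
  note int_v_HK = lebesgue_integrable_imp_integrable_on[OF int_v]
  have w1: "integrable ?M (\<lambda>s. of_real (?w s) :: real)"
  proof -
    have "square_integrable_on ?w {0..\<tau>}"
      unfolding square_integrable_on_def using meas_w integrable_singular_weight_square[OF \<tau>] by simp
    then show ?thesis using square_integrable_imp_integrable by simp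
  qed
  have int_w: "?w integrable_on {0..\<tau>}"
    using lebesgue_integrable_imp_integrable_on(1)[OF w1] by simp
  have int_wk: "(\<lambda>s. ?w s * norm (k \<psi> s)) integrable_on {0..\<tau>}" if "\<psi> \<in> D_adj" for \<psi>
    using lebesgue_integrable_imp_integrable_on(1)[OF integrable_mult_continuous[OF w1 continuous_on_norm[OF cont_k[OF that]]]]
    by simp
  let ?I = "{\<psi>\<in>D_adj. norm \<psi> \<le> 1}"
  have "\<exists>C. \<forall>\<psi>\<in>?I. \<forall>v. norm (\<Lambda> \<psi> v) \<le> C * norm v"
  proof (rule Banach_Steinhaus)
    fix \<psi> assume "\<psi> \<in> ?I"
    then have \<psi>: "\<psi> \<in> D_adj" by simp
    show "bounded_linear (\<Lambda> \<psi>)"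
    proof (rule bounded_linear_intro)
      show "\<Lambda> \<psi> (v + v') = \<Lambda> \<psi> v + \<Lambda> \<psi> v'" for v v'
        unfolding \<Lambda>_def
        by (subst Henstock_Kurzweil_Integration.integral_add[OF int_v_HK(1)[OF \<psi>] int_v_HK(1)[OF \<psi>], symmetric])
           (auto simp: plus_bcontfun.rep_eq algebra_simps)
      show "\<Lambda> \<psi> (c *\<^sub>R v) = c *\<^sub>R \<Lambda> \<psi> v" for c v
        unfolding \<Lambda>_def by (subst integral_cmul[symmetric]) (simp add: scaleR_bcontfun.rep_eq)
      show "norm (\<Lambda> \<psi> v) \<le> norm v * integral {0..\<tau>} (\<lambda>s. ?w s * norm (k \<psi> s))" for v
      proof -
        have "norm (\<Lambda> \<psi> v) \<le> integral {0..\<tau>} (\<lambda>s. norm v * (?w s * norm (k \<psi> s)))"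
          unfolding \<Lambda>_def
        proof (rule integral_norm_bound_integral[OF int_v_HK(1)[OF \<psi>]])
          show "(\<lambda>s. norm v * (?w s * norm (k \<psi> s))) integrable_on {0..\<tau>}"
            using int_wk[OF \<psi>] by (rule integrable_on_mult_right)
          show "norm (of_real (?w s) * apply_bcontfun v s * k \<psi> s) \<le> norm v * (?w s * norm (k \<psi> s))" for s
            using mult_right_mono[OF norm_bounded[of v s], of "?w s * norm (k \<psi> s)"]
            by (simp add: norm_mult mult_ac)
        qed auto
        then show ?thesis by simp
      qed
    qed
  next
    fix v :: "(real, 'k) bcontfun"
    obtain x where x: "\<forall>\<psi>\<in>D_adj. ip \<psi> x = integral\<^sup>L ?M (\<lambda>s. (of_real (?w s) * apply_bcontfun v s) * \<kappa> (T_adj (\<tau> - s) \<psi>))"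
      using adm[OF sq_v[where C = "norm v" and v = "apply_bcontfun v"]] norm_bounded by fastforce
    have "norm (\<Lambda> \<psi> v) \<le> norm x" if "\<psi> \<in> ?I" for \<psi>
    proof -
      have "\<Lambda> \<psi> v = ip \<psi> x"
        using that x int_v_HK(2)[of \<psi> v] by (simp add: \<Lambda>_def k_def)
      then show ?thesis
        using that Cauchy_Schwarz[of \<psi> x] mult_right_mono[of "norm \<psi>" 1 "norm x"] by simp
    qed
    then show "\<exists>C. \<forall>\<psi>\<in>?I. norm (\<Lambda> \<psi> v) \<le> C" by blast
  qed
  then obtain C where C: "\<And>\<psi> v. \<psi> \<in> D_adj \<Longrightarrow> norm \<psi> \<le> 1 \<Longrightarrow> norm (\<Lambda> \<psi> v) \<le> C * norm v" by auto
  define C' where "C' = max C 0"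
  have weighted: "integral {0..\<tau>} (\<lambda>s. ?w s * norm (k \<psi> s)) \<le> C'" if \<psi>: "\<psi> \<in> D_adj" "norm \<psi> \<le> 1" for \<psi>
  proof (rule field_le_epsilon)
    fix e' :: real assume "e' > 0"
    define e where "e = e' / (integral {0..\<tau>} ?w + 1)"
    have w_nonneg: "0 \<le> integral {0..\<tau>} ?w" by (rule Henstock_Kurzweil_Integration.integral_nonneg[OF int_w]) simp
    then have "e > 0" using \<open>e' > 0\<close> by (simp add: e_def)
    have "e * integral {0..\<tau>} ?w \<le> e'"
      using w_nonneg \<open>e' > 0\<close> by (simp add: e_def field_simps)
    define p where "p s = max 0 (min \<tau> s)" for s
    have p: "p s \<in> {0..\<tau>}" for s using \<tau> by (simp add: p_def)
    have p_id: "p s = s" if "s \<in> {0..\<tau>}" for s using that by (simp add: p_def)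
    \<comment> \<open>A continuous substitute for the conjugate sign of the kernel, which need not be continuous.\<close>
    define v where "v s = kcnj (k \<psi> (p s)) / of_real (norm (k \<psi> (p s)) + e)" for s
    have cont_kp: "continuous_on UNIV (\<lambda>s. k \<psi> (p s))"
      by (rule continuous_on_compose2[OF cont_k[OF \<psi>(1)]]) (use p in \<open>auto simp: p_def[abs_def] intro!: continuous_intros\<close>)
    have denom: "norm (k \<psi> s) + e > 0" for s using \<open>e > 0\<close> by (simp add: add_nonneg_pos)
    have cont_v: "continuous_on UNIV v"
      unfolding v_def
      by (intro continuous_intros cont_kp) (metis denom of_real_eq_0_iff less_irrefl)
    have v_le: "norm (v s) \<le> 1" for s
      unfolding v_def norm_divide norm_kcnj norm_of_real using denom[of "p s"] \<open>e > 0\<close> by (simp add: abs_of_pos)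
    have v_b: "v \<in> bcontfun" using cont_v v_le by (auto simp: bcontfun_def bounded_iff)
    then have app: "apply_bcontfun (Bcontfun v) = v" by (simp add: Bcontfun_inverse)
    have "norm (Bcontfun v) \<le> 1" by (rule norm_bound) (simp add: app v_le)
    then have "C * norm (Bcontfun v) \<le> C'"
      unfolding C'_def by (metis max.cobounded1 max.cobounded2 mult_left_le mult_right_mono norm_ge_zero order_trans)
    then have \<Lambda>_le: "norm (\<Lambda> \<psi> (Bcontfun v)) \<le> C'" using C[OF \<psi>] order_trans by blast
    have prod: "v s * k \<psi> s = of_real ((norm (k \<psi> s))\<^sup>2 / (norm (k \<psi> s) + e))" if "s \<in> {0..\<tau>}" for s
      unfolding v_def p_id[OF that] of_real_divide kcnj_mult_self[symmetric] by simp
    have int_kre: "integral {0..\<tau>} (\<lambda>s. kre (of_real (?w s) * v s * k \<psi> s)) = kre (\<Lambda> \<psi> (Bcontfun v))"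
      and int_kre': "(\<lambda>s. kre (of_real (?w s) * v s * k \<psi> s)) integrable_on {0..\<tau>}"
      using integral_linear[OF int_v_HK(1)[OF \<psi>(1), of "Bcontfun v"] bounded_linear_kre]
        integrable_linear[OF int_v_HK(1)[OF \<psi>(1), of "Bcontfun v"] bounded_linear_kre]
      unfolding \<Lambda>_def app by (simp_all add: o_def)
    have "integral {0..\<tau>} (\<lambda>s. ?w s * norm (k \<psi> s)) - e * integral {0..\<tau>} ?w
        = integral {0..\<tau>} (\<lambda>s. ?w s * norm (k \<psi> s) - e * ?w s)"
      using Henstock_Kurzweil_Integration.integral_diff[OF int_wk[OF \<psi>(1)] integrable_on_mult_right[OF int_w, of e]] by simp
    also have "\<dots> \<le> integral {0..\<tau>} (\<lambda>s. kre (of_real (?w s) * v s * k \<psi> s))"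
    proof (rule integral_le[OF integrable_diff[OF int_wk[OF \<psi>(1)] integrable_on_mult_right[OF int_w, of e]] int_kre'])
      fix s assume s: "s \<in> {0..\<tau>}"
      have "norm (k \<psi> s) - e \<le> (norm (k \<psi> s))\<^sup>2 / (norm (k \<psi> s) + e)"
        using denom[of s] by (simp add: field_simps power2_eq_square)
      then have "?w s * (norm (k \<psi> s) - e) \<le> ?w s * ((norm (k \<psi> s))\<^sup>2 / (norm (k \<psi> s) + e))"
        by (intro mult_left_mono) auto
      also have "\<dots> = kre (of_real (?w s) * v s * k \<psi> s)"
        unfolding mult.assoc prod[OF s] of_real_mult[symmetric] kre_of_real ..
      finally show "?w s * norm (k \<psi> s) - e * ?w s \<le> kre (of_real (?w s) * v s * k \<psi> s)"
        by (simp add: algebra_simps)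
    qed
    also have "\<dots> \<le> C'" unfolding int_kre using kre_le_norm \<Lambda>_le order_trans by blast
    finally show "integral {0..\<tau>} (\<lambda>s. ?w s * norm (k \<psi> s)) \<le> C' + e'"
      using \<open>e * integral {0..\<tau>} ?w \<le> e'\<close> by simp
  qed
  have "C' \<ge> 0" by (simp add: C'_def)
  \<comment> \<open>On \<open>{\<tau> - a..<\<tau>}\<close> the weight is at least \<open>1 / q\<close> because \<open>a \<le> q ^ 4\<close>.\<close>
  define q where "q = \<epsilon> / (C' + 1)"
  define a where "a = min \<tau> (q ^ 4)"
  have q: "q > 0" "C' * q \<le> \<epsilon>" using \<open>\<epsilon> > 0\<close> \<open>C' \<ge> 0\<close> by (auto simp: q_def field_simps)
  have a: "a > 0" "a \<le> \<tau>" "sqrt (sqrt a) \<le> q"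
  proof -
    have "sqrt (q ^ 4) = q\<^sup>2" by (rule real_sqrt_unique) (simp_all flip: power_mult)
    then have "sqrt (sqrt (q ^ 4)) = q" using q by simp
    moreover have "sqrt (sqrt a) \<le> sqrt (sqrt (q ^ 4))" by (simp add: a_def)
    ultimately show "sqrt (sqrt a) \<le> q" by simp
  qed (use \<tau> q in \<open>auto simp: a_def\<close>)
  have unit: "integral {0..a} (\<lambda>s. norm (\<kappa> (T_adj s \<psi>))) \<le> \<epsilon>" if \<psi>: "\<psi> \<in> D_adj" "norm \<psi> \<le> 1" for \<psi>
  proof -
    let ?f = "\<lambda>s. if s = \<tau> then 0 else norm (k \<psi> s)"
    have cont: "continuous_on {\<tau> - a..\<tau>} (\<lambda>s. norm (k \<psi> s))"
      by (intro continuous_on_norm continuous_on_subset[OF cont_k[OF \<psi>(1)]]) (use a in auto)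
    have "integral {0..a} (\<lambda>s. norm (\<kappa> (T_adj s \<psi>))) = integral {\<tau> - a..\<tau>} (\<lambda>s. norm (k \<psi> s))"
      using integral_reflect_shift[of "\<tau> - a" \<tau> "\<lambda>s. norm (\<kappa> (T_adj s \<psi>))" \<tau>] by (simp add: k_def)
    \<comment> \<open>The weight vanishes at the single point \<open>\<tau>\<close>, which is removed.\<close>
    also have "\<dots> = integral {\<tau> - a..\<tau>} ?f"
      by (rule integral_spike[of "{\<tau>}"]) auto
    also have "\<dots> \<le> integral {\<tau> - a..\<tau>} (\<lambda>s. q * (?w s * norm (k \<psi> s)))"
    proof (rule integral_le)
      show "?f integrable_on {\<tau> - a..\<tau>}"
        by (rule integrable_spike[OF integrable_continuous_real[OF cont], of "{\<tau>}"]) auto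
      show "(\<lambda>s. q * (?w s * norm (k \<psi> s))) integrable_on {\<tau> - a..\<tau>}"
        by (rule integrable_on_mult_right[OF integrable_on_subinterval[OF int_wk[OF \<psi>(1)]]]) (use a in auto)
      fix s assume s: "s \<in> {\<tau> - a..\<tau>}"
      show "?f s \<le> q * (?w s * norm (k \<psi> s))"
      proof (cases "s = \<tau>")
        case False
        then have pos: "0 < sqrt (sqrt (\<tau> - s))" and lt: "s < \<tau>" using s by auto
        have "sqrt (sqrt (\<tau> - s)) \<le> sqrt (sqrt a)" using s by simp
        then have "sqrt (sqrt (\<tau> - s)) \<le> q" using a(3) by (rule order_trans)
        then have "1 \<le> q * ?w s" using pos lt by (simp add: singular_weight_def field_simps)
        then have "1 * norm (k \<psi> s) \<le> q * ?w s * norm (k \<psi> s)" by (rule mult_right_mono) simp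
        then show ?thesis using False by (simp add: mult.assoc)
      qed (use q in simp)
    qed
    also have "\<dots> = q * integral {\<tau> - a..\<tau>} (\<lambda>s. ?w s * norm (k \<psi> s))" by simp
    also have "\<dots> \<le> q * integral {0..\<tau>} (\<lambda>s. ?w s * norm (k \<psi> s))"
      using q a
      by (intro mult_left_mono integral_subset_le integrable_on_subinterval[OF int_wk[OF \<psi>(1)]] int_wk \<psi>(1)) auto
    also have "\<dots> \<le> q * C'" using q weighted[OF \<psi>] by (intro mult_left_mono) auto
    finally show ?thesis using q by (simp add: mult.commute)
  qed
  show ?thesis
  proof (intro exI[of _ a] conjI ballI a(1))
    fix \<psi> assume \<psi>: "\<psi> \<in> D_adj"
    show "integral {0..a} (\<lambda>s. norm (\<kappa> (T_adj s \<psi>))) \<le> \<epsilon> * norm \<psi>"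
    proof (cases "\<psi> = 0")
      case True
      have "\<kappa> (T_adj s 0) = 0" if "s \<ge> 0" for s
        using \<kappa>_T_adj[OF \<psi> that] adj_unique(2)[OF D_dense, of 0 F 0] True by simp
      then have "integral {0..a} (\<lambda>s. norm (\<kappa> (T_adj s \<psi>))) = integral {0..a} (\<lambda>s. 0)"
        unfolding True by (intro integral_cong) auto
      then show ?thesis using \<open>\<epsilon> > 0\<close> True by simp
    next
      case False
      note sub = adj_dom_subspace[OF D_dense F_linear]
      define c :: 'k where "c = of_real (inverse (norm \<psi>))"
      have "scaleK c \<psi> \<in> D_adj" "norm (scaleK c \<psi>) \<le> 1"
        using subspace_scale[OF sub(1) \<psi>] False by (auto simp: c_def norm_scaleK norm_of_real simp del: of_real_inverse)
      note u = unit[OF this]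
      have "\<kappa> (T_adj s (scaleK c \<psi>)) = of_real (inverse (norm \<psi>)) * \<kappa> (T_adj s \<psi>)" if "s \<ge> 0" for s
        using \<kappa>_T_adj[OF \<open>scaleK c \<psi> \<in> D_adj\<close> that] \<kappa>_T_adj[OF \<psi> that] sub(3)[OF \<psi>, of c]
        by (simp add: ip_scale_left c_def distrib_left del: of_real_inverse)
      then have "integral {0..a} (\<lambda>s. norm (\<kappa> (T_adj s (scaleK c \<psi>))))
          = integral {0..a} (\<lambda>s. inverse (norm \<psi>) * norm (\<kappa> (T_adj s \<psi>)))"
        by (intro integral_cong) (simp add: norm_mult norm_of_real del: of_real_inverse)
      with u show ?thesis using False by (simp add: field_simps)
    qed
  qed
qed

end

section \<open>Short-time bound for closed-loop trajectories\<close>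

context feedback_setting begin

text \<open>What remains of a mild solution after integration in time. The input \<open>h\<close> enters only through its
integral, and \<open>variation_of_constants_integrated\<close> recovers the integral of the mild formula.\<close>

definition integrated_solution :: "'h \<Rightarrow> (real \<Rightarrow> 'k) \<Rightarrow> (real \<Rightarrow> 'h) \<Rightarrow> bool" where
  "integrated_solution z0 h z \<longleftrightarrow>
     continuous_on {0..} z \<and> (\<forall>t\<ge>0. integrable (lebesgue_on {0..t}) h) \<and>
     (\<forall>t\<ge>0. \<forall>\<psi>\<in>ol.D_adj.
        ip \<psi> (z t) = ip \<psi> z0 + ip (cl.F_adj \<psi>) (integral {0..t} z) + B 1 \<psi> * integral {0..t} h)"

lemma integrated_solution_if_mild:
  assumes mild: "mild_trajectory scaleK ip DA A B DL L S z0 h z"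
    and h: "\<And>t. t \<ge> 0 \<Longrightarrow> square_integrable_on h {0..t}"
  shows "integrated_solution z0 h z"
proof -
  obtain c1 c2 where "controlled_semigroup scaleK ip DAL AL S (B 1) c1 c2" using B_representations by blast
  then interpret c: controlled_semigroup scaleK ip DAL AL S "B 1" c1 c2 .
  have z: "continuous_on {0..} z" using mild unfolding mild_trajectory_def by blast
  have int_h: "integrable (lebesgue_on {0..t}) h" if "t \<ge> 0" for t
    using square_integrable_imp_integrable[OF h[OF that]] .
  have eq: "ip \<psi> (z t) = ip \<psi> (S t z0) + integral {0..t} (\<lambda>s. h s * B 1 (cl.T_adj (t - s) \<psi>))"
    if t: "t \<ge> 0" and \<psi>: "\<psi> \<in> cl.D_adj" for t \<psi>
  proof -
    have "input_map ip S B h t \<psi> = integral\<^sup>L (lebesgue_on {0..t}) (\<lambda>s. h s * B 1 (cl.T_adj (t - s) \<psi>))"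
      unfolding input_map_def
    proof (rule Bochner_Integration.integral_cong[OF refl])
      fix s assume "s \<in> space (lebesgue_on {0..t})"
      then have "cl.T_adj (t - s) \<psi> \<in> ol.D_adj" using cl.T_adj_in_D(1)[OF \<psi>] D_adj_eq by simp
      then show "B (h s) (cl.T_adj (t - s) \<psi>) = h s * B 1 (cl.T_adj (t - s) \<psi>)" by (rule B_eq)
    qed
    also have "\<dots> = integral {0..t} (\<lambda>s. h s * B 1 (cl.T_adj (t - s) \<psi>))"
    proof (rule lebesgue_integrable_imp_integrable_on(2)[OF integrable_mult_continuous[OF int_h[OF t]]])
      show "continuous_on {0..t} (\<lambda>s. B 1 (cl.T_adj (t - s) \<psi>))"
        by (rule continuous_on_compose2[OF c.continuous_on_\<kappa>_T_adj[OF \<psi>]]) (auto intro: continuous_intros)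
    qed simp
    finally show ?thesis using mild t \<psi> unfolding mild_trajectory_def by simp
  qed
  show ?thesis
    unfolding integrated_solution_def
    using z int_h c.integrated_equation_if_mild[OF z int_h eq] D_adj_eq by simp
qed

lemma integrated_solution_initial:
  assumes "integrated_solution z0 h z" shows "z 0 = z0"
  using assms unfolding integrated_solution_def by (intro ol.adj_dom_separates) simp

text \<open>In terms of the open-loop adjoint the input becomes \<open>h + ip feedback_vector z\<close>, with integral \<open>G\<close>.
The open-loop variation of constants formula then bounds increments of the integral \<open>W\<close> of \<open>z\<close> by the
Lipschitz constant of \<open>G\<close> times the small integral of the kernel, and difference quotients of \<open>W\<close>
converge to \<open>z\<close>. The contribution of \<open>ip feedback_vector z\<close> is at most half of the maximum of
\<open>norm (z s)\<close> and is absorbed.\<close>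

theorem short_time_bound:
  "\<exists>M\<ge>1. \<forall>\<epsilon>>0. \<exists>a>0. \<forall>z0 h z C t. integrated_solution z0 h z \<longrightarrow> C \<ge> 0 \<longrightarrow> 0 \<le> t \<longrightarrow> t \<le> a \<longrightarrow>
     (AE s in lebesgue_on {0..t}. norm (h s) \<le> C) \<longrightarrow> norm (z t) \<le> M * norm z0 + \<epsilon> * C"
proof -
  obtain b1 b2 where "controlled_semigroup scaleK ip DA A T (B 1) b1 b2" using B_representations by blast
  then interpret c: controlled_semigroup scaleK ip DA A T "B 1" b1 b2 .
  obtain \<tau>' where \<tau>': "\<tau>' > 0" and adm: "\<And>u. square_integrable_on u {0..\<tau>'} \<Longrightarrow>
      \<exists>x. \<forall>\<psi>\<in>ol.D_adj. ip \<psi> x = input_map ip T B u \<tau>' \<psi>"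
    using B_admissible unfolding admissible_def by blast
  have input: "input_map ip T B u \<tau>' \<psi> = integral\<^sup>L (lebesgue_on {0..\<tau>'}) (\<lambda>s. u s * B 1 (ol.T_adj (\<tau>' - s) \<psi>))"
    if "\<psi> \<in> ol.D_adj" for u \<psi>
    unfolding input_map_def
    by (intro Bochner_Integration.integral_cong refl B_eq ol.T_adj_in_D(1) that) simp
  have small: "\<exists>a>0. \<forall>\<psi>\<in>ol.D_adj. integral {0..a} (\<lambda>s. norm (B 1 (ol.T_adj s \<psi>))) \<le> \<epsilon> * norm \<psi>" if "\<epsilon> > 0" for \<epsilon>
    using c.admissible_imp_small_integral[OF \<tau>' _ that] adm input by simp
  obtain M0 where M0: "M0 \<ge> 1"
    and norming: "\<And>x R. R \<ge> 0 \<Longrightarrow> (\<And>\<psi>. \<psi> \<in> ol.D_adj \<Longrightarrow> norm (ip \<psi> x) \<le> R * norm \<psi>) \<Longrightarrow> norm x \<le> M0 * R"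
    using ol.adj_dom_norming by blast
  obtain M1 where M1: "M1 \<ge> 1" "\<And>t x. t \<in> {0..1} \<Longrightarrow> norm (T t x) \<le> M1 * norm x"
    using ol.T_bounded_interval[of 1] by blast
  show ?thesis
  proof (rule exI[of _ "2 * M0 * M1"], intro conjI allI impI)
    have "1 * 1 \<le> M0 * M1" using M0 M1(1) by (intro mult_mono) auto
    then show "1 \<le> 2 * M0 * M1" by simp
    fix \<epsilon> :: real assume "\<epsilon> > 0"
    \<comment> \<open>The first bound gives the factor \<open>\<epsilon>\<close> of \<open>C\<close>, the second one the factor \<open>1/2\<close> of the absorbed term.\<close>
    define e where "e = min (\<epsilon> / (2 * M0)) (1 / (2 * M0 * (norm feedback_vector + 1)))"
    have lpos: "norm feedback_vector + 1 > 0" by (simp add: add_nonneg_pos)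
    have e: "e > 0" "2 * M0 * e \<le> \<epsilon>" "M0 * e * norm feedback_vector \<le> 1 / 2"
    proof -
      show "e > 0" using M0 lpos \<open>\<epsilon> > 0\<close> by (simp add: e_def)
      have "e \<le> \<epsilon> / (2 * M0)" by (simp add: e_def)
      then show "2 * M0 * e \<le> \<epsilon>" using M0 by (simp add: field_simps)
      have "e \<le> 1 / (2 * M0 * (norm feedback_vector + 1))" by (simp add: e_def)
      moreover have "0 < 2 * M0 * (norm feedback_vector + 1)" using M0 lpos by simp
      ultimately have "e * (2 * M0 * (norm feedback_vector + 1)) \<le> 1" by (simp only: pos_le_divide_eq)
      then have "M0 * e * (norm feedback_vector + 1) \<le> 1 / 2" by (simp add: algebra_simps)
      moreover have "0 \<le> M0 * e" using M0 \<open>e > 0\<close> by simp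
      ultimately show "M0 * e * norm feedback_vector \<le> 1 / 2" by (simp add: distrib_left)
    qed
    obtain a0 where a0: "a0 > 0" and kernel: "\<And>\<psi>. \<psi> \<in> ol.D_adj \<Longrightarrow> integral {0..a0} (\<lambda>s. norm (B 1 (ol.T_adj s \<psi>))) \<le> e * norm \<psi>"
      using small[OF e(1)] by blast
    show "\<exists>a>0. \<forall>z0 h z C t. integrated_solution z0 h z \<longrightarrow> C \<ge> 0 \<longrightarrow> 0 \<le> t \<longrightarrow> t \<le> a \<longrightarrow>
     (AE s in lebesgue_on {0..t}. norm (h s) \<le> C) \<longrightarrow> norm (z t) \<le> 2 * M0 * M1 * norm z0 + \<epsilon> * C"
    proof (intro exI[of _ "min a0 1"] conjI allI impI)
      show "min a0 1 > 0" using a0 by simp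
      fix z0 h z C t
      assume sol: "integrated_solution z0 h z" and "C \<ge> 0" and t: "0 \<le> t" "t \<le> min a0 1"
        and bound: "AE s in lebesgue_on {0..t}. norm (h s) \<le> C"
      have z: "continuous_on {0..} z" using sol unfolding integrated_solution_def by blast
      have int_h: "integrable (lebesgue_on {0..s}) h" if "s \<ge> 0" for s
        using sol that unfolding integrated_solution_def by blast
      have int_z: "z integrable_on {0..s}" for s
        by (intro integrable_continuous_real continuous_on_subset[OF z]) auto
      have h_HK: "h integrable_on {0..s}" if "s \<ge> 0" for s
        using lebesgue_integrable_imp_integrable_on(1)[OF int_h[OF that]] by simp
      have "\<exists>s\<in>{0..t}. \<forall>r\<in>{0..t}. norm (z r) \<le> norm (z s)"
        using t by (intro continuous_attains_sup continuous_on_norm continuous_on_subset[OF z]) auto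
      then obtain s\<^sub>m where s\<^sub>m: "s\<^sub>m \<in> {0..t}" and max: "\<And>r. r \<in> {0..t} \<Longrightarrow> norm (z r) \<le> norm (z s\<^sub>m)" by blast
      define Z where "Z = norm (z s\<^sub>m)"
      define g where "g = C + norm feedback_vector * Z"
      have "g \<ge> 0" using \<open>C \<ge> 0\<close> by (simp add: g_def Z_def)
      define W where "W s = integral {0..s} z" for s
      define G where "G s = integral {0..s} h + ip feedback_vector (W s)" for s
      have G_diff: "norm (G y - G x) \<le> g * (y - x)" if "0 \<le> x" "x \<le> y" "y \<le> t" for x y
      proof -
        have "G y - G x = integral {x..y} h + ip feedback_vector (integral {x..y} z)"
          using integral_diff_eq[OF h_HK \<open>0 \<le> x\<close> \<open>x \<le> y\<close>] integral_diff_eq[OF int_z \<open>0 \<le> x\<close> \<open>x \<le> y\<close>] that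
          by (simp add: G_def W_def ip_diff_right[symmetric] add_diff_add)
        moreover have "norm (integral {x..y} h) \<le> C * (y - x)"
        proof (rule norm_integral_le_AE)
          show "integrable (lebesgue_on {x..y}) h"
            by (rule integrable_lebesgue_on_subset[OF int_h[of y]]) (use that in auto)
          show "AE s in lebesgue_on {x..y}. norm (h s) \<le> C"
            by (rule AE_lebesgue_on_subset[OF bound]) (use that in auto)
        qed (use that in simp)
        moreover have "norm (ip feedback_vector (integral {x..y} z)) \<le> norm feedback_vector * (Z * (y - x))"
        proof (rule order_trans[OF Cauchy_Schwarz mult_left_mono[OF integral_bound]])
          show "continuous_on {x..y} z" by (rule continuous_on_subset[OF z]) (use that in auto)
          show "norm (z r) \<le> Z" if "r \<in> {x..y}" for r
            unfolding Z_def by (rule max) (use that \<open>0 \<le> x\<close> \<open>y \<le> t\<close> in auto)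
        qed (use that in auto)
        ultimately show ?thesis
          using norm_triangle_ineq[of "integral {x..y} h" "ip feedback_vector (integral {x..y} z)"]
          by (simp add: g_def distrib_right mult.assoc)
      qed
      have G_cont: "continuous_on {0..t} G"
      proof -
        have "g-lipschitz_on {0..t} G"
        proof (rule lipschitz_onI[OF _ \<open>g \<ge> 0\<close>])
          fix x y assume "x \<in> {0..t}" "y \<in> {0..t}"
          then show "dist (G x) (G y) \<le> g * dist x y"
            using G_diff[of x y] G_diff[of y x]
            by (cases "x \<le> y") (auto simp: dist_norm norm_minus_commute)
        qed
        then show ?thesis by (rule lipschitz_on_continuous_on)
      qed
      have G0: "G 0 = 0" by (simp add: G_def W_def)
      have eq: "ip \<psi> (z s) = ip \<psi> z0 + ip (ol.F_adj \<psi>) (integral {0..s} z) + B 1 \<psi> * G s"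
        if "s \<in> {0..t}" "\<psi> \<in> ol.D_adj" for s \<psi>
        using sol that F_adj_eq[OF that(2)] unfolding integrated_solution_def
        by (simp add: G_def W_def ip_add_left ip_scale_left algebra_simps)
      have W_eq: "ip \<psi> (W s) = ip \<psi> (ol.orbit_integral s z0) + integral {0..s} (\<lambda>q. B 1 (ol.T_adj q \<psi>) * G (s - q))"
        if s: "s \<in> {0..t}" and \<psi>: "\<psi> \<in> ol.D_adj" for s \<psi>
      proof -
        have "ip \<psi> (W s) = ip \<psi> (ol.orbit_integral s z0) + integral {0..s} (\<lambda>q. B 1 (ol.T_adj (s - q) \<psi>) * G q)"
          unfolding W_def
          by (rule c.variation_of_constants_integrated)
             (use s \<psi> eq in \<open>auto intro: continuous_on_subset[OF z] continuous_on_subset[OF G_cont]\<close>)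
        moreover have "integral {0..s} (\<lambda>q. B 1 (ol.T_adj (s - q) \<psi>) * G q) = integral {0..s} (\<lambda>q. B 1 (ol.T_adj q \<psi>) * G (s - q))"
          using integral_reflect_shift[of 0 s "\<lambda>q. B 1 (ol.T_adj q \<psi>) * G (s - q)" s] by simp
        ultimately show ?thesis by simp
      qed
      define R where "R = M1 * norm z0 + e * g"
      have "R \<ge> 0" using M1 e \<open>g \<ge> 0\<close> by (simp add: R_def)
      have W_diff: "norm (W s - W r) \<le> M0 * (R * (s - r))" if rs: "0 \<le> r" "r \<le> s" "s \<le> t" for r s
      proof (rule norming)
        show "0 \<le> R * (s - r)" using \<open>R \<ge> 0\<close> rs by simp
        fix \<psi> assume \<psi>: "\<psi> \<in> ol.D_adj"
        let ?k = "\<lambda>q. B 1 (ol.T_adj q \<psi>)"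
        have k: "continuous_on {0..s'} ?k" for s'
          by (rule continuous_on_subset[OF c.continuous_on_\<kappa>_T_adj[OF \<psi>]]) auto
        have contG: "continuous_on {0..s} (\<lambda>q. G (s - q))" "continuous_on {0..s} (\<lambda>q. G (max 0 (r - q)))"
          by (rule continuous_on_compose2[OF G_cont]; use rs in \<open>auto intro!: continuous_intros\<close>)+
        have int1: "(\<lambda>q. ?k q * G (s - q)) integrable_on {0..s}"
          and int2: "(\<lambda>q. ?k q * G (max 0 (r - q))) integrable_on {0..s}"
          by (intro integrable_continuous_real continuous_on_mult k contG)+
        have "integral {0..r} (\<lambda>q. ?k q * G (r - q)) = integral {0..r} (\<lambda>q. ?k q * G (max 0 (r - q)))"
          by (intro integral_cong) simp
        also have "\<dots> = integral {0..s} (\<lambda>q. ?k q * G (max 0 (r - q)))"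
        proof -
          have "integral {r..s} (\<lambda>q. ?k q * G (max 0 (r - q))) = integral {r..s} (\<lambda>q. 0)"
            by (intro integral_cong) (simp add: G0 max_absorb1)
          then show ?thesis
            using Henstock_Kurzweil_Integration.integral_combine[OF rs(1,2) int2] by simp
        qed
        finally have decomposition: "ip \<psi> (W s - W r) = ip \<psi> (ol.orbit_integral s z0 - ol.orbit_integral r z0)
            + integral {0..s} (\<lambda>q. ?k q * G (s - q) - ?k q * G (max 0 (r - q)))"
          using W_eq[OF _ \<psi>, of s] W_eq[OF _ \<psi>, of r] rs Henstock_Kurzweil_Integration.integral_diff[OF int1 int2]
          by (simp add: ip_diff_right algebra_simps)
        have free: "norm (ip \<psi> (ol.orbit_integral s z0 - ol.orbit_integral r z0)) \<le> norm \<psi> * (M1 * norm z0 * (s - r))"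
        proof -
          have "ol.orbit_integral s z0 - ol.orbit_integral r z0 = integral {r..s} (\<lambda>q. T q z0)"
            unfolding ol.orbit_integral_def by (rule integral_diff_eq[OF ol.T_integrable rs(1,2)]) simp
          moreover have "norm (integral {r..s} (\<lambda>q. T q z0)) \<le> M1 * norm z0 * (s - r)"
            by (rule integral_bound[OF rs(2) continuous_on_subset[OF ol.continuous_on_T]]) (use rs t M1(2) in auto)
          ultimately show ?thesis
            by (metis Cauchy_Schwarz mult_left_mono norm_ge_zero order_trans)
        qed
        have forced: "norm (integral {0..s} (\<lambda>q. ?k q * G (s - q) - ?k q * G (max 0 (r - q)))) \<le> e * norm \<psi> * (g * (s - r))"
        proof -
          have "norm (integral {0..s} (\<lambda>q. ?k q * G (s - q) - ?k q * G (max 0 (r - q))))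
              \<le> integral {0..s} (\<lambda>q. norm (?k q) * (g * (s - r)))"
          proof (rule integral_norm_bound_integral[OF integrable_diff[OF int1 int2]])
            show "(\<lambda>q. norm (?k q) * (g * (s - r))) integrable_on {0..s}"
              by (intro integrable_continuous_real continuous_intros k)
            fix q assume q: "q \<in> {0..s}"
            have "norm (G (s - q) - G (max 0 (r - q))) \<le> g * ((s - q) - max 0 (r - q))"
              by (rule G_diff) (use q rs in auto)
            also have "\<dots> \<le> g * (s - r)" using \<open>g \<ge> 0\<close> by (intro mult_left_mono) auto
            finally show "norm (?k q * G (s - q) - ?k q * G (max 0 (r - q))) \<le> norm (?k q) * (g * (s - r))"
              by (simp add: right_diff_distrib[symmetric] norm_mult mult_left_mono)
          qed
          also have "\<dots> = integral {0..s} (\<lambda>q. norm (?k q)) * (g * (s - r))" by simp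
          also have "\<dots> \<le> integral {0..a0} (\<lambda>q. norm (?k q)) * (g * (s - r))"
            using \<open>g \<ge> 0\<close> rs t
            by (intro mult_right_mono integral_subset_le integrable_continuous_real continuous_on_norm k) auto
          also have "\<dots> \<le> e * norm \<psi> * (g * (s - r))"
            using \<open>g \<ge> 0\<close> rs by (intro mult_right_mono kernel \<psi>) auto
          finally show ?thesis .
        qed
        have "norm (ip \<psi> (W s - W r)) \<le> norm \<psi> * (M1 * norm z0 * (s - r)) + e * norm \<psi> * (g * (s - r))"
          unfolding decomposition by (rule norm_triangle_mono[OF free forced])
        also have "\<dots> = R * (s - r) * norm \<psi>" by (simp add: R_def algebra_simps)
        finally show "norm (ip \<psi> (W s - W r)) \<le> R * (s - r) * norm \<psi>" .
      qed
      have z_le: "norm (z s) \<le> M0 * R" if s: "s \<in> {0..t}" for s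
      proof (cases "s = 0")
        case True
        have "1 * norm z0 \<le> M0 * M1 * norm z0" using \<open>1 * 1 \<le> M0 * M1\<close> by (intro mult_right_mono) auto
        also have "\<dots> \<le> M0 * R" using M0 e \<open>g \<ge> 0\<close> by (simp add: R_def distrib_left)
        finally show ?thesis using True integrated_solution_initial[OF sol] by simp
      next
        case False
        then have "s > 0" using s by simp
        have "(W has_vector_derivative z s) (at s within {0..s})"
          unfolding W_def[abs_def]
          using s by (intro integral_has_vector_derivative continuous_on_subset[OF z]) auto
        then have "((\<lambda>r. (W r - W s) /\<^sub>R (r - s)) \<longlongrightarrow> z s) (at s within {0..s})"
          by (simp only: has_vector_derivative_iff_quotient)
        then have lim: "((\<lambda>r. norm ((W r - W s) /\<^sub>R (r - s))) \<longlongrightarrow> norm (z s)) (at_left s)"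
          using \<open>s > 0\<close> by (intro tendsto_norm) (simp add: at_within_Icc_at_left)
        show ?thesis
        proof (rule tendsto_upperbound[OF lim])
          have "norm ((W r - W s) /\<^sub>R (r - s)) \<le> M0 * R" if "0 < r" "r < s" for r
          proof -
            have "norm ((W r - W s) /\<^sub>R (r - s)) = norm (W s - W r) / (s - r)"
              using that by (simp add: norm_minus_commute divide_inverse mult.commute)
            then show ?thesis using W_diff[of r s] that s by (simp add: pos_divide_le_eq mult.assoc)
          qed
          then show "\<forall>\<^sub>F r in at_left s. norm ((W r - W s) /\<^sub>R (r - s)) \<le> M0 * R"
            using \<open>s > 0\<close> by (auto simp: eventually_at_left_field)
        qed simp
      qed
      have "Z \<le> M0 * R" unfolding Z_def by (rule z_le[OF s\<^sub>m])
      also have "\<dots> = M0 * M1 * norm z0 + M0 * e * C + M0 * e * norm feedback_vector * Z"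
        by (simp add: R_def g_def algebra_simps)
      also have "M0 * e * norm feedback_vector * Z \<le> 1 / 2 * Z"
        using e(3) by (rule mult_right_mono) (simp add: Z_def)
      finally have "Z \<le> 2 * M0 * M1 * norm z0 + 2 * M0 * e * C" by simp
      also have "2 * M0 * e * C \<le> \<epsilon> * C" using e(2) \<open>C \<ge> 0\<close> by (rule mult_right_mono)
      finally show "norm (z t) \<le> 2 * M0 * M1 * norm z0 + \<epsilon> * C"
        using max[of t] t by (simp add: Z_def)
    qed
  qed
qed

end

section \<open>Extinction in finite time\<close>

lemma le_if_right_decreasing:
  fixes g :: "real \<Rightarrow> real"
  assumes "a \<le> b" and g: "continuous_on {a..b} g"
    and step: "\<And>t. a \<le> t \<Longrightarrow> t < b \<Longrightarrow> \<exists>s. t < s \<and> s \<le> b \<and> g s \<le> g t"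
  shows "g b \<le> g a"
proof -
  let ?X = "{t \<in> {a..b}. g t \<le> g a}"
  have "closed ?X" by (intro continuous_on_closed_Collect_le g continuous_intros closed_atLeastAtMost)
  moreover have "bounded ?X" by (rule bounded_subset[OF bounded_closed_interval[of a b]]) auto
  ultimately have "compact ?X" by (simp add: compact_eq_bounded_closed)
  then obtain c where c: "c \<in> ?X" "\<And>t. t \<in> ?X \<Longrightarrow> t \<le> c"
    using compact_attains_sup[of ?X] \<open>a \<le> b\<close> by auto
  have "c = b"
  proof (rule ccontr)
    assume "c \<noteq> b"
    then obtain s where "c < s" "s \<le> b" "g s \<le> g c" using step[of c] c(1) by auto
    then have "s \<in> ?X" using c(1) by auto
    then show False using c(2) \<open>c < s\<close> by fastforce
  qed
  then show ?thesis using c(1) by simp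
qed

text \<open>Between its last zero before \<open>t\<close> (or time 0) and \<open>t\<close>, the function \<open>f s + k * s\<close> is decreasing. If
that starting point is a zero of \<open>f\<close>, then \<open>f t\<close> would be negative. The hypothesis is one-sided
because the functions of interest are not differentiable everywhere.\<close>

theorem finite_time_extinction:
  fixes f :: "real \<Rightarrow> real"
  assumes f: "continuous_on {0..} f" and nonneg: "\<And>t. t \<ge> 0 \<Longrightarrow> f t \<ge> 0"
    and step: "\<And>t. t \<ge> 0 \<Longrightarrow> f t > 0 \<Longrightarrow> \<exists>\<delta>>0. \<forall>s. t < s \<and> s < t + \<delta> \<longrightarrow> f s \<le> f t - k * (s - t)"
    and "k > 0" "t \<ge> 0"
  shows "f t \<le> max 0 (f 0 - k * t)"
proof -
  let ?X = "{s \<in> {0..t}. s = 0 \<or> f s = 0}"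
  have "?X = {0} \<union> {s \<in> {0..t}. f s = 0}" using \<open>t \<ge> 0\<close> by auto
  moreover have "closed {s \<in> {0..t}. f s = 0}"
    by (intro continuous_closed_preimage_constant continuous_on_subset[OF f]) auto
  ultimately have "closed ?X" by (simp add: closed_Un)
  moreover have "bounded ?X" by (rule bounded_subset[OF bounded_closed_interval[of 0 t]]) auto
  ultimately have "compact ?X" by (simp add: compact_eq_bounded_closed)
  then obtain c where c: "c \<in> ?X" "\<And>s. s \<in> ?X \<Longrightarrow> s \<le> c"
    using compact_attains_sup[of ?X] \<open>t \<ge> 0\<close> by auto
  have *: "f t + k * t \<le> f r + k * r" if "c < r" "r \<le> t" for r
  proof (rule le_if_right_decreasing[of r t "\<lambda>s. f s + k * s"])
    show "continuous_on {r..t} (\<lambda>s. f s + k * s)"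
      using c(1) that by (intro continuous_intros continuous_on_subset[OF f]) auto
    fix s assume s: "r \<le> s" "s < t"
    have "f s \<noteq> 0" using c(2)[of s] c(1) s that by auto
    then have "f s > 0" using nonneg[of s] c(1) s that by auto
    moreover have "s \<ge> 0" using c(1) s that by auto
    ultimately obtain \<delta> where \<delta>: "\<delta> > 0" "\<And>s'. s < s' \<and> s' < s + \<delta> \<Longrightarrow> f s' \<le> f s - k * (s' - s)"
      using step[of s] by blast
    define s' where "s' = min t (s + \<delta> / 2)"
    have "s < s'" "s' < s + \<delta>" "s' \<le> t" using s \<delta>(1) by (auto simp: s'_def)
    then show "\<exists>s'. s < s' \<and> s' \<le> t \<and> f s' + k * s' \<le> f s + k * s"
      using \<delta>(2)[of s'] by (auto intro!: exI[of _ s'] simp: algebra_simps)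
  qed (use that in simp)
  show ?thesis
  proof (cases "c = t")
    case True
    then show ?thesis using c(1) by auto
  next
    case False
    then have "c < t" using c(1) by auto
    have "f t + k * t \<le> f c + k * c"
    proof (rule tendsto_lowerbound)
      have "continuous_on {c..t} (\<lambda>s. f s + k * s)"
        using c(1) by (intro continuous_intros continuous_on_subset[OF f]) auto
      then have "((\<lambda>s. f s + k * s) \<longlongrightarrow> f c + k * c) (at c within {c..t})"
        unfolding continuous_on_def using \<open>c < t\<close> by auto
      then show "((\<lambda>s. f s + k * s) \<longlongrightarrow> f c + k * c) (at_right c)"
        using \<open>c < t\<close> by (simp add: at_within_Icc_at_right)
      show "\<forall>\<^sub>F s in at_right c. f t + k * t \<le> f s + k * s"
        unfolding eventually_at_right_field using \<open>c < t\<close> * by (intro exI[of _ t]) auto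
    qed simp
    moreover have "k * c < k * t" using \<open>c < t\<close> \<open>k > 0\<close> by simp
    ultimately show ?thesis using c(1) nonneg[OF \<open>t \<ge> 0\<close>] by auto
  qed
qed

context feedback_setting begin

lemma S_bounded: "\<exists>M\<ge>1. \<forall>t\<ge>0. \<forall>x. norm (S t x) \<le> M * norm x"
proof -
  obtain \<delta> where \<delta>: "\<delta> > 0" "\<And>x z t. (\<And>t. t \<ge> 0 \<Longrightarrow> z t = S t x) \<Longrightarrow> norm x < \<delta> \<Longrightarrow> t \<ge> 0 \<Longrightarrow> norm (z t) < 1"
    using feedback_stable unfolding globally_asymptotically_stable_def by (metis zero_less_one)
  have "norm (S t x) \<le> (2 / \<delta>) * norm x" if "t \<ge> 0" for t x
  proof (cases "x = 0")
    case False
    interpret St: bounded_linear "S t" by (rule cl.bounded_linear_T[OF that])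
    have "norm (S t ((\<delta> / (2 * norm x)) *\<^sub>R x)) < 1"
      by (rule \<delta>(2)[of "\<lambda>t. S t ((\<delta> / (2 * norm x)) *\<^sub>R x)"]) (use \<delta>(1) False that in auto)
    then show ?thesis using \<delta>(1) False by (simp add: St.scaleR field_simps)
  qed (use linear_0[OF bounded_linear.linear[OF cl.bounded_linear_T[OF that]]] in simp)
  moreover have "(2 / \<delta>) * norm x \<le> max 1 (2 / \<delta>) * norm x" for x :: 'h
    by (rule mult_right_mono) auto
  ultimately show ?thesis by (intro exI[of _ "max 1 (2 / \<delta>)"]) (auto intro: order_trans)
qed

lemma S_tendsto_0: "((\<lambda>t. S t x) \<longlongrightarrow> 0) at_top"
proof -
  have "(\<forall>t\<ge>0. z t = S t x) \<longrightarrow> (z \<longlongrightarrow> 0) at_top" for z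
    using feedback_stable unfolding globally_asymptotically_stable_def by blast
  from this[of "\<lambda>t. S t x"] show ?thesis by simp
qed

text \<open>The integrated equation tested with the eigenvector is a closed scalar equation for the output.\<close>

lemma output_increment:
  assumes sol: "integrated_solution z0 h z" and st: "0 \<le> s" "s \<le> t"
  shows "ip \<phi> (z t) - ip \<phi> (z s) = integral {s..t} (\<lambda>r. kcnj ev * ip \<phi> (z r) + B 1 \<phi> * h r)"
proof -
  have z: "continuous_on {0..} z" using sol unfolding integrated_solution_def by blast
  have int_z: "z integrable_on {0..t}"
    by (intro integrable_continuous_real continuous_on_subset[OF z]) auto
  have int_h: "h integrable_on {0..t}"
    using sol st lebesgue_integrable_imp_integrable_on(1)[of "{0..t}" h] unfolding integrated_solution_def by auto
  have sub: "z integrable_on {s..t}" "h integrable_on {s..t}"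
    using integrable_on_subinterval[OF int_z, of s t] integrable_on_subinterval[OF int_h, of s t] st by auto
  have eq: "ip \<phi> (z r) = ip \<phi> z0 + kcnj ev * ip \<phi> (integral {0..r} z) + B 1 \<phi> * integral {0..r} h" if "r \<ge> 0" for r
    using sol that eigenvector_D eigenvector unfolding integrated_solution_def by (simp add: ip_scale_left)
  have "ip \<phi> (z t) - ip \<phi> (z s) = kcnj ev * (ip \<phi> (integral {0..t} z) - ip \<phi> (integral {0..s} z))
      + B 1 \<phi> * (integral {0..t} h - integral {0..s} h)"
    using eq[of s] eq[of t] st by (simp add: algebra_simps)
  also have "\<dots> = kcnj ev * ip \<phi> (integral {s..t} z) + B 1 \<phi> * integral {s..t} h"
    unfolding ip_diff_right[symmetric] integral_diff_eq[OF int_z st] integral_diff_eq[OF int_h st] ..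
  also have "ip \<phi> (integral {s..t} z) = integral {s..t} (\<lambda>r. ip \<phi> (z r))"
    using integral_linear[OF sub(1) bounded_linear_ip, of \<phi>] by (simp add: o_def)
  also have "kcnj ev * integral {s..t} (\<lambda>r. ip \<phi> (z r)) + B 1 \<phi> * integral {s..t} h
      = integral {s..t} (\<lambda>r. kcnj ev * ip \<phi> (z r) + B 1 \<phi> * h r)"
    using integrable_linear[OF sub(1) bounded_linear_ip, of \<phi>] sub(2)
    by (subst Henstock_Kurzweil_Integration.integral_add) (auto simp: o_def intro: integrable_on_mult_right)
  finally show ?thesis .
qed

text \<open>While the output is zero, \<open>output_increment\<close> shows that \<open>h\<close> integrates to zero over every interval
that starts at \<open>t0\<close>. The state shifted by \<open>t0\<close> therefore solves the integrated equation without
input, and the variation of constants formula identifies it with the orbit of \<open>z t0\<close>.\<close>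

theorem free_evolution_if_output_zero:
  assumes sol: "integrated_solution z0 h z" and "t0 \<ge> 0"
    and zero: "\<And>t. t \<ge> t0 \<Longrightarrow> ip \<phi> (z t) = 0" and "t \<ge> t0"
  shows "z t = S (t - t0) (z t0)"
proof -
  obtain c1 c2 where "controlled_semigroup scaleK ip DAL AL S (B 1) c1 c2" using B_representations by blast
  then interpret c: controlled_semigroup scaleK ip DAL AL S "B 1" c1 c2 .
  have z: "continuous_on {0..} z" using sol unfolding integrated_solution_def by blast
  have int_z: "z integrable_on {0..r}" for r
    by (intro integrable_continuous_real continuous_on_subset[OF z]) auto
  have h_HK: "h integrable_on {0..r}" if "r \<ge> 0" for r
    using sol that lebesgue_integrable_imp_integrable_on(1)[of "{0..r}" h] unfolding integrated_solution_def by auto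
  define y where "y s = z (t0 + s)" for s
  have y: "continuous_on {0..} y"
    unfolding y_def by (rule continuous_on_compose2[OF z]) (use \<open>t0 \<ge> 0\<close> in \<open>auto intro: continuous_intros\<close>)
  have int_h: "integral {t0..t0 + s} h = 0" if "s \<ge> 0" for s
  proof -
    have "0 = integral {t0..t0 + s} (\<lambda>r. kcnj ev * ip \<phi> (z r) + B 1 \<phi> * h r)"
      using output_increment[OF sol \<open>t0 \<ge> 0\<close>, of "t0 + s"] zero that by simp
    also have "\<dots> = integral {t0..t0 + s} (\<lambda>r. B 1 \<phi> * h r)"
      by (intro integral_cong) (simp add: zero)
    finally show ?thesis using B_eigenvector_nonzero by simp
  qed
  have eq: "ip \<psi> (y s) = ip \<psi> (z t0) + ip (cl.F_adj \<psi>) (integral {0..s} y) + B 1 \<psi> * 0"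
    if "s \<ge> 0" "\<psi> \<in> cl.D_adj" for s \<psi>
  proof -
    have "integral {0..s} y = integral {0 + t0..s + t0} z"
      unfolding y_def by (rule integral_shift_banach)
    then have "integral {0..s} y = integral {0..t0 + s} z - integral {0..t0} z"
      using integral_diff_eq[OF int_z \<open>t0 \<ge> 0\<close>, of "t0 + s"] that by (simp add: add.commute)
    moreover have "integral {0..t0 + s} h = integral {0..t0} h"
      using integral_diff_eq[OF h_HK \<open>t0 \<ge> 0\<close>, of "t0 + s"] int_h[OF that(1)] that \<open>t0 \<ge> 0\<close> by simp
    moreover have "ip \<psi> (z (t0 + s)) = ip \<psi> z0 + ip (cl.F_adj \<psi>) (integral {0..t0 + s} z) + B 1 \<psi> * integral {0..t0 + s} h"
      "ip \<psi> (z t0) = ip \<psi> z0 + ip (cl.F_adj \<psi>) (integral {0..t0} z) + B 1 \<psi> * integral {0..t0} h"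
      using sol that \<open>t0 \<ge> 0\<close> D_adj_eq unfolding integrated_solution_def by auto
    ultimately show ?thesis by (simp add: y_def ip_diff_right)
  qed
  have W: "integral {0..s} y = cl.orbit_integral s (z t0)" if "s \<ge> 0" for s
  proof (rule cl.adj_dom_separates)
    fix \<psi> assume \<psi>: "\<psi> \<in> cl.D_adj"
    show "ip \<psi> (integral {0..s} y) = ip \<psi> (cl.orbit_integral s (z t0))"
      using c.variation_of_constants_integrated[of s y "\<lambda>_. 0" \<psi> "z t0"] eq that \<psi>
        continuous_on_subset[OF y, of "{0..s}"] by simp
  qed
  have "y s = S s (z t0)" if "s \<ge> 0" for s
  proof (rule cl.adj_dom_separates)
    fix \<psi> assume \<psi>: "\<psi> \<in> cl.D_adj"
    show "ip \<psi> (y s) = ip \<psi> (S s (z t0))"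
      using eq[OF that \<psi>] cl.ip_F_adj[OF \<psi> cl.orbit_integral_in_D(1)[OF that], of "z t0"]
        cl.orbit_integral_in_D(2)[OF that, of "z t0"] W[OF that] by (simp add: ip_diff_right diff_eq_eq add.commute)
  qed
  from this[of "t - t0"] show ?thesis using \<open>t \<ge> t0\<close> by (simp add: y_def)
qed

theorem convergence_if_output_vanishes:
  assumes "integrated_solution z0 h z" and "t0 \<ge> 0" and "\<And>t. t \<ge> t0 \<Longrightarrow> ip \<phi> (z t) = 0"
  shows "(z \<longlongrightarrow> 0) at_top"
proof -
  have "filterlim (\<lambda>t. t - t0) at_top at_top"
    using filterlim_tendsto_add_at_top[OF tendsto_const filterlim_ident, of "- t0"] by simp
  then have "((\<lambda>t. S (t - t0) (z t0)) \<longlongrightarrow> 0) at_top"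
    by (rule filterlim_compose[OF S_tendsto_0])
  then show ?thesis
    by (rule Lim_transform_eventually)
       (use eventually_ge_at_top[of t0] in \<open>eventually_elim; use assms free_evolution_if_output_zero in metis\<close>)
qed

text \<open>The estimate behind Lyapunov stability for both control laws. The factor \<open>\<epsilon>\<close> in front of the bound \<open>C\<close>
on the input is essential, since a sliding mode control does not become small with the state.\<close>

theorem bound_if_output_vanishes_early:
  "\<exists>M\<ge>1. \<forall>\<epsilon>>0. \<exists>a>0. \<forall>z0 h z C t0 t. integrated_solution z0 h z \<longrightarrow> C \<ge> 0 \<longrightarrow> 0 \<le> t0 \<longrightarrow> t0 \<le> a \<longrightarrow>
     (AE s in lebesgue_on {0..t0}. norm (h s) \<le> C) \<longrightarrow> (\<forall>t\<ge>t0. ip \<phi> (z t) = 0) \<longrightarrow> t \<ge> 0 \<longrightarrow>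
     norm (z t) \<le> M * norm z0 + \<epsilon> * C"
proof -
  obtain M1 where M1: "M1 \<ge> 1" and short: "\<And>\<epsilon>. \<epsilon> > 0 \<Longrightarrow> \<exists>a>0. \<forall>z0 h z C t. integrated_solution z0 h z \<longrightarrow> C \<ge> 0 \<longrightarrow> 0 \<le> t \<longrightarrow> t \<le> a \<longrightarrow>
     (AE s in lebesgue_on {0..t}. norm (h s) \<le> C) \<longrightarrow> norm (z t) \<le> M1 * norm z0 + \<epsilon> * C"
    using short_time_bound by blast
  obtain M2 where M2: "M2 \<ge> 1" "\<And>t x. t \<ge> 0 \<Longrightarrow> norm (S t x) \<le> M2 * norm x"
    using S_bounded by blast
  show ?thesis
  proof (rule exI[of _ "M2 * M1"], intro conjI allI impI)
    have "1 * 1 \<le> M2 * M1" using M1 M2(1) by (intro mult_mono) auto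
    then show "1 \<le> M2 * M1" by simp
    fix \<epsilon> :: real assume "\<epsilon> > 0"
    then have "\<epsilon> / M2 > 0" using M2(1) by simp
    from short[OF this] obtain a where a: "a > 0" "\<And>z0 h z C t. integrated_solution z0 h z \<Longrightarrow> C \<ge> 0 \<Longrightarrow> 0 \<le> t \<Longrightarrow> t \<le> a \<Longrightarrow>
     (AE s in lebesgue_on {0..t}. norm (h s) \<le> C) \<Longrightarrow> norm (z t) \<le> M1 * norm z0 + (\<epsilon> / M2) * C" by blast
    have "norm (z t) \<le> M2 * M1 * norm z0 + \<epsilon> * C"
      if sol: "integrated_solution z0 h z" and C: "C \<ge> 0" and t0: "0 \<le> t0" "t0 \<le> a"
        and h: "AE s in lebesgue_on {0..t0}. norm (h s) \<le> C" and zero: "\<forall>t\<ge>t0. ip \<phi> (z t) = 0" and t: "t \<ge> 0"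
      for z0 h z C t0 t
    proof -
      define r where "r = min t t0"
      have "AE s in lebesgue_on {0..r}. norm (h s) \<le> C"
        by (rule AE_lebesgue_on_subset[OF h]) (auto simp: r_def)
      then have "norm (z r) \<le> M1 * norm z0 + (\<epsilon> / M2) * C"
        using t t0 by (intro a(2)[OF sol C]) (auto simp: r_def)
      then have "M2 * norm (z r) \<le> M2 * (M1 * norm z0 + (\<epsilon> / M2) * C)"
        using M2(1) by (intro mult_left_mono) auto
      also have "\<dots> = M2 * M1 * norm z0 + \<epsilon> * C" using M2(1) by (simp add: field_simps)
      finally have *: "M2 * norm (z r) \<le> M2 * M1 * norm z0 + \<epsilon> * C" .
      show ?thesis
      proof (cases "t \<le> t0")
        case True
        have "1 * norm (z t) \<le> M2 * norm (z t)" using M2(1) by (rule mult_right_mono) simp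
        then show ?thesis using * True by (simp add: r_def)
      next
        case False
        then have "norm (z t) \<le> M2 * norm (z t0)"
          using free_evolution_if_output_zero[OF sol t0(1), of t] zero M2(2)[of "t - t0" "z t0"] by simp
        then show ?thesis using * False by (simp add: r_def)
      qed
    qed
    with a(1) show "\<exists>a>0. \<forall>z0 h z C t0 t. integrated_solution z0 h z \<longrightarrow> C \<ge> 0 \<longrightarrow> 0 \<le> t0 \<longrightarrow> t0 \<le> a \<longrightarrow>
     (AE s in lebesgue_on {0..t0}. norm (h s) \<le> C) \<longrightarrow> (\<forall>t\<ge>t0. ip \<phi> (z t) = 0) \<longrightarrow> t \<ge> 0 \<longrightarrow>
     norm (z t) \<le> M2 * M1 * norm z0 + \<epsilon> * C" by blast
  qed
qed

end

section \<open>Sliding mode control\<close>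

text \<open>Expand \<open>(norm (\<sigma> s))\<^sup>2\<close> around \<open>\<sigma> t\<close>: the linear term decreases at rate \<open>3/2 * c * norm (\<sigma> t)\<close>, and
for small \<open>s - t\<close> the quadratic term uses up only a part of this.\<close>

lemma norm_decrease_step:
  fixes \<sigma> p :: "real \<Rightarrow> 'k::real_or_complex"
  assumes inc: "\<And>s. t \<le> s \<Longrightarrow> s < t + \<delta> \<Longrightarrow> \<sigma> s - \<sigma> t = integral {t..s} p"
    and int: "\<And>s. t \<le> s \<Longrightarrow> s < t + \<delta> \<Longrightarrow> integrable (lebesgue_on {t..s}) p"
    and AE_re: "\<And>s. t \<le> s \<Longrightarrow> s < t + \<delta> \<Longrightarrow> AE r in lebesgue_on {t..s}. kre (kcnj (\<sigma> t) * p r) \<le> - (3 / 4 * c) * norm (\<sigma> t)"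
    and AE_norm: "\<And>s. t \<le> s \<Longrightarrow> s < t + \<delta> \<Longrightarrow> AE r in lebesgue_on {t..s}. norm (p r) \<le> P"
    and pos: "\<delta> > 0" "c > 0" "\<sigma> t \<noteq> 0"
  shows "\<exists>\<delta>>0. \<forall>s. t < s \<and> s < t + \<delta> \<longrightarrow> norm (\<sigma> s) \<le> norm (\<sigma> t) - c / 2 * (s - t)"
proof -
  define N where "N = norm (\<sigma> t)"
  have "N > 0" using pos by (simp add: N_def)
  have den: "2 * P\<^sup>2 + 1 > 0" by (simp add: add_nonneg_pos)
  \<comment> \<open>The second bound keeps \<open>N - c / 2 * h\<close> nonnegative, the third one makes the quadratic term
    small.\<close>
  define \<delta>' where "\<delta>' = min \<delta> (min (2 * N / c) (c * N / (2 * P\<^sup>2 + 1)))"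
  have "\<delta>' > 0" using pos \<open>N > 0\<close> den by (simp add: \<delta>'_def)
  have "norm (\<sigma> s) \<le> N - c / 2 * (s - t)" if s: "t < s" "s < t + \<delta>'" for s
  proof -
    define h where "h = s - t"
    have h: "h > 0" "h \<le> 2 * N / c" "h \<le> c * N / (2 * P\<^sup>2 + 1)" "s < t + \<delta>"
      using s by (auto simp: h_def \<delta>'_def)
    have st: "t \<le> s" using s by simp
    note intp = int[OF st h(4)]
    have "kre (kcnj (\<sigma> t) * integral {t..s} p) = integral {t..s} (\<lambda>r. kre (kcnj (\<sigma> t) * p r))"
      using integral_linear[OF lebesgue_integrable_imp_integrable_on(1)[OF intp]
          bounded_linear_compose[OF bounded_linear_kre bounded_linear_mult_right[of "kcnj (\<sigma> t)"]]]
      by (simp add: o_def)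
    also have "\<dots> \<le> - (3 / 4 * c) * N * (s - t)"
      using integrable_bounded_linear[OF bounded_linear_compose[OF bounded_linear_kre bounded_linear_mult_right[of "kcnj (\<sigma> t)"]] intp]
        AE_re[OF st h(4)] st unfolding N_def by (intro integral_le_AE) auto
    finally have re: "kre (kcnj (\<sigma> t) * (\<sigma> s - \<sigma> t)) \<le> - (3 / 4 * c) * N * h"
      unfolding inc[OF st h(4)] h_def .
    have "norm (\<sigma> s - \<sigma> t) \<le> P * h"
      unfolding inc[OF st h(4)] h_def by (rule norm_integral_le_AE[OF intp AE_norm[OF st h(4)] st])
    then have "(norm (\<sigma> s - \<sigma> t))\<^sup>2 \<le> (P * h)\<^sup>2" by (rule power_mono) simp
    also have "\<dots> \<le> (c * N / 2) * h"
    proof -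
      have "h * (2 * P\<^sup>2 + 1) \<le> c * N" using h(3) den by (simp add: pos_le_divide_eq)
      then have "2 * (P\<^sup>2 * h) \<le> c * N" using h(1) by (simp add: algebra_simps)
      then have "(P\<^sup>2 * h) * h \<le> (c * N / 2) * h" using h(1) by (intro mult_right_mono) auto
      then show ?thesis by (simp add: power_mult_distrib power2_eq_square mult_ac)
    qed
    finally have "(norm (\<sigma> t + (\<sigma> s - \<sigma> t)))\<^sup>2 \<le> N\<^sup>2 + 2 * (- (3 / 4 * c) * N * h) + (c * N / 2) * h"
      unfolding norm_add_square_scalar N_def[symmetric] using re by (simp add: algebra_simps)
    also have "\<dots> \<le> (N - c / 2 * h)\<^sup>2" by (simp add: power2_diff)
    finally have sq: "(norm (\<sigma> s))\<^sup>2 \<le> (N - c / 2 * h)\<^sup>2" by simp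
    have "0 \<le> N - c / 2 * h" using h(2) pos by (simp add: field_simps)
    with sq show ?thesis unfolding h_def by (rule power2_le_imp_le)
  qed
  with \<open>\<delta>' > 0\<close> show ?thesis unfolding N_def by blast
qed

lemma norm_ksign_le: "\<xi> \<in> ksign s \<Longrightarrow> norm \<xi> \<le> 1"
  by (auto simp: ksign_def norm_divide split: if_splits)

context feedback_setting begin

definition sliding_input :: "real \<Rightarrow> (real \<Rightarrow> 'k) \<Rightarrow> (real \<Rightarrow> 'h) \<Rightarrow> (real \<Rightarrow> 'k) \<Rightarrow> bool" where
  "sliding_input K d z h \<longleftrightarrow> (AE t in lebesgue_on {0..}. \<exists>\<xi>\<in>ksign (ip \<phi> (z t)).
     h t = - (1 / B 1 \<phi>) * (ev * ip \<phi> (z t) + of_real K * \<xi>) + d t)"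

context
  fixes K K\<^sub>d :: real and d :: "real \<Rightarrow> 'k"
  assumes d_bound: "\<And>t. t \<ge> 0 \<Longrightarrow> norm (d t) \<le> K\<^sub>d" and "K > 0" and gain: "K > norm (B 1 \<phi>) * K\<^sub>d"
begin

abbreviation decay where "decay \<equiv> K - norm (B 1 \<phi>) * K\<^sub>d"

text \<open>Near a time where the output is nonzero, the derivative \<open>p\<close> of the output consists of
\<open>(kcnj ev - ev) * \<sigma>\<close>, which is orthogonal to \<open>\<sigma> t\<close> in the limit, of the switching term \<open>- K\<close> times the
unit vector in the direction of \<open>\<sigma>\<close>, and of the disturbance, which is weaker by assumption.\<close>

lemma sliding_output_decreases:
  assumes sol: "integrated_solution z0 h z" and input: "sliding_input K d z h" and t: "t \<ge> 0" "ip \<phi> (z t) \<noteq> 0"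
  shows "\<exists>\<delta>>0. \<forall>s. t < s \<and> s < t + \<delta> \<longrightarrow> norm (ip \<phi> (z s)) \<le> norm (ip \<phi> (z t)) - decay / 2 * (s - t)"
proof -
  define \<sigma> where "\<sigma> s = ip \<phi> (z s)" for s
  define b where "b = B 1 \<phi>"
  have "b \<noteq> 0" unfolding b_def by (rule B_eigenvector_nonzero)
  define p where "p s = kcnj ev * \<sigma> s + b * h s" for s
  define N where "N = norm (\<sigma> t)"
  have N: "N > 0" using t by (simp add: N_def \<sigma>_def)
  have \<sigma>: "continuous_on {0..} \<sigma>"
    unfolding \<sigma>_def using sol unfolding integrated_solution_def by (intro continuous_intros) blast
  let ?q = "\<lambda>r. kre (kcnj (\<sigma> t) * ((kcnj ev - ev) * \<sigma> r)) - K * kre (kcnj (\<sigma> t) * (\<sigma> r / of_real (norm (\<sigma> r))))"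
  have \<sigma>_lim: "(\<sigma> \<longlongrightarrow> \<sigma> t) (at t within {0..})" using \<sigma> t(1) unfolding continuous_on_def by auto
  have "(?q \<longlongrightarrow> ?q t) (at t within {0..})"
    by (intro tendsto_intros bounded_linear.tendsto[OF bounded_linear_kre] \<sigma>_lim) (use N N_def in auto)
  moreover have "?q t = - K * N"
  proof -
    have "kcnj (\<sigma> t) * ((kcnj ev - ev) * \<sigma> t) = (kcnj (\<sigma> t) * \<sigma> t) * (kcnj ev - ev)"
      by (simp only: mult_ac)
    then have "kre (kcnj (\<sigma> t) * ((kcnj ev - ev) * \<sigma> t)) = 0"
      unfolding kcnj_mult_self kre_of_real_mult[symmetric] by (simp only: kre_of_real_mult kre_diff kre_kcnj) simp
    moreover have "kcnj (\<sigma> t) * (\<sigma> t / of_real (norm (\<sigma> t))) = of_real N"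
      using kcnj_mult_self[of "\<sigma> t"] N unfolding N_def by (simp add: power2_eq_square)
    then have "kre (kcnj (\<sigma> t) * (\<sigma> t / of_real (norm (\<sigma> t)))) = N" by simp
    ultimately show ?thesis by simp
  qed
  ultimately have q_lim: "(?q \<longlongrightarrow> - K * N) (at t within {0..})" by simp
  have "decay > 0" using gain by simp
  have "- K * N < - K * N + decay / 4 * N" using N \<open>decay > 0\<close> by simp
  then have "\<forall>\<^sub>F r in at t within {0..}. ?q r < - K * N + decay / 4 * N"
    by (rule order_tendstoD(2)[OF q_lim])
  moreover have "\<forall>\<^sub>F r in at t within {0..}. norm (\<sigma> r) < 2 * N"
    using tendsto_norm[OF \<sigma>_lim] by (rule order_tendstoD) (use N N_def in auto)
  moreover have "\<forall>\<^sub>F r in at t within {0..}. norm (\<sigma> r) > 0"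
    using tendsto_norm[OF \<sigma>_lim] by (rule order_tendstoD) (use N N_def in auto)
  ultimately have "\<forall>\<^sub>F r in at t within {0..}. ?q r < - K * N + decay / 4 * N \<and> norm (\<sigma> r) < 2 * N \<and> \<sigma> r \<noteq> 0"
    by eventually_elim auto
  then obtain \<delta> where \<delta>: "\<delta> > 0" "\<And>r. r \<in> {0..} \<Longrightarrow> r \<noteq> t \<Longrightarrow> dist r t < \<delta> \<Longrightarrow>
      ?q r < - K * N + decay / 4 * N \<and> norm (\<sigma> r) < 2 * N \<and> \<sigma> r \<noteq> 0"
    unfolding eventually_at by blast
  have near: "?q r < - K * N + decay / 4 * N \<and> norm (\<sigma> r) < 2 * N \<and> \<sigma> r \<noteq> 0" if "t \<le> r" "r < t + \<delta>" for r
    using \<delta>(2)[of r] that t(1) N \<open>?q t = - K * N\<close> \<open>decay > 0\<close> by (cases "r = t") (auto simp: dist_real_def N_def)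
  define P where "P = norm (kcnj ev - ev) * (2 * N) + K + norm b * K\<^sub>d"
  have AE_input: "AE r in lebesgue_on {t..s}. r \<in> {t..s} \<and> (\<exists>\<xi>\<in>ksign (\<sigma> r). h r = - (1 / b) * (ev * \<sigma> r + of_real K * \<xi>) + d r)" for s
    using AE_lebesgue_on_subset[OF input[unfolded sliding_input_def], of "{t..s}"] t(1)
      AE_space[of "lebesgue_on {t..s}"] unfolding \<sigma>_def b_def by (auto elim: eventually_elim2)
  have p_eq: "p r = (kcnj ev - ev) * \<sigma> r - of_real K * (\<sigma> r / of_real (norm (\<sigma> r))) + b * d r"
    if "\<sigma> r \<noteq> 0" "\<exists>\<xi>\<in>ksign (\<sigma> r). h r = - (1 / b) * (ev * \<sigma> r + of_real K * \<xi>) + d r" for r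
  proof -
    have cancel: "b * (- (1 / b) * x + y) = - x + b * y" for x y
      using \<open>b \<noteq> 0\<close> by (simp add: right_diff_distrib)
    have "h r = - (1 / b) * (ev * \<sigma> r + of_real K * (\<sigma> r / of_real (norm (\<sigma> r)))) + d r"
      using that by (simp add: ksign_def)
    then show ?thesis unfolding p_def by (simp only: cancel) (simp add: left_diff_distrib)
  qed
  have "\<exists>\<delta>>0. \<forall>s. t < s \<and> s < t + \<delta> \<longrightarrow> norm (\<sigma> s) \<le> norm (\<sigma> t) - decay / 2 * (s - t)"
  proof (rule norm_decrease_step[where p = p and \<delta> = \<delta> and P = P])
    fix s assume s: "t \<le> s" "s < t + \<delta>"
    show "\<sigma> s - \<sigma> t = integral {t..s} p"
      unfolding \<sigma>_def p_def b_def by (rule output_increment[OF sol t(1) s(1)])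
    have "integrable (lebesgue_on {0..s}) h" using sol s t unfolding integrated_solution_def by auto
    then have "integrable (lebesgue_on {t..s}) h"
      by (rule integrable_lebesgue_on_subset) (use t in auto)
    moreover have "integrable (lebesgue_on {t..s}) (\<lambda>r. 1 * \<sigma> r)"
    proof (rule integrable_mult_continuous)
      interpret finite_measure "lebesgue_on {t..s}" by (intro finite_measure_lebesgue_on) auto
      show "integrable (lebesgue_on {t..s}) (\<lambda>r. 1 :: 'k)" by simp
    qed (use t in \<open>auto intro: continuous_on_subset[OF \<sigma>]\<close>)
    ultimately show "integrable (lebesgue_on {t..s}) p" unfolding p_def by simp
    show "AE r in lebesgue_on {t..s}. kre (kcnj (\<sigma> t) * p r) \<le> - (3 / 4 * decay) * norm (\<sigma> t)"
      using AE_input[of s]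
    proof eventually_elim
      case (elim r)
      then have r: "t \<le> r" "r < t + \<delta>" "r \<ge> 0" using s t by auto
      have "kre (kcnj (\<sigma> t) * p r) = ?q r + kre (kcnj (\<sigma> t) * (b * d r))"
        unfolding p_eq[OF near[OF r(1,2), THEN conjunct2, THEN conjunct2] elim[THEN conjunct2]]
        by (simp only: distrib_left right_diff_distrib kre_add kre_diff mult.left_commute[of _ "of_real K"]
            kre_of_real_mult)
      moreover have "kre (kcnj (\<sigma> t) * (b * d r)) \<le> N * (norm b * K\<^sub>d)"
        using d_bound[OF r(3)] kre_le_norm[of "kcnj (\<sigma> t) * (b * d r)"]
        by (simp add: norm_mult N_def) (meson mult_left_mono norm_ge_zero order_trans)
      ultimately have "kre (kcnj (\<sigma> t) * p r) \<le> - K * N + decay / 4 * N + N * (norm b * K\<^sub>d)"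
        using near[OF r(1,2)] by linarith
      also have "\<dots> = - (3 / 4 * decay) * N" by (simp add: b_def field_simps)
      finally show ?case by (simp only: N_def)
    qed
    show "AE r in lebesgue_on {t..s}. norm (p r) \<le> P"
      using AE_input[of s]
    proof eventually_elim
      case (elim r)
      then have r: "t \<le> r" "r < t + \<delta>" "r \<ge> 0" using s t by auto
      have "norm (p r) \<le> norm ((kcnj ev - ev) * \<sigma> r - of_real K * (\<sigma> r / of_real (norm (\<sigma> r)))) + norm (b * d r)"
        using p_eq[of r] near[OF r(1,2)] elim norm_triangle_ineq by metis
      moreover have "norm ((kcnj ev - ev) * \<sigma> r - of_real K * (\<sigma> r / of_real (norm (\<sigma> r))))
          \<le> norm ((kcnj ev - ev) * \<sigma> r) + norm (of_real K * (\<sigma> r / of_real (norm (\<sigma> r))))"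
        by (rule norm_triangle_ineq4)
      moreover have "norm ((kcnj ev - ev) * \<sigma> r) \<le> norm (kcnj ev - ev) * (2 * N)"
        using near[OF r(1,2)] unfolding norm_mult by (intro mult_left_mono) auto
      moreover have "norm (of_real K * (\<sigma> r / of_real (norm (\<sigma> r)))) = K"
        using near[OF r(1,2)] \<open>K > 0\<close> by (simp add: norm_mult norm_divide)
      moreover have "norm (b * d r) \<le> norm b * K\<^sub>d"
        using d_bound[OF r(3)] unfolding norm_mult by (intro mult_left_mono) auto
      ultimately show ?case unfolding P_def by linarith
    qed
  qed (use \<delta> \<open>decay > 0\<close> N N_def in auto)
  then show ?thesis unfolding \<sigma>_def .
qed

theorem sliding_output_bound:
  assumes "integrated_solution z0 h z" "sliding_input K d z h" "t \<ge> 0"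
  shows "norm (ip \<phi> (z t)) \<le> max 0 (norm (ip \<phi> z0) - decay / 2 * t)"
  unfolding integrated_solution_initial[OF assms(1), symmetric]
proof (rule finite_time_extinction[OF _ _ _ _ assms(3)])
  show "continuous_on {0..} (\<lambda>t. norm (ip \<phi> (z t)))"
    using assms(1) unfolding integrated_solution_def by (intro continuous_intros) blast
qed (use sliding_output_decreases[OF assms(1,2)] gain in auto)

theorem sliding_mode_stable:
  "globally_asymptotically_stable (\<lambda>z0 z. \<exists>h. integrated_solution z0 h z \<and> sliding_input K d z h)"
proof -
  have "decay > 0" using gain by simp
  define t0 where "t0 z0 = 2 * norm (ip \<phi> z0) / decay" for z0
  have t0: "t0 z0 \<ge> 0" for z0 using \<open>decay > 0\<close> by (simp add: t0_def)
  have zero: "ip \<phi> (z t) = 0" if "integrated_solution z0 h z" "sliding_input K d z h" "t \<ge> t0 z0" for z0 h z t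
  proof -
    have "norm (ip \<phi> z0) - decay / 2 * t \<le> 0" using that(3) \<open>decay > 0\<close> by (simp add: t0_def field_simps)
    then show ?thesis using sliding_output_bound[OF that(1,2), of t] that(3) t0[of z0] by simp
  qed
  obtain M where M: "M \<ge> 1" and early: "\<And>\<epsilon>. \<epsilon> > 0 \<Longrightarrow> \<exists>a>0. \<forall>z0 h z C t0 t. integrated_solution z0 h z \<longrightarrow> C \<ge> 0 \<longrightarrow> 0 \<le> t0 \<longrightarrow> t0 \<le> a \<longrightarrow>
     (AE s in lebesgue_on {0..t0}. norm (h s) \<le> C) \<longrightarrow> (\<forall>t\<ge>t0. ip \<phi> (z t) = 0) \<longrightarrow> t \<ge> 0 \<longrightarrow>
     norm (z t) \<le> M * norm z0 + \<epsilon> * C"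
    using bound_if_output_vanishes_early by blast
  define C where "C = (norm ev * norm \<phi> + K) / norm (B 1 \<phi>) + K\<^sub>d"
  have "K\<^sub>d \<ge> 0" using order_trans[OF norm_ge_zero d_bound[of 0]] by simp
  then have "C \<ge> 0" using \<open>K > 0\<close> unfolding C_def
    by (intro add_nonneg_nonneg divide_nonneg_nonneg mult_nonneg_nonneg) auto
  have input_bound: "AE s in lebesgue_on {0..r}. norm (h s) \<le> C"
    if sol: "integrated_solution z0 h z" "sliding_input K d z h" and "norm z0 \<le> 1" for z0 h z r
  proof -
    have out: "norm (ip \<phi> (z s)) \<le> norm \<phi>" if "s \<ge> 0" for s
    proof -
      have "norm (ip \<phi> (z s)) \<le> norm (ip \<phi> z0)"
        using sliding_output_bound[OF sol that] \<open>decay > 0\<close> that by (simp add: max_def split: if_splits) (smt (verit) mult_nonneg_nonneg divide_nonneg_nonneg norm_ge_zero)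
      also have "\<dots> \<le> norm \<phi> * norm z0" by (rule Cauchy_Schwarz)
      also have "\<dots> \<le> norm \<phi>" using \<open>norm z0 \<le> 1\<close> mult_left_mono[of "norm z0" 1 "norm \<phi>"] by simp
      finally show ?thesis .
    qed
    have "AE s in lebesgue_on {0..r}. \<exists>\<xi>\<in>ksign (ip \<phi> (z s)). h s = - (1 / B 1 \<phi>) * (ev * ip \<phi> (z s) + of_real K * \<xi>) + d s"
      by (rule AE_lebesgue_on_subset[OF sol(2)[unfolded sliding_input_def]]) auto
    moreover have "AE s in lebesgue_on {0..r}. s \<in> {0..r}"
      using AE_space[of "lebesgue_on {0..r}"] by simp
    ultimately show ?thesis
    proof eventually_elim
      case (elim s)
      then obtain \<xi> where \<xi>: "\<xi> \<in> ksign (ip \<phi> (z s))"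
        and h: "h s = - (1 / B 1 \<phi>) * (ev * ip \<phi> (z s) + of_real K * \<xi>) + d s" by blast
      have "norm (ev * ip \<phi> (z s) + of_real K * \<xi>) \<le> norm ev * norm \<phi> + K * 1"
      proof (rule norm_triangle_mono)
        show "norm (ev * ip \<phi> (z s)) \<le> norm ev * norm \<phi>"
          using out[of s] elim unfolding norm_mult by (intro mult_left_mono) auto
        show "norm (of_real K * \<xi>) \<le> K * 1"
          using norm_ksign_le[OF \<xi>] \<open>K > 0\<close> unfolding norm_mult by (intro mult_mono) auto
      qed
      then have "norm (- (1 / B 1 \<phi>) * (ev * ip \<phi> (z s) + of_real K * \<xi>)) \<le> (norm ev * norm \<phi> + K) / norm (B 1 \<phi>)"
        unfolding norm_mult norm_minus_cancel norm_divide norm_one by (simp add: divide_right_mono)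
      then show ?case
        unfolding h C_def using d_bound[of s] elim by (intro norm_triangle_mono) auto
    qed
  qed
  show ?thesis
    unfolding globally_asymptotically_stable_def
  proof (intro conjI allI impI)
    fix \<epsilon> :: real assume "\<epsilon> > 0"
    define \<epsilon>' where "\<epsilon>' = \<epsilon> / (2 * (C + 1))"
    have "\<epsilon>' > 0" "\<epsilon>' * C < \<epsilon> / 2"
      using \<open>\<epsilon> > 0\<close> \<open>C \<ge> 0\<close> by (auto simp: \<epsilon>'_def field_simps)
    then obtain a where a: "a > 0" "\<And>z0 h z C t0 t. integrated_solution z0 h z \<Longrightarrow> C \<ge> 0 \<Longrightarrow> 0 \<le> t0 \<Longrightarrow> t0 \<le> a \<Longrightarrow>
     (AE s in lebesgue_on {0..t0}. norm (h s) \<le> C) \<Longrightarrow> (\<forall>t\<ge>t0. ip \<phi> (z t) = 0) \<Longrightarrow> t \<ge> 0 \<Longrightarrow>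
     norm (z t) \<le> M * norm z0 + \<epsilon>' * C" using early by blast
    define \<delta> where "\<delta> = min 1 (min (\<epsilon> / (2 * M)) (a * decay / (2 * norm \<phi> + 1)))"
    have den: "2 * norm \<phi> + 1 > 0" by (simp add: add_nonneg_pos)
    have "\<delta> > 0" using \<open>\<epsilon> > 0\<close> M a \<open>decay > 0\<close> den by (simp add: \<delta>_def)
    moreover have "norm (z t) < \<epsilon>"
      if sol: "integrated_solution z0 h z" "sliding_input K d z h" and small: "norm z0 < \<delta>" and "t \<ge> 0" for z0 h z t
    proof -
      have "2 * norm (ip \<phi> z0) \<le> 2 * norm \<phi> * norm z0" using Cauchy_Schwarz[of \<phi> z0] by simp
      also have "\<dots> \<le> (2 * norm \<phi> + 1) * norm z0" by (rule mult_right_mono) auto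
      also have "\<dots> \<le> a * decay" using small den by (simp add: \<delta>_def pos_less_divide_eq mult.commute less_imp_le)
      finally have "t0 z0 \<le> a" using \<open>decay > 0\<close> by (simp add: t0_def pos_divide_le_eq)
      then have "norm (z t) \<le> M * norm z0 + \<epsilon>' * C"
        using zero[OF sol] input_bound[OF sol, of "t0 z0"] small \<open>t \<ge> 0\<close>
        by (intro a(2)[OF sol(1) \<open>C \<ge> 0\<close> t0]) (auto simp: \<delta>_def)
      moreover have "M * norm z0 < \<epsilon> / 2"
        using small M by (simp add: \<delta>_def pos_less_divide_eq mult_ac)
      ultimately show ?thesis using \<open>\<epsilon>' * C < \<epsilon> / 2\<close> by linarith
    qed
    ultimately show "\<exists>\<delta>>0. \<forall>z0 z. (\<exists>h. integrated_solution z0 h z \<and> sliding_input K d z h) \<and> norm z0 < \<delta> \<longrightarrow>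
        (\<forall>t\<ge>0. norm (z t) < \<epsilon>)" by blast
  next
    fix z0 z assume "\<exists>h. integrated_solution z0 h z \<and> sliding_input K d z h"
    then show "(z \<longlongrightarrow> 0) at_top"
      using convergence_if_output_vanishes[OF _ t0] zero by blast
  qed
qed

end

end

lemma globally_asymptotically_stable_mono:
  assumes P: "globally_asymptotically_stable P" and imp: "\<And>x0 x. Q x0 x \<Longrightarrow> P x0 x"
  shows "globally_asymptotically_stable Q"
  unfolding globally_asymptotically_stable_def
proof (intro conjI allI impI)
  fix \<epsilon> :: real assume "\<epsilon> > 0"
  then obtain \<delta> where "\<delta> > 0" "\<forall>x0 x. P x0 x \<and> norm x0 < \<delta> \<longrightarrow> (\<forall>t\<ge>0. norm (x t) < \<epsilon>)"
    using P unfolding globally_asymptotically_stable_def by blast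
  then show "\<exists>\<delta>>0. \<forall>x0 x. Q x0 x \<and> norm x0 < \<delta> \<longrightarrow> (\<forall>t\<ge>0. norm (x t) < \<epsilon>)"
    using imp by blast
next
  fix x0 x assume "Q x0 x"
  then show "(x \<longlongrightarrow> 0) at_top"
    using P imp unfolding globally_asymptotically_stable_def by blast
qed

theorem sliding_mode_control_stable:
  fixes scaleK :: "'k::real_or_complex \<Rightarrow> 'h::banach \<Rightarrow> 'h"
  assumes setting: "feedback_setting scaleK ip DA A T B \<tau> DL L S \<phi> ev"
    and d: "\<And>t. t \<ge> 0 \<Longrightarrow> norm (d t) \<le> K\<^sub>d" and K: "K > 0" "K / norm (adjB B \<phi>) > K\<^sub>d"
  shows "globally_asymptotically_stable (sliding_mode_solution scaleK ip DA A B DL L S \<phi> ev K d)"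
proof -
  interpret feedback_setting scaleK ip DA A T B \<tau> DL L S \<phi> ev by (rule setting)
  have "norm (B 1 \<phi>) > 0" using B_eigenvector_nonzero by simp
  then have gain: "K > norm (B 1 \<phi>) * K\<^sub>d" using K(2) by (simp add: adjB_def pos_less_divide_eq mult.commute)
  show ?thesis
  proof (rule globally_asymptotically_stable_mono[OF sliding_mode_stable[OF d K(1) gain]])
    fix z0 z assume sol: "sliding_mode_solution scaleK ip DA A B DL L S \<phi> ev K d z0 z"
    then obtain h where h: "\<And>t. t \<ge> 0 \<Longrightarrow> square_integrable_on h {0..t}"
        "mild_trajectory scaleK ip DA A B DL L S z0 h z"
      and input: "AE t in lebesgue_on {0..}. \<exists>\<xi>\<in>ksign (ip \<phi> (z t)).
             h t = - (1 / adjB B \<phi>) * (ev * ip \<phi> (z t) + of_real K * \<xi>) + d t"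
      unfolding sliding_mode_solution_def by blast
    have "sliding_input K d z h" unfolding sliding_input_def using input unfolding adjB_def .
    then show "\<exists>h. integrated_solution z0 h z \<and> sliding_input K d z h"
      using integrated_solution_if_mild[OF h(2,1)] by blast
  qed
qed

section \<open>Absolutely continuous functions\<close>

lemma sum_disjoint_intervals_le_emeasure:
  fixes a b :: "'i \<Rightarrow> real"
  assumes "finite I" and ab: "\<And>i. i \<in> I \<Longrightarrow> a i \<le> b i"
    and disj: "\<And>i j. i \<in> I \<Longrightarrow> j \<in> I \<Longrightarrow> i \<noteq> j \<Longrightarrow> {a i<..<b i} \<inter> {a j<..<b j} = {}"
    and sub: "\<And>i. i \<in> I \<Longrightarrow> {a i<..<b i} \<subseteq> U" and U: "U \<in> sets lebesgue"
  shows "ennreal (\<Sum>i\<in>I. b i - a i) \<le> emeasure lebesgue U"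
proof -
  have "ennreal (\<Sum>i\<in>I. b i - a i) = (\<Sum>i\<in>I. ennreal (b i - a i))"
    using ab by (intro sum_ennreal[symmetric]) auto
  also have "\<dots> = (\<Sum>i\<in>I. emeasure lebesgue {a i<..<b i})"
    using ab by (intro sum.cong) auto
  also have "\<dots> = emeasure lebesgue (\<Union>i\<in>I. {a i<..<b i})"
    using disj \<open>finite I\<close> by (intro sum_emeasure) (auto simp: disjoint_family_on_def)
  also have "\<dots> \<le> emeasure lebesgue U" using sub U by (intro emeasure_mono) auto
  finally show ?thesis .
qed

text \<open>Take a gauge that is fine enough for the derivative outside \<open>N\<close> and that keeps the intervals tagged
in \<open>N\<close> inside an open set of small measure. In a tagged division that is fine for it, the increments
over the first kind of intervals are controlled by \<open>c\<close>, and those over the second kind are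
negligible by absolute continuity.\<close>

theorem absolutely_continuous_increment_le:
  fixes w :: "real \<Rightarrow> real"
  assumes ac: "absolutely_continuous_on I w" and "a \<le> b" "{a..b} \<subseteq> I"
    and N: "negligible N" and deriv: "\<And>t. t \<in> {a..b} - N \<Longrightarrow> \<exists>D\<le>c. (w has_real_derivative D) (at t)"
  shows "w b - w a \<le> c * (b - a)"
proof (rule field_le_epsilon)
  fix e :: real assume "e > 0"
  define \<epsilon> where "\<epsilon> = min 1 (e / (b - a + 2))"
  have "\<epsilon> > 0" using \<open>e > 0\<close> \<open>a \<le> b\<close> by (simp add: \<epsilon>_def add_nonneg_pos)
  have \<epsilon>_e: "\<epsilon> * (b - a + 2) \<le> e"
  proof -
    have "\<epsilon> \<le> e / (b - a + 2)" by (simp add: \<epsilon>_def)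
    then show ?thesis using \<open>a \<le> b\<close> by (simp add: pos_le_divide_eq)
  qed
  obtain \<eta> where \<eta>: "\<eta> > 0"
    and ac_\<eta>: "\<forall>(n::nat) u v. (\<forall>i<n. u i \<in> I \<and> v i \<in> I \<and> u i \<le> v i) \<and>
        (\<forall>i<n. \<forall>j<n. i \<noteq> j \<longrightarrow> {u i<..<v i} \<inter> {u j<..<v j} = {}) \<and>
        (\<Sum>i<n. v i - u i) < \<eta> \<longrightarrow> (\<Sum>i<n. \<bar>w (v i) - w (u i)\<bar>) < \<epsilon>"
    using ac[unfolded absolutely_continuous_on_def, THEN spec, THEN mp, OF \<open>\<epsilon> > 0\<close>]
    by (elim exE conjE)
  define \<eta>' where "\<eta>' = min \<eta> (\<epsilon> / (\<bar>c\<bar> + 1))"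
  have "\<eta>' > 0" using \<eta> \<open>\<epsilon> > 0\<close> by (simp add: \<eta>'_def add_nonneg_pos)
  obtain U where U: "open U" "N \<subseteq> U" "(U - N) \<in> lmeasurable" "emeasure lebesgue (U - N) < ennreal \<eta>'"
    using sets_lebesgue_outer_open[OF negligible_imp_sets[OF N] \<open>\<eta>' > 0\<close>] .
  have U_small: "emeasure lebesgue U < ennreal \<eta>'"
  proof -
    have "emeasure lebesgue U \<le> emeasure lebesgue ((U - N) \<union> N)"
      using U(1,3) negligible_imp_sets[OF N] by (intro emeasure_mono) auto
    also have "\<dots> = emeasure lebesgue (U - N)"
      using U(3) N by (intro emeasure_Un_null_set) (auto simp: negligible_iff_null_sets)
    finally show ?thesis using U(4) by simp
  qed
  have "\<exists>r>0. (t \<in> N \<longrightarrow> ball t r \<subseteq> U) \<and>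
      (t \<in> {a..b} - N \<longrightarrow> (\<forall>u v. u \<in> ball t r \<longrightarrow> v \<in> ball t r \<longrightarrow> u \<le> t \<longrightarrow> t \<le> v \<longrightarrow> w v - w u \<le> (c + \<epsilon>) * (v - u)))" for t
  proof (cases "t \<in> N")
    case True
    then obtain r where "r > 0" "ball t r \<subseteq> U" using U(1,2) by (meson openE subsetD)
    then show ?thesis using True by blast
  next
    case notN: False
    show ?thesis
    proof (cases "t \<in> {a..b}")
      case True
      then obtain D where D: "D \<le> c" "(w has_real_derivative D) (at t)" using deriv notN by blast
      have "(w has_derivative (*) D) (at t)" using D(2) by (simp add: has_field_derivative_def)
      then obtain r where r: "r > 0" "\<And>y. norm (y - t) < r \<Longrightarrow> norm (w y - w t - D * (y - t)) \<le> \<epsilon> * norm (y - t)"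
        unfolding has_derivative_at_alt using \<open>\<epsilon> > 0\<close> by blast
      have "w v - w u \<le> (c + \<epsilon>) * (v - u)" if uv: "u \<in> ball t r" "v \<in> ball t r" "u \<le> t" "t \<le> v" for u v
      proof -
        have "\<bar>w v - w t - D * (v - t)\<bar> \<le> \<epsilon> * (v - t)" "\<bar>w u - w t - D * (u - t)\<bar> \<le> \<epsilon> * (t - u)"
          using r(2)[of v] r(2)[of u] uv by (auto simp: dist_real_def)
        then have "w v - w u \<le> D * (v - t) - D * (u - t) + \<epsilon> * (v - t) + \<epsilon> * (t - u)" by linarith
        also have "\<dots> = D * (v - u) + \<epsilon> * (v - u)" by (simp add: algebra_simps)
        also have "\<dots> \<le> c * (v - u) + \<epsilon> * (v - u)"
          using D(1) uv by (intro add_right_mono mult_right_mono) auto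
        finally show ?thesis by (simp add: distrib_right)
      qed
      then show ?thesis using r(1) notN by blast
    next
      case False
      then show ?thesis using notN by (intro exI[of _ 1]) auto
    qed
  qed
  then obtain r where r: "\<And>t. r t > 0" "\<And>t. t \<in> N \<Longrightarrow> ball t (r t) \<subseteq> U"
    "\<And>t u v. t \<in> {a..b} - N \<Longrightarrow> u \<in> ball t (r t) \<Longrightarrow> v \<in> ball t (r t) \<Longrightarrow> u \<le> t \<Longrightarrow> t \<le> v \<Longrightarrow> w v - w u \<le> (c + \<epsilon>) * (v - u)"
    by metis
  have "gauge (\<lambda>t. ball t (r t))" using r(1) by (simp add: gauge_def)
  then obtain p where p: "p tagged_division_of {a..b}" "(\<lambda>t. ball t (r t)) fine p"
    using fine_division_exists_real by blast
  note pD = tagged_division_ofD[OF p(1)]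
  have K: "x \<in> {a..b} \<and> Inf K \<le> x \<and> x \<le> Sup K \<and> Inf K \<in> {a..b} \<and> Sup K \<in> {a..b} \<and> K = {Inf K..Sup K} \<and> K \<subseteq> ball x (r x)"
    if xK: "(x, K) \<in> p" for x K
  proof -
    obtain u v where uv: "K = {u..v}" using pD(4)[OF xK] by auto
    have "x \<in> K" "K \<subseteq> {a..b}" using pD(2,3)[OF xK] by auto
    moreover have "K \<subseteq> ball x (r x)" using p(2) xK unfolding fine_def by blast
    ultimately show ?thesis using uv by auto
  qed
  \<comment> \<open>The part of the division that is tagged in the exceptional set.\<close>
  define P where "P = {(x, K) \<in> p. x \<in> N}"
  have "P \<subseteq> p" "finite P" using pD(1) by (auto simp: P_def intro: finite_subset)
  define \<Delta> where "\<Delta> y = w (Sup (snd y)) - w (Inf (snd y))" for y :: "real \<times> real set"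
  define len where "len y = Sup (snd y) - Inf (snd y)" for y :: "real \<times> real set"
  have len_nonneg: "len y \<ge> 0" if "y \<in> p" for y
    using K[of "fst y" "snd y"] that by (auto simp: len_def)
  have total: "sum \<Delta> p = w b - w a" "sum len p = b - a"
    using additive_tagged_division_1[OF \<open>a \<le> b\<close> p(1), of w] additive_tagged_division_1[OF \<open>a \<le> b\<close> p(1), of "\<lambda>t. t"]
    by (simp_all add: \<Delta>_def len_def case_prod_beta)
  have disj: "{Inf (snd y)<..<Sup (snd y)} \<inter> {Inf (snd y')<..<Sup (snd y')} = {}" if "y \<in> p" "y' \<in> p" "y \<noteq> y'" for y y'
  proof -
    have "interior (snd y) \<inter> interior (snd y') = {}"
      using pD(5)[of "fst y" "snd y" "fst y'" "snd y'"] that by (auto simp: prod_eq_iff)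
    moreover have "interior (snd y) = {Inf (snd y)<..<Sup (snd y)}" "interior (snd y') = {Inf (snd y')<..<Sup (snd y')}"
      using K[of "fst y" "snd y"] K[of "fst y'" "snd y'"] that
      by (metis interior_atLeastAtMost_real prod.collapse)+
    ultimately show ?thesis by simp
  qed
  have lenP: "sum len P < \<eta>'"
  proof -
    have "ennreal (sum len P) \<le> emeasure lebesgue U"
      unfolding len_def
    proof (rule sum_disjoint_intervals_le_emeasure[OF \<open>finite P\<close>])
      fix y assume y: "y \<in> P"
      then have yp: "(fst y, snd y) \<in> p" "fst y \<in> N" by (auto simp: P_def)
      show "Inf (snd y) \<le> Sup (snd y)" using K[OF yp(1)] by linarith
      show "{Inf (snd y)<..<Sup (snd y)} \<subseteq> U"
        using K[OF yp(1)] r(2)[OF yp(2)] by (metis greaterThanLessThan_subseteq_atLeastAtMost_iff order_refl subset_trans)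
    next
      show "{Inf (snd i)<..<Sup (snd i)} \<inter> {Inf (snd j)<..<Sup (snd j)} = {}" if "i \<in> P" "j \<in> P" "i \<noteq> j" for i j
        using disj that \<open>P \<subseteq> p\<close> by blast
    qed (use U in auto)
    then have "ennreal (sum len P) < ennreal \<eta>'" using U_small by (rule le_less_trans)
    then show ?thesis using \<open>\<eta>' > 0\<close> by (simp add: ennreal_less_iff sum_nonneg len_nonneg subsetD[OF \<open>P \<subseteq> p\<close>])
  qed
  have badP: "sum \<Delta> P \<le> \<epsilon>"
  proof -
    obtain g where g: "bij_betw g {..<card P} P"
      using ex_bij_betw_nat_finite[OF \<open>finite P\<close>] by (auto simp: atLeast0LessThan)
    have gP: "g i \<in> p" if "i < card P" for i using g that \<open>P \<subseteq> p\<close> bij_betwE by blast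
    have "(\<Sum>i<card P. \<bar>w (Sup (snd (g i))) - w (Inf (snd (g i)))\<bar>) < \<epsilon>"
    proof (rule ac_\<eta>[THEN spec, THEN spec, THEN spec, THEN mp], intro conjI)
      show "\<forall>i<card P. Inf (snd (g i)) \<in> I \<and> Sup (snd (g i)) \<in> I \<and> Inf (snd (g i)) \<le> Sup (snd (g i))"
      proof (intro allI impI)
        fix i assume "i < card P"
        then have "(fst (g i), snd (g i)) \<in> p" using gP by simp
        from K[OF this] show "Inf (snd (g i)) \<in> I \<and> Sup (snd (g i)) \<in> I \<and> Inf (snd (g i)) \<le> Sup (snd (g i))"
          using \<open>{a..b} \<subseteq> I\<close> by auto
      qed
      show "\<forall>i<card P. \<forall>j<card P. i \<noteq> j \<longrightarrow>
          {Inf (snd (g i))<..<Sup (snd (g i))} \<inter> {Inf (snd (g j))<..<Sup (snd (g j))} = {}"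
      proof (intro allI impI)
        fix i j assume ij: "i < card P" "j < card P" "i \<noteq> j"
        then have "g i \<noteq> g j" using g by (auto simp: bij_betw_def inj_on_def)
        then show "{Inf (snd (g i))<..<Sup (snd (g i))} \<inter> {Inf (snd (g j))<..<Sup (snd (g j))} = {}"
          by (rule disj[OF gP[OF ij(1)] gP[OF ij(2)]])
      qed
      have "(\<Sum>i<card P. Sup (snd (g i)) - Inf (snd (g i))) = sum len P"
        using sum.reindex_bij_betw[OF g, of len] by (simp add: len_def)
      then show "(\<Sum>i<card P. Sup (snd (g i)) - Inf (snd (g i))) < \<eta>" using lenP by (simp add: \<eta>'_def)
    qed
    also have "(\<Sum>i<card P. \<bar>w (Sup (snd (g i))) - w (Inf (snd (g i)))\<bar>) = (\<Sum>y\<in>P. \<bar>\<Delta> y\<bar>)"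
      using sum.reindex_bij_betw[OF g, of "\<lambda>y. \<bar>\<Delta> y\<bar>"] by (simp add: \<Delta>_def)
    finally have "(\<Sum>y\<in>P. \<bar>\<Delta> y\<bar>) < \<epsilon>" .
    moreover have "sum \<Delta> P \<le> (\<Sum>y\<in>P. \<bar>\<Delta> y\<bar>)" by (rule sum_mono) simp
    ultimately show ?thesis by simp
  qed
  have good: "sum \<Delta> (p - P) \<le> (c + \<epsilon>) * sum len (p - P)"
    unfolding sum_distrib_left
  proof (rule sum_mono)
    fix y assume y: "y \<in> p - P"
    then have yp: "(fst y, snd y) \<in> p" "fst y \<notin> N" by (auto simp: P_def case_prod_beta)
    show "\<Delta> y \<le> (c + \<epsilon>) * len y"
      unfolding \<Delta>_def len_def
    proof (rule r(3))
      show "fst y \<in> {a..b} - N" using K[OF yp(1)] yp(2) by blast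
      have "Inf (snd y) \<in> snd y" "Sup (snd y) \<in> snd y" using K[OF yp(1)] by (metis atLeastAtMost_iff order_refl order_trans)+
      then show "Inf (snd y) \<in> ball (fst y) (r (fst y))" "Sup (snd y) \<in> ball (fst y) (r (fst y))"
        using K[OF yp(1)] by blast+
    qed (use K[OF yp(1)] in auto)
  qed
  have split: "sum f p = sum f (p - P) + sum f P" for f :: "real \<times> real set \<Rightarrow> real"
    by (rule sum.subset_diff[OF \<open>P \<subseteq> p\<close> pD(1)])
  \<comment> \<open>If \<open>c\<close> is negative, leaving out the intervals in \<open>P\<close> costs their total length times \<open>\<bar>c\<bar>\<close>.\<close>
  have "- (c + \<epsilon>) * sum len P \<le> (\<bar>c\<bar> + 1) * sum len P"
    using \<open>\<epsilon> > 0\<close> len_nonneg \<open>P \<subseteq> p\<close> by (intro mult_right_mono sum_nonneg) auto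
  also have "\<dots> \<le> (\<bar>c\<bar> + 1) * (\<epsilon> / (\<bar>c\<bar> + 1))"
    using lenP by (intro mult_left_mono) (auto simp: \<eta>'_def)
  also have "\<dots> = \<epsilon>" by (simp add: add_nonneg_eq_0_iff)
  finally have "- (c + \<epsilon>) * sum len P \<le> \<epsilon>" .
  moreover have "w b - w a \<le> (c + \<epsilon>) * sum len (p - P) + \<epsilon>"
    using good badP split[of \<Delta>] total(1) by simp
  moreover have "sum len (p - P) = b - a - sum len P" using split[of len] total(2) by simp
  ultimately have "w b - w a \<le> (c + \<epsilon>) * (b - a) + 2 * \<epsilon>" by (simp add: algebra_simps)
  also have "\<dots> = c * (b - a) + \<epsilon> * (b - a + 2)" by (simp add: algebra_simps)
  finally show "w b - w a \<le> c * (b - a) + e" using \<epsilon>_e by simp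
qed

lemma absolutely_continuous_on_uminus:
  "absolutely_continuous_on I w \<Longrightarrow> absolutely_continuous_on I (\<lambda>t. - w t)"
proof -
  have "\<bar>- x - - y\<bar> = \<bar>x - y\<bar>" for x y :: real by simp
  then show "absolutely_continuous_on I w \<Longrightarrow> ?thesis" unfolding absolutely_continuous_on_def by simp
qed

lemma continuous_on_Ici_if_absolutely_continuous:
  assumes "\<And>\<tau>. \<tau> \<ge> 0 \<Longrightarrow> absolutely_continuous_on {0..\<tau>} w"
  shows "continuous_on {0..} w"
  unfolding continuous_on_iff
proof (intro ballI allI impI)
  fix t e :: real assume t: "t \<in> {0..}" and "e > 0"
  have "absolutely_continuous_on {0..t + 1} w" using assms t by simp
  from this[unfolded absolutely_continuous_on_def, THEN spec, THEN mp, OF \<open>e > 0\<close>]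
  obtain \<delta> where \<delta>: "\<delta> > 0"
    and ac: "\<forall>(n::nat) a b. (\<forall>i<n. a i \<in> {0..t + 1} \<and> b i \<in> {0..t + 1} \<and> a i \<le> b i) \<and>
        (\<forall>i<n. \<forall>j<n. i \<noteq> j \<longrightarrow> {a i<..<b i} \<inter> {a j<..<b j} = {}) \<and>
        (\<Sum>i<n. b i - a i) < \<delta> \<longrightarrow> (\<Sum>i<n. \<bar>w (b i) - w (a i)\<bar>) < e"
    by (elim exE conjE)
  have close: "\<bar>w v - w u\<bar> < e" if "u \<in> {0..t + 1}" "v \<in> {0..t + 1}" "u \<le> v" "v - u < \<delta>" for u v
    using ac[THEN spec, of 1, THEN spec, of "\<lambda>_. u", THEN spec, of "\<lambda>_. v"] that by simp
  have "dist (w s) (w t) < e" if "s \<in> {0..}" "dist s t < min \<delta> 1" for s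
    using close[of s t] close[of t s] that t by (cases "s \<le> t") (auto simp: dist_real_def)
  then show "\<exists>d>0. \<forall>s\<in>{0..}. dist s t < d \<longrightarrow> dist (w s) (w t) < e"
    using \<delta> by (intro exI[of _ "min \<delta> 1"]) auto
qed

section \<open>The scalar super-twisting system\<close>

definition signed_root :: "real \<Rightarrow> real" where
  "signed_root s = sqrt \<bar>s\<bar> * sgn s"

lemma signed_root_uminus [simp]: "signed_root (- s) = - signed_root s"
  by (simp add: signed_root_def sgn_minus)

lemma signed_root_nonneg: "s \<ge> 0 \<Longrightarrow> signed_root s = sqrt s"
  by (simp add: signed_root_def sgn_if)

lemma signed_root_square: "(signed_root s)\<^sup>2 = \<bar>s\<bar>"
  by (simp add: signed_root_def power_mult_distrib sgn_if)

lemma continuous_on_signed_root [continuous_intros]: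
  assumes "continuous_on X f" shows "continuous_on X (\<lambda>t. signed_root (f t))"
proof -
  have "signed_root s = sqrt (max 0 s) - sqrt (max 0 (- s))" for s
    by (simp add: signed_root_def sgn_if max_def)
  then show ?thesis using assms by (simp add: continuous_intros)
qed

text \<open>With \<open>Y = \<alpha> * signed_root \<sigma>\<close> the squared function equals \<open>w\<^sup>2\<close> while \<open>\<sigma>\<close> moves away from zero, that is,
while \<open>w - Y\<close> has the sign of \<open>Y\<close>, and the quadratic form \<open>w\<^sup>2 + 4/3 * Y * (Y - w)\<close> while \<open>\<sigma>\<close>
returns to zero. The two agree on the curve \<open>w = Y\<close>, and the function reduces to \<open>\<bar>w\<bar>\<close> on
the axis \<open>\<sigma> = 0\<close>, so it is insensitive to crossings of the axis. The coefficient \<open>4/3\<close> is the one for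
which the dissipation in the limiting case \<open>\<mu> = \<alpha>\<^sup>2\<close> becomes a square.\<close>

definition st_lyapunov :: "real \<Rightarrow> real \<Rightarrow> real \<Rightarrow> real" where
  "st_lyapunov \<alpha> \<sigma> w = sqrt (w\<^sup>2 + 4 / 3 * max 0 (\<alpha> * signed_root \<sigma> * (\<alpha> * signed_root \<sigma> - w)))"

lemma st_lyapunov_uminus: "st_lyapunov \<alpha> (- \<sigma>) (- w) = st_lyapunov \<alpha> \<sigma> w"
proof -
  have "\<alpha> * - signed_root \<sigma> * (\<alpha> * - signed_root \<sigma> - - w) = \<alpha> * signed_root \<sigma> * (\<alpha> * signed_root \<sigma> - w)"
    by (simp add: algebra_simps)
  then show ?thesis by (simp add: st_lyapunov_def)
qed

lemma st_lyapunov_nonneg [simp]: "st_lyapunov \<alpha> \<sigma> w \<ge> 0"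
  by (simp add: st_lyapunov_def)

lemma abs_le_st_lyapunov: "\<bar>w\<bar> \<le> st_lyapunov \<alpha> \<sigma> w"
  unfolding st_lyapunov_def by (rule real_le_rsqrt) simp

lemma st_lyapunov_square:
  "(st_lyapunov \<alpha> \<sigma> w)\<^sup>2 = w\<^sup>2 + 4 / 3 * max 0 (\<alpha> * signed_root \<sigma> * (\<alpha> * signed_root \<sigma> - w))"
  unfolding st_lyapunov_def by (intro real_sqrt_pow2 add_nonneg_nonneg) auto

lemma abs_le_st_lyapunov_square: "\<alpha>\<^sup>2 * \<bar>\<sigma>\<bar> \<le> 2 * (st_lyapunov \<alpha> \<sigma> w)\<^sup>2"
proof -
  define Y where "Y = \<alpha> * signed_root \<sigma>"
  have Y2: "Y\<^sup>2 = \<alpha>\<^sup>2 * \<bar>\<sigma>\<bar>" by (simp add: Y_def power_mult_distrib signed_root_square)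
  have "Y\<^sup>2 \<le> 2 * w\<^sup>2 + 8 / 3 * (Y * (Y - w))"
  proof -
    have "2 * w\<^sup>2 + 8 / 3 * (Y * (Y - w)) - Y\<^sup>2 = 2 * (w - 2 / 3 * Y)\<^sup>2 + 7 / 9 * Y\<^sup>2"
      by (simp add: power2_eq_square field_simps)
    also have "\<dots> \<ge> 0" by simp
    finally show ?thesis by simp
  qed
  also have "\<dots> \<le> 2 * (w\<^sup>2 + 4 / 3 * max 0 (Y * (Y - w)))" by simp
  finally show ?thesis unfolding st_lyapunov_square Y2[symmetric] Y_def .
qed

lemma st_lyapunov_square_le: "(st_lyapunov \<alpha> \<sigma> w)\<^sup>2 \<le> 2 * w\<^sup>2 + 2 * (\<alpha>\<^sup>2 * \<bar>\<sigma>\<bar>)"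
proof -
  define Y where "Y = \<alpha> * signed_root \<sigma>"
  have Y2: "Y\<^sup>2 = \<alpha>\<^sup>2 * \<bar>\<sigma>\<bar>" by (simp add: Y_def power_mult_distrib signed_root_square)
  have "0 \<le> (Y + w)\<^sup>2" by simp
  then have "Y * (Y - w) \<le> 3 / 2 * Y\<^sup>2 + 1 / 2 * w\<^sup>2" by (simp add: power2_eq_square algebra_simps)
  then have "4 / 3 * max 0 (Y * (Y - w)) \<le> 4 / 3 * (3 / 2 * Y\<^sup>2 + 1 / 2 * w\<^sup>2)" by (intro mult_left_mono) auto
  also have "\<dots> \<le> w\<^sup>2 + 2 * Y\<^sup>2" by simp
  finally show ?thesis unfolding st_lyapunov_square Y_def[symmetric] Y2[symmetric] by simp
qed

definition st_quadratic :: "real \<Rightarrow> real \<Rightarrow> real \<Rightarrow> real" where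
  "st_quadratic \<alpha> s w = w\<^sup>2 + 4 / 3 * (\<alpha> * s * (\<alpha> * s - w))"

lemma st_quadratic_alt: "st_quadratic \<alpha> s w = (w - 2 / 3 * (\<alpha> * s))\<^sup>2 + 8 / 9 * (\<alpha> * s)\<^sup>2"
  by (simp add: st_quadratic_def power2_eq_square field_simps)

lemma st_quadratic_convex:
  assumes "u \<le> w" "w \<le> v"
  shows "st_quadratic \<alpha> s w \<le> max (st_quadratic \<alpha> s u) (st_quadratic \<alpha> s v)"
proof -
  have "\<bar>w - 2 / 3 * (\<alpha> * s)\<bar> \<le> \<bar>u - 2 / 3 * (\<alpha> * s)\<bar> \<or> \<bar>w - 2 / 3 * (\<alpha> * s)\<bar> \<le> \<bar>v - 2 / 3 * (\<alpha> * s)\<bar>"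
    using assms by linarith
  then show ?thesis unfolding st_quadratic_alt abs_le_square_iff by auto
qed

lemma st_lyapunov_pos:
  assumes "\<sigma> > 0" "\<alpha> > 0"
  shows "st_lyapunov \<alpha> \<sigma> w = (if w \<ge> \<alpha> * sqrt \<sigma> then \<bar>w\<bar> else sqrt (st_quadratic \<alpha> (sqrt \<sigma>) w))"
proof -
  have "0 < \<alpha> * sqrt \<sigma>" using assms by simp
  moreover have "Y * (Y - w) \<le> 0 \<longleftrightarrow> Y \<le> w" if "0 < Y" for Y
    using that by (simp add: mult_le_0_iff)
  ultimately have "\<alpha> * sqrt \<sigma> * (\<alpha> * sqrt \<sigma> - w) \<le> 0 \<longleftrightarrow> \<alpha> * sqrt \<sigma> \<le> w"
    by blast
  then show ?thesis
    using assms by (auto simp: st_lyapunov_def st_quadratic_def signed_root_nonneg max_def)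
qed

text \<open>With \<open>y = Y - w\<close> the right-hand side equals \<open>\<mu> * (y - Y)\<^sup>2 + (\<alpha>\<^sup>2 - \<mu>) * (y\<^sup>2 + y * Y)\<close>. For
\<open>0 < \<mu> < \<alpha>\<^sup>2\<close> and \<open>y \<ge> 0\<close> both terms are nonnegative and they do not vanish together. The root on
the left is that of the quadratic form in terms of \<open>y\<close> and \<open>Y\<close>.\<close>

lemma st_dissipation:
  fixes y Y :: real
  assumes "0 < p" "p \<le> q" "q < \<alpha>\<^sup>2" "\<mu> \<in> {p, q}" "y \<ge> 0" "Y > 0"
  shows "min p (\<alpha>\<^sup>2 - q) / 4 * (Y * sqrt (y\<^sup>2 - 2 / 3 * (y * Y) + Y\<^sup>2))
      < \<alpha>\<^sup>2 * y\<^sup>2 - (3 * \<mu> - \<alpha>\<^sup>2) * (y * Y) + \<mu> * Y\<^sup>2"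
proof -
  define \<nu> where "\<nu> = min p (\<alpha>\<^sup>2 - q)"
  define Q where "Q = y\<^sup>2 - 2 / 3 * (y * Y) + Y\<^sup>2"
  have \<nu>: "\<nu> > 0" "\<nu> \<le> \<mu>" "\<nu> \<le> \<alpha>\<^sup>2 - \<mu>" using assms by (auto simp: \<nu>_def)
  have yY: "y * Y \<ge> 0" using assms by simp
  have "Q = (y - Y / 3)\<^sup>2 + 8 / 9 * Y\<^sup>2" by (simp add: Q_def power2_eq_square field_simps)
  then have "Q \<ge> 0" by simp
  have "0 \<le> (Y - sqrt Q)\<^sup>2" by simp
  then have "2 * (Y * sqrt Q) \<le> Y\<^sup>2 + Q" using \<open>Q \<ge> 0\<close> by (simp add: power2_diff)
  also have "\<dots> \<le> 2 * (y\<^sup>2 + Y\<^sup>2)"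
  proof -
    have "- (2 * (y * Y) / 3) \<le> y\<^sup>2" by (rule order_trans[of _ 0]) (use yY in auto)
    then show ?thesis by (simp add: Q_def)
  qed
  finally have sq: "Y * sqrt Q \<le> y\<^sup>2 + Y\<^sup>2" by simp
  have pos: "y\<^sup>2 + Y\<^sup>2 > 0" using assms by (simp add: add_nonneg_pos)
  have "\<nu> / 4 * (Y * sqrt Q) \<le> \<nu> / 4 * (y\<^sup>2 + Y\<^sup>2)" using sq \<nu> by (intro mult_left_mono) auto
  also have "\<dots> < \<nu> / 2 * (y\<^sup>2 + Y\<^sup>2)" using pos \<nu> by simp
  also have "\<dots> \<le> \<nu> * ((y - Y)\<^sup>2 + (y\<^sup>2 + y * Y))"
  proof -
    have "(y - Y)\<^sup>2 + (y\<^sup>2 + y * Y) - 1 / 2 * (y\<^sup>2 + Y\<^sup>2) = (Y - y)\<^sup>2 / 2 + y\<^sup>2"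
      by (simp add: power2_eq_square field_simps)
    also have "\<dots> \<ge> 0" by simp
    finally have "\<nu> * (1 / 2 * (y\<^sup>2 + Y\<^sup>2)) \<le> \<nu> * ((y - Y)\<^sup>2 + (y\<^sup>2 + y * Y))" using \<nu> by (intro mult_left_mono) auto
    then show ?thesis by simp
  qed
  also have "\<dots> = \<nu> * (y - Y)\<^sup>2 + \<nu> * (y\<^sup>2 + y * Y)" by (rule distrib_left)
  also have "\<dots> \<le> \<mu> * (y - Y)\<^sup>2 + (\<alpha>\<^sup>2 - \<mu>) * (y\<^sup>2 + y * Y)"
    using \<nu> yY by (intro add_mono mult_right_mono) auto
  also have "\<dots> = \<alpha>\<^sup>2 * y\<^sup>2 - (3 * \<mu> - \<alpha>\<^sup>2) * (y * Y) + \<mu> * Y\<^sup>2"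
    by (simp add: power2_eq_square algebra_simps)
  finally show ?thesis unfolding \<nu>_def Q_def .
qed

text \<open>The derivative of the quadratic form along \<open>\<sigma>\<close> and along a straight line of slope \<open>- \<mu>\<close> in \<open>w\<close> is
\<open>- 2 / (3 * Y)\<close> times the expression estimated in \<open>st_dissipation\<close>.\<close>

lemma st_quadratic_decreases:
  fixes \<sigma> :: "real \<Rightarrow> real"
  assumes par: "0 < p" "p \<le> q" "q < \<alpha>\<^sup>2" "\<alpha> > 0" and \<mu>: "\<mu> \<in> {p, q}"
    and \<sigma>: "\<sigma> t > 0" "(\<sigma> has_real_derivative w - \<alpha> * sqrt (\<sigma> t)) (at t within {t..})"
    and w: "w \<le> \<alpha> * sqrt (\<sigma> t)"
  shows "\<exists>\<delta>>0. \<forall>s. t < s \<and> s < t + \<delta> \<longrightarrow>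
    sqrt (st_quadratic \<alpha> (sqrt (\<sigma> s)) (w - \<mu> * (s - t)))
      \<le> sqrt (st_quadratic \<alpha> (sqrt (\<sigma> t)) w) - min p (\<alpha>\<^sup>2 - q) / 12 * (s - t)"
proof -
  define k where "k = min p (\<alpha>\<^sup>2 - q) / 12"
  define S where "S = sqrt (\<sigma> t)"
  define Y where "Y = \<alpha> * S"
  define y where "y = Y - w"
  have S: "S > 0" using \<sigma>(1) by (simp add: S_def)
  have Y: "Y > 0" "y \<ge> 0" using S par w by (simp_all add: Y_def y_def S_def)
  define Q where "Q = st_quadratic \<alpha> S w"
  have Q: "Q = y\<^sup>2 - 2 / 3 * (y * Y) + Y\<^sup>2"
    by (simp add: Q_def st_quadratic_def y_def Y_def power2_eq_square algebra_simps)
  have "Q > 0" using S par unfolding Q_def st_quadratic_alt by (simp add: add_nonneg_pos)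
  define S' where "S' = (w - \<alpha> * S) / (2 * S)"
  have dS: "((\<lambda>s. sqrt (\<sigma> s)) has_real_derivative S') (at t within {t..})"
    using \<sigma> unfolding S'_def S_def by (auto intro!: derivative_eq_intros simp: field_simps)
  define R where "R = - 2 * \<mu> * w + 4 / 3 * ((\<alpha> * S') * (\<alpha> * S - w) + \<alpha> * S * (\<alpha> * S' + \<mu>))"
  have dQ: "((\<lambda>s. st_quadratic \<alpha> (sqrt (\<sigma> s)) (w - \<mu> * (s - t))) has_real_derivative R) (at t within {t..})"
    unfolding st_quadratic_def R_def
    by (rule derivative_eq_intros dS refl)+ (simp add: S_def algebra_simps)
  have dF: "((\<lambda>s. sqrt (st_quadratic \<alpha> (sqrt (\<sigma> s)) (w - \<mu> * (s - t))) + k * (s - t)) has_real_derivative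
      R / (2 * sqrt Q) + k) (at t within {t..})"
  proof -
    let ?G = "\<lambda>s. st_quadratic \<alpha> (sqrt (\<sigma> s)) (w - \<mu> * (s - t))"
    have Gt: "?G t = Q" by (simp add: Q_def S_def)
    have "((\<lambda>s. sqrt (?G s)) has_real_derivative inverse (sqrt (?G t)) / 2 * R) (at t within {t..})"
      by (rule DERIV_chain2[OF DERIV_real_sqrt dQ]) (simp add: Gt[simplified] \<open>Q > 0\<close>)
    moreover have "((\<lambda>s. k * (s - t)) has_real_derivative k) (at t within {t..})"
      by (auto intro!: derivative_eq_intros)
    ultimately have "((\<lambda>s. sqrt (?G s) + k * (s - t)) has_real_derivative inverse (sqrt (?G t)) / 2 * R + k) (at t within {t..})"
      by (rule DERIV_add)
    then show ?thesis unfolding Gt by (simp add: field_simps)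
  qed
  have "R / (2 * sqrt Q) + k < 0"
  proof -
    have wy: "w = Y - y" by (simp add: y_def)
    have yS: "2 * S * S' = - y" using S by (simp add: S'_def y_def Y_def)
    have "2 * Y * R = - 4 * \<mu> * w * Y + 4 / 3 * (\<alpha>\<^sup>2 * (2 * S * S') * (2 * Y - w) + 2 * \<mu> * Y\<^sup>2)"
      unfolding R_def Y_def by (simp add: power2_eq_square field_simps)
    also have "\<dots> = - (4 / 3) * (\<alpha>\<^sup>2 * y\<^sup>2 - (3 * \<mu> - \<alpha>\<^sup>2) * (y * Y) + \<mu> * Y\<^sup>2)"
      unfolding yS wy by (simp add: power2_eq_square field_simps)
    also have "\<dots> < - (4 / 3) * (3 * k * (Y * sqrt Q))"
    proof -
      have "3 * k * (Y * sqrt Q) < \<alpha>\<^sup>2 * y\<^sup>2 - (3 * \<mu> - \<alpha>\<^sup>2) * (y * Y) + \<mu> * Y\<^sup>2"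
        using st_dissipation[OF par(1-3) \<mu> Y(2,1)] unfolding Q[symmetric] by (simp add: k_def)
      then show ?thesis by (rule mult_strict_left_mono_neg) simp
    qed
    finally have "Y * (R + 2 * k * sqrt Q) < 0" by (simp add: algebra_simps)
    then have "R + 2 * k * sqrt Q < 0" using Y(1) by (simp add: mult_less_0_iff)
    then show ?thesis using \<open>Q > 0\<close> by (simp add: field_simps)
  qed
  from has_real_derivative_neg_dec_right[OF dF this] obtain \<delta> where \<delta>: "\<delta> > 0"
    "\<And>h. h > 0 \<Longrightarrow> h < \<delta> \<Longrightarrow> sqrt (st_quadratic \<alpha> (sqrt (\<sigma> (t + h))) (w - \<mu> * (t + h - t))) + k * (t + h - t)
      < sqrt (st_quadratic \<alpha> (sqrt (\<sigma> t)) (w - \<mu> * (t - t))) + k * (t - t)" by auto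
  show ?thesis
    unfolding k_def[symmetric]
  proof (intro exI[of _ \<delta>] conjI allI impI \<delta>(1))
    fix s assume "t < s \<and> s < t + \<delta>"
    then show "sqrt (st_quadratic \<alpha> (sqrt (\<sigma> s)) (w - \<mu> * (s - t))) \<le> sqrt (st_quadratic \<alpha> (sqrt (\<sigma> t)) w) - k * (s - t)"
      using \<delta>(2)[of "s - t"] by simp
  qed
qed

text \<open>Only two-sided bounds on the increments of \<open>w\<close> are known. By convexity of the quadratic form in \<open>w\<close>
it suffices to treat the two extreme slopes \<open>- p\<close> and \<open>- q\<close>, which are differentiable.\<close>

lemma st_lyapunov_decreases_pos:
  fixes \<sigma> w :: "real \<Rightarrow> real"
  assumes par: "0 < p" "p \<le> q" "q < \<alpha>\<^sup>2" "\<alpha> > 0"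
    and \<sigma>: "\<sigma> t > 0" "(\<sigma> has_real_derivative w t - \<alpha> * sqrt (\<sigma> t)) (at t within {t..})"
    and w_lim: "(w \<longlongrightarrow> w t) (at_right t)"
    and w_bounds: "\<forall>\<^sub>F s in at_right t. w t - q * (s - t) \<le> w s \<and> w s \<le> w t - p * (s - t)"
  shows "\<forall>\<^sub>F s in at_right t. st_lyapunov \<alpha> (\<sigma> s) (w s) \<le> st_lyapunov \<alpha> (\<sigma> t) (w t) - min p (\<alpha>\<^sup>2 - q) / 12 * (s - t)"
proof -
  define k where "k = min p (\<alpha>\<^sup>2 - q) / 12"
  have "k \<le> p" using par by (simp add: k_def min_def)
  define S where "S = sqrt (\<sigma> t)"
  have "S > 0" using \<sigma>(1) by (simp add: S_def)
  define V where "V = st_lyapunov \<alpha> (\<sigma> t) (w t)"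
  have lim: "(\<sigma> \<longlongrightarrow> \<sigma> t) (at_right t)"
    using DERIV_continuous[OF \<sigma>(2)] unfolding continuous_within at_within_Ici_at_right .
  then have \<sigma>_pos: "\<forall>\<^sub>F s in at_right t. \<sigma> s > 0" using \<sigma>(1) by (rule order_tendstoD)
  have right: "\<forall>\<^sub>F s in at_right t. t < s" by (rule eventually_at_right_less)
  have gap_lim: "((\<lambda>s. w s - \<alpha> * sqrt (\<sigma> s)) \<longlongrightarrow> w t - \<alpha> * S) (at_right t)"
    unfolding S_def by (intro tendsto_intros lim w_lim)
  have A: "\<forall>\<^sub>F s in at_right t. \<bar>w s\<bar> \<le> V - k * (s - t)" if "w t \<ge> \<alpha> * S"
  proof -
    have "w t > 0" using that \<open>S > 0\<close> par(4) by (meson less_le_trans mult_pos_pos)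
    then have V: "V = w t" using that \<sigma>(1) par(4) by (simp add: V_def st_lyapunov_pos S_def)
    have "\<forall>\<^sub>F s in at_right t. w s > 0" using w_lim \<open>w t > 0\<close> by (rule order_tendstoD)
    then show ?thesis using w_bounds right
    proof eventually_elim
      case (elim s)
      then have "k * (s - t) \<le> p * (s - t)" using \<open>k \<le> p\<close> by (intro mult_right_mono) auto
      then show ?case using elim V by linarith
    qed
  qed
  have B: "\<forall>\<^sub>F s in at_right t. sqrt (st_quadratic \<alpha> (sqrt (\<sigma> s)) (w s)) \<le> V - k * (s - t)" if le: "w t \<le> \<alpha> * S"
  proof -
    have V: "V = sqrt (st_quadratic \<alpha> S (w t))"
      using le \<sigma>(1) par(4) by (auto simp: V_def st_lyapunov_pos S_def st_quadratic_def)
    have dec: "\<forall>\<^sub>F s in at_right t. sqrt (st_quadratic \<alpha> (sqrt (\<sigma> s)) (w t - \<mu> * (s - t))) \<le> V - k * (s - t)"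
      if \<mu>: "\<mu> \<in> {p, q}" for \<mu>
    proof -
      obtain \<delta> where "\<delta> > 0" "\<forall>s. t < s \<and> s < t + \<delta> \<longrightarrow>
        sqrt (st_quadratic \<alpha> (sqrt (\<sigma> s)) (w t - \<mu> * (s - t))) \<le> V - k * (s - t)"
        using st_quadratic_decreases[OF par \<mu> \<sigma>, OF le[unfolded S_def]] unfolding V S_def k_def by blast
      then show ?thesis unfolding eventually_at_right_field by (intro exI[of _ "t + \<delta>"]) auto
    qed
    show ?thesis using w_bounds dec[of p, simplified] dec[of q, simplified]
    proof eventually_elim
      case (elim s)
      have "sqrt (st_quadratic \<alpha> (sqrt (\<sigma> s)) (w s))
          \<le> sqrt (max (st_quadratic \<alpha> (sqrt (\<sigma> s)) (w t - q * (s - t))) (st_quadratic \<alpha> (sqrt (\<sigma> s)) (w t - p * (s - t))))"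
        using elim(1) by (intro real_sqrt_le_mono st_quadratic_convex) auto
      also have "\<dots> \<le> V - k * (s - t)" using elim(2,3) by (simp add: max_def)
      finally show ?case .
    qed
  qed
  have "\<forall>\<^sub>F s in at_right t. w s \<ge> \<alpha> * sqrt (\<sigma> s) \<longrightarrow> \<bar>w s\<bar> \<le> V - k * (s - t)"
  proof (cases "w t \<ge> \<alpha> * S")
    case True
    then show ?thesis using A by (auto elim: eventually_mono)
  next
    case False
    then have "\<forall>\<^sub>F s in at_right t. w s - \<alpha> * sqrt (\<sigma> s) < 0"
      by (intro order_tendstoD(2)[OF gap_lim]) simp
    then show ?thesis by eventually_elim simp
  qed
  moreover have "\<forall>\<^sub>F s in at_right t. w s < \<alpha> * sqrt (\<sigma> s) \<longrightarrow> sqrt (st_quadratic \<alpha> (sqrt (\<sigma> s)) (w s)) \<le> V - k * (s - t)"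
  proof (cases "w t \<le> \<alpha> * S")
    case True
    then show ?thesis using B by (auto elim: eventually_mono)
  next
    case False
    then have "\<forall>\<^sub>F s in at_right t. w s - \<alpha> * sqrt (\<sigma> s) > 0"
      by (intro order_tendstoD(1)[OF gap_lim]) simp
    then show ?thesis by eventually_elim simp
  qed
  ultimately have "\<forall>\<^sub>F s in at_right t. st_lyapunov \<alpha> (\<sigma> s) (w s) \<le> V - k * (s - t)"
    using \<sigma>_pos by eventually_elim (simp add: st_lyapunov_pos par(4))
  then show ?thesis unfolding V_def k_def .
qed

lemma continuous_on_st_lyapunov:
  assumes "continuous_on X \<sigma>" "continuous_on X w"
  shows "continuous_on X (\<lambda>t. st_lyapunov \<alpha> (\<sigma> t) (w t))"
  unfolding st_lyapunov_def by (intro continuous_intros assms)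

text \<open>The output may vanish at the left end point \<open>t\<close>, where the signed root is not differentiable; the
estimate is proved on \<open>{r..t'}\<close> for \<open>r > t\<close> and extended by continuity.\<close>

lemma st_lyapunov_decreases_while_pos:
  fixes \<sigma> w :: "real \<Rightarrow> real"
  assumes par: "0 < p" "p \<le> q" "q < \<alpha>\<^sup>2" "\<alpha> > 0" and "t \<ge> 0"
    and \<sigma>: "continuous_on {0..} \<sigma>" and w: "continuous_on {0..} w"
    and d\<sigma>: "\<And>t. t \<ge> 0 \<Longrightarrow> (\<sigma> has_real_derivative w t - \<alpha> * signed_root (\<sigma> t)) (at t within {t..})"
    and dw: "\<And>s t. 0 \<le> s \<Longrightarrow> s \<le> t \<Longrightarrow> (\<And>r. s < r \<Longrightarrow> r < t \<Longrightarrow> \<sigma> r > 0) \<Longrightarrow>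
      - q * (t - s) \<le> w t - w s \<and> w t - w s \<le> - p * (t - s)"
    and pos: "\<And>r. t < r \<Longrightarrow> r < t' \<Longrightarrow> \<sigma> r > 0" and "t < t'"
  shows "st_lyapunov \<alpha> (\<sigma> t') (w t') \<le> st_lyapunov \<alpha> (\<sigma> t) (w t) - min p (\<alpha>\<^sup>2 - q) / 12 * (t' - t)"
proof -
  define k where "k = min p (\<alpha>\<^sup>2 - q) / 12"
  define g where "g s = st_lyapunov \<alpha> (\<sigma> s) (w s) + k * s" for s
  have g: "continuous_on {t..t'} g"
    unfolding g_def using \<open>t \<ge> 0\<close>
    by (intro continuous_intros continuous_on_st_lyapunov continuous_on_subset[OF \<sigma>] continuous_on_subset[OF w]) auto
  have dec: "g t' \<le> g r" if r: "t < r" "r < t'" for r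
  proof (rule le_if_right_decreasing[of r t' g])
    show "continuous_on {r..t'} g" using r by (intro continuous_on_subset[OF g]) auto
    fix s assume s: "r \<le> s" "s < t'"
    have "s \<ge> 0" "\<sigma> s > 0" using s r \<open>t \<ge> 0\<close> pos by auto
    have "(w \<longlongrightarrow> w s) (at s within {0..})" using w \<open>s \<ge> 0\<close> unfolding continuous_on_def by auto
    then have w_lim: "(w \<longlongrightarrow> w s) (at_right s)"
      by (rule tendsto_within_subset) (use \<open>s \<ge> 0\<close> in auto)
    have "\<forall>\<^sub>F u in at_right s. w s - q * (u - s) \<le> w u \<and> w u \<le> w s - p * (u - s)"
      unfolding eventually_at_right_field
    proof (intro exI[of _ t'] conjI allI impI)
      fix u assume u: "s < u" "u < t'"
      have "- q * (u - s) \<le> w u - w s \<and> w u - w s \<le> - p * (u - s)"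
        by (rule dw) (use u s r \<open>s \<ge> 0\<close> pos in auto)
      then show "w s - q * (u - s) \<le> w u" "w u \<le> w s - p * (u - s)" by auto
    qed (use s in auto)
    moreover have "(\<sigma> has_real_derivative w s - \<alpha> * sqrt (\<sigma> s)) (at s within {s..})"
      using d\<sigma>[OF \<open>s \<ge> 0\<close>] \<open>\<sigma> s > 0\<close> by (simp add: signed_root_nonneg)
    ultimately have "\<forall>\<^sub>F u in at_right s. st_lyapunov \<alpha> (\<sigma> u) (w u) \<le> st_lyapunov \<alpha> (\<sigma> s) (w s) - k * (u - s)"
      unfolding k_def using \<open>\<sigma> s > 0\<close> w_lim by (intro st_lyapunov_decreases_pos par)
    then obtain b where b: "b > s" "\<And>u. s < u \<Longrightarrow> u < b \<Longrightarrow> st_lyapunov \<alpha> (\<sigma> u) (w u) \<le> st_lyapunov \<alpha> (\<sigma> s) (w s) - k * (u - s)"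
      unfolding eventually_at_right_field by blast
    define u where "u = min t' ((s + b) / 2)"
    have "s < (s + b) / 2" "(s + b) / 2 < b" using b(1) by (simp_all add: field_simps)
    then have "s < u" "u < b" "u \<le> t'" using s by (auto simp: u_def min_less_iff_disj)
    then show "\<exists>u. s < u \<and> u \<le> t' \<and> g u \<le> g s"
      using b(2)[of u] by (intro exI[of _ u]) (auto simp: g_def algebra_simps)
  qed (use r in simp)
  have "g t' \<le> g t"
  proof (rule tendsto_lowerbound)
    have "(g \<longlongrightarrow> g t) (at t within {t..t'})"
      using g \<open>t < t'\<close> unfolding continuous_on_def by auto
    then show "(g \<longlongrightarrow> g t) (at_right t)" using \<open>t < t'\<close> by (simp add: at_within_Icc_at_right)
    show "\<forall>\<^sub>F r in at_right t. g t' \<le> g r"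
      unfolding eventually_at_right_field using \<open>t < t'\<close> dec by (intro exI[of _ t']) auto
  qed simp
  then show ?thesis unfolding g_def k_def[symmetric] by (simp add: algebra_simps)
qed

text \<open>As long as the Lyapunov function is positive, a zero of \<open>\<sigma>\<close> has \<open>w \<noteq> 0\<close>, so that \<open>\<sigma>\<close> leaves zero
at once with the sign of \<open>w\<close>. Hence to the right of every time there is a phase of constant sign; the
negative phases reduce to the positive ones by the symmetry \<open>(\<sigma>, w) \<mapsto> (- \<sigma>, - w)\<close>.\<close>

theorem super_twisting_extinction:
  fixes \<sigma> w :: "real \<Rightarrow> real"
  assumes par: "0 < p" "p \<le> q" "q < \<alpha>\<^sup>2" "\<alpha> > 0" and "t \<ge> 0"
    and \<sigma>: "continuous_on {0..} \<sigma>" and w: "continuous_on {0..} w"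
    and d\<sigma>: "\<And>t. t \<ge> 0 \<Longrightarrow> (\<sigma> has_real_derivative w t - \<alpha> * signed_root (\<sigma> t)) (at t within {t..})"
    and dw_pos: "\<And>s t. 0 \<le> s \<Longrightarrow> s \<le> t \<Longrightarrow> (\<And>r. s < r \<Longrightarrow> r < t \<Longrightarrow> \<sigma> r > 0) \<Longrightarrow>
      - q * (t - s) \<le> w t - w s \<and> w t - w s \<le> - p * (t - s)"
    and dw_neg: "\<And>s t. 0 \<le> s \<Longrightarrow> s \<le> t \<Longrightarrow> (\<And>r. s < r \<Longrightarrow> r < t \<Longrightarrow> \<sigma> r < 0) \<Longrightarrow>
      p * (t - s) \<le> w t - w s \<and> w t - w s \<le> q * (t - s)"
  shows "st_lyapunov \<alpha> (\<sigma> t) (w t) \<le> max 0 (st_lyapunov \<alpha> (\<sigma> 0) (w 0) - min p (\<alpha>\<^sup>2 - q) / 12 * t)"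
proof (rule finite_time_extinction[OF continuous_on_st_lyapunov[OF \<sigma> w] _ _ _ \<open>t \<ge> 0\<close>])
  show "min p (\<alpha>\<^sup>2 - q) / 12 > 0" using par by simp
  fix t :: real assume t: "t \<ge> 0" and V: "st_lyapunov \<alpha> (\<sigma> t) (w t) > 0"
  let ?k = "min p (\<alpha>\<^sup>2 - q) / 12"
  let ?goal = "\<exists>\<delta>>0. \<forall>s. t < s \<and> s < t + \<delta> \<longrightarrow> st_lyapunov \<alpha> (\<sigma> s) (w s) \<le> st_lyapunov \<alpha> (\<sigma> t) (w t) - ?k * (s - t)"
  have pos_phase: ?goal if "\<delta> > 0" "\<And>r. t < r \<Longrightarrow> r < t + \<delta> \<Longrightarrow> \<sigma> r > 0" for \<delta>
  proof (intro exI[of _ \<delta>] conjI allI impI that(1))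
    fix s assume s: "t < s \<and> s < t + \<delta>"
    show "st_lyapunov \<alpha> (\<sigma> s) (w s) \<le> st_lyapunov \<alpha> (\<sigma> t) (w t) - ?k * (s - t)"
      by (rule st_lyapunov_decreases_while_pos[OF par t \<sigma> w d\<sigma> dw_pos]) (use s that(2) in auto)
  qed
  have neg_phase: ?goal if "\<delta> > 0" "\<And>r. t < r \<Longrightarrow> r < t + \<delta> \<Longrightarrow> \<sigma> r < 0" for \<delta>
  proof (intro exI[of _ \<delta>] conjI allI impI that(1))
    fix s assume s: "t < s \<and> s < t + \<delta>"
    have "st_lyapunov \<alpha> (- \<sigma> s) (- w s) \<le> st_lyapunov \<alpha> (- \<sigma> t) (- w t) - ?k * (s - t)"
    proof (rule st_lyapunov_decreases_while_pos[OF par t, where \<sigma> = "\<lambda>t. - \<sigma> t" and w = "\<lambda>t. - w t"])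
      show "((\<lambda>t. - \<sigma> t) has_real_derivative - w r - \<alpha> * signed_root (- \<sigma> r)) (at r within {r..})" if "r \<ge> 0" for r
        using DERIV_minus[OF d\<sigma>[OF that]] by (simp add: algebra_simps)
      show "- q * (u - r) \<le> - w u - - w r \<and> - w u - - w r \<le> - p * (u - r)"
        if "0 \<le> r" "r \<le> u" "\<And>v. r < v \<Longrightarrow> v < u \<Longrightarrow> - \<sigma> v > 0" for r u
        using dw_neg[OF that(1,2)] that(3) by auto
    qed (use s that(2) \<sigma> w in \<open>auto intro: continuous_intros\<close>)
    then show "st_lyapunov \<alpha> (\<sigma> s) (w s) \<le> st_lyapunov \<alpha> (\<sigma> t) (w t) - ?k * (s - t)"
      by (simp only: st_lyapunov_uminus)
  qed
  have lim: "(\<sigma> \<longlongrightarrow> \<sigma> t) (at_right t)"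
    using DERIV_continuous[OF d\<sigma>[OF t]] unfolding continuous_within at_within_Ici_at_right .
  \<comment> \<open>A zero of \<open>\<sigma>\<close> at which the Lyapunov function is positive is left in the direction of \<open>w\<close>.\<close>
  consider "\<sigma> t > 0" | "\<sigma> t < 0" | "\<sigma> t = 0" "w t > 0" | "\<sigma> t = 0" "w t < 0"
  proof -
    have "w t \<noteq> 0" if "\<sigma> t = 0" using V that by (auto simp: st_lyapunov_def signed_root_def)
    then show ?thesis using that by (meson linorder_neqE)
  qed
  then show ?goal
  proof cases
    case 1
    have "\<forall>\<^sub>F r in at_right t. \<sigma> r > 0" using lim 1 by (rule order_tendstoD)
    then obtain b where "b > t" "\<And>r. t < r \<Longrightarrow> r < b \<Longrightarrow> \<sigma> r > 0" unfolding eventually_at_right_field by blast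
    then show ?thesis using pos_phase[of "b - t"] by simp
  next
    case 2
    have "\<forall>\<^sub>F r in at_right t. \<sigma> r < 0" using lim 2 by (rule order_tendstoD)
    then obtain b where "b > t" "\<And>r. t < r \<Longrightarrow> r < b \<Longrightarrow> \<sigma> r < 0" unfolding eventually_at_right_field by blast
    then show ?thesis using neg_phase[of "b - t"] by simp
  next
    case 3
    then have "w t - \<alpha> * signed_root (\<sigma> t) > 0" by (simp add: signed_root_def)
    from has_real_derivative_pos_inc_right[OF d\<sigma>[OF t] this] obtain \<delta> where
      \<delta>: "\<delta> > 0" "\<And>h. h > 0 \<Longrightarrow> h < \<delta> \<Longrightarrow> \<sigma> t < \<sigma> (t + h)" by auto
    show ?thesis
    proof (rule pos_phase[OF \<delta>(1)])
      fix r assume "t < r" "r < t + \<delta>"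
      then show "\<sigma> r > 0" using \<delta>(2)[of "r - t"] 3 by simp
    qed
  next
    case 4
    then have "w t - \<alpha> * signed_root (\<sigma> t) < 0" by (simp add: signed_root_def)
    from has_real_derivative_neg_dec_right[OF d\<sigma>[OF t] this] obtain \<delta> where
      \<delta>: "\<delta> > 0" "\<And>h. h > 0 \<Longrightarrow> h < \<delta> \<Longrightarrow> \<sigma> (t + h) < \<sigma> t" by auto
    show ?thesis
    proof (rule neg_phase[OF \<delta>(1)])
      fix r assume "t < r" "r < t + \<delta>"
      then show "\<sigma> r < 0" using \<delta>(2)[of "r - t"] 4 by simp
    qed
  qed
qed simp

section \<open>Super-twisting control\<close>

lemma real_derivative_if_integral:
  fixes f g :: "real \<Rightarrow> real"
  assumes f: "\<And>s. t \<le> s \<Longrightarrow> f s - f t = integral {t..s} g" and g: "continuous_on {t..} g"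
  shows "(f has_real_derivative g t) (at t within {t..})"
proof -
  have "((\<lambda>s. integral {t..s} g) has_vector_derivative g t) (at t within {t..t + 1})"
    by (intro integral_has_vector_derivative continuous_on_subset[OF g]) auto
  then have "((\<lambda>s. f t + integral {t..s} g) has_vector_derivative 0 + g t) (at t within {t..t + 1})"
    by (intro has_vector_derivative_add) auto
  then have deriv: "((\<lambda>s. f t + integral {t..s} g) has_vector_derivative g t) (at t within {t..t + 1})" by simp
  have eq: "f s = f t + integral {t..s} g" if "s \<in> {t..t + 1}" for s
  proof -
    have "t \<le> s" using that by simp
    then show ?thesis using f[of s] by linarith
  qed
  have "(f has_vector_derivative g t) (at t within {t..t + 1})"
    by (rule has_vector_derivative_transform[OF _ eq deriv]) simp
  then show ?thesis
    by (simp add: has_real_derivative_iff_has_vector_derivative at_within_Icc_at_right at_within_Ici_at_right)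
qed

text \<open>In a phase of constant sign the derivative of \<open>w\<close> lies between \<open>p\<close> and \<open>q\<close> up to that sign, almost
everywhere, and absolute continuity turns this into bounds on increments. The extinction time is at most the
initial value of the Lyapunov function divided by the decay rate.\<close>

theorem super_twisting_stable:
  fixes DA DL :: "('g::{real_inner,banach}) set"
  assumes setting: "feedback_setting (*\<^sub>R) (\<bullet>) DA A T B \<tau> DL L S \<phi> ev"
    and d: "AE t in lebesgue_on {0..}. \<bar>deriv d t\<bar> \<le> C"
    and \<alpha>: "\<alpha> > 0" and \<beta>: "\<beta> > \<bar>adjB B \<phi>\<bar> * C" and gain: "\<alpha> > sqrt (\<beta> + \<bar>adjB B \<phi>\<bar> * C)"
    and C: "C > 0"
  shows "globally_asymptotically_stable (super_twisting_solution DA A B DL L S \<phi> ev \<alpha> \<beta> d)"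
proof -
  interpret feedback_setting "(*\<^sub>R)" "(\<bullet>)" DA A T B \<tau> DL L S \<phi> ev by (rule setting)
  define b where "b = adjB B \<phi>"
  have "b \<noteq> 0" using B_eigenvector_nonzero by (simp add: b_def adjB_def)
  define p where "p = \<beta> - \<bar>b\<bar> * C"
  define q where "q = \<beta> + \<bar>b\<bar> * C"
  have bC: "0 \<le> \<bar>b\<bar> * C" using C by simp
  have par: "0 < p" "p \<le> q" "q < \<alpha>\<^sup>2"
  proof -
    show "0 < p" using \<beta> by (simp add: p_def b_def)
    show "p \<le> q" using bC by (simp add: p_def q_def)
    have "0 \<le> q" using \<open>0 < p\<close> \<open>p \<le> q\<close> by simp
    have "(sqrt q)\<^sup>2 < \<alpha>\<^sup>2" using gain \<open>0 \<le> q\<close> by (intro power_strict_mono) (auto simp: q_def b_def)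
    then show "q < \<alpha>\<^sup>2" using \<open>0 \<le> q\<close> by simp
  qed
  define k where "k = min p (\<alpha>\<^sup>2 - q) / 12"
  have "k > 0" using par by (simp add: k_def)
  define u where "u \<sigma> w = (1 / b) * (- ev * \<sigma> - \<alpha> * sqrt \<bar>\<sigma>\<bar> * sgn \<sigma> + w)" for \<sigma> w :: real
  define V where "V \<sigma> w = st_lyapunov \<alpha> \<sigma> w" for \<sigma> w
  \<comment> \<open>The output and the integrator state form the scalar super-twisting system: the part
    \<open>- ev * \<sigma>\<close> of the control cancels the eigenvalue.\<close>
  have loop: "integrated_solution (fst x0) (\<lambda>t. u (\<phi> \<bullet> fst (x t)) (snd (x t))) (\<lambda>t. fst (x t))
      \<and> snd (x 0) = snd x0 \<and> (\<forall>t\<ge>0. V (\<phi> \<bullet> fst (x t)) (snd (x t)) \<le> max 0 (V (\<phi> \<bullet> fst x0) (snd x0) - k * t))"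
    if sol: "super_twisting_solution DA A B DL L S \<phi> ev \<alpha> \<beta> d x0 x" for x0 x
  proof -
    define \<sigma> where "\<sigma> t = \<phi> \<bullet> fst (x t)" for t
    define w where "w t = snd (x t)" for t
    have mild: "mild_trajectory (*\<^sub>R) (\<bullet>) DA A B DL L S (fst x0) (\<lambda>t. u (\<sigma> t) (w t)) (\<lambda>t. fst (x t))"
      and ac: "\<And>\<tau>. \<tau> \<ge> 0 \<Longrightarrow> absolutely_continuous_on {0..\<tau>} w"
      and w0: "w 0 = snd x0"
      and AE_w: "AE t in lebesgue_on {0..}. \<exists>\<xi>\<in>ksign (\<sigma> t). (w has_real_derivative b * deriv d t - \<beta> * \<xi>) (at t)"
      using sol unfolding super_twisting_solution_def Let_def u_def b_def \<sigma>_def w_def comp_def by auto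
    have z_cont: "continuous_on {0..} (\<lambda>t. fst (x t))" using mild unfolding mild_trajectory_def by blast
    have \<sigma>_cont: "continuous_on {0..} \<sigma>"
      unfolding \<sigma>_def by (intro continuous_on_inner continuous_on_const z_cont)
    have w_cont: "continuous_on {0..} w" by (rule continuous_on_Ici_if_absolutely_continuous[OF ac])
    have u_eq: "u (\<sigma> t) (w t) = (1 / b) * (- ev * \<sigma> t - \<alpha> * signed_root (\<sigma> t) + w t)" for t
      by (simp add: u_def signed_root_def)
    have u_cont: "continuous_on {0..} (\<lambda>t. u (\<sigma> t) (w t))"
      unfolding u_eq by (intro continuous_intros \<sigma>_cont w_cont)
    have int_sol: "integrated_solution (fst x0) (\<lambda>t. u (\<sigma> t) (w t)) (\<lambda>t. fst (x t))"
      by (rule integrated_solution_if_mild[OF mild])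
         (intro continuous_square_integrable continuous_on_subset[OF u_cont], auto)
    have d\<sigma>: "(\<sigma> has_real_derivative w t - \<alpha> * signed_root (\<sigma> t)) (at t within {t..})" if "t \<ge> 0" for t
    proof (rule real_derivative_if_integral)
      fix s assume "t \<le> s"
      have "\<sigma> s - \<sigma> t = integral {t..s} (\<lambda>r. kcnj ev * \<sigma> r + b * u (\<sigma> r) (w r))"
        using output_increment[OF int_sol that \<open>t \<le> s\<close>] by (simp add: \<sigma>_def b_def adjB_def)
      also have "\<dots> = integral {t..s} (\<lambda>r. w r - \<alpha> * signed_root (\<sigma> r))"
        using \<open>b \<noteq> 0\<close> by (intro integral_cong) (simp add: u_eq)
      finally show "\<sigma> s - \<sigma> t = integral {t..s} (\<lambda>r. w r - \<alpha> * signed_root (\<sigma> r))" .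
    next
      show "continuous_on {t..} (\<lambda>r. w r - \<alpha> * signed_root (\<sigma> r))"
        using that by (intro continuous_intros continuous_on_subset[OF w_cont] continuous_on_subset[OF \<sigma>_cont]) auto
    qed
    have "AE t in lebesgue_on {0..}. \<bar>deriv d t\<bar> \<le> C \<and> (\<exists>\<xi>\<in>ksign (\<sigma> t). (w has_real_derivative b * deriv d t - \<beta> * \<xi>) (at t))"
      using d AE_w by eventually_elim simp
    then obtain N where N: "negligible N" and w': "\<And>t. t \<ge> 0 \<Longrightarrow> t \<notin> N \<Longrightarrow>
        \<bar>deriv d t\<bar> \<le> C \<and> (\<exists>\<xi>\<in>ksign (\<sigma> t). (w has_real_derivative b * deriv d t - \<beta> * \<xi>) (at t))"
      by (rule AE_lebesgue_on_negligible) auto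
    have bd: "\<bar>b * deriv d t\<bar> \<le> \<bar>b\<bar> * C" if "t \<ge> 0" "t \<notin> N" for t
      using w'[OF that] by (simp add: abs_mult mult_left_mono)
    have neg_st: "negligible (N \<union> {s, t})" for s t :: real
      using N by (intro negligible_Un) (auto intro: negligible_finite)
    have ac': "absolutely_continuous_on {0..t} (\<lambda>t. - w t)" if "t \<ge> 0" for t
      using absolutely_continuous_on_uminus[OF ac[OF that]] .
    have increment: "w t - w s \<le> c * (t - s) \<and> c' * (t - s) \<le> w t - w s"
      if st: "0 \<le> s" "s \<le> t" and D: "\<And>r. r \<in> {s<..<t} \<Longrightarrow> r \<notin> N \<Longrightarrow> \<exists>D. c' \<le> D \<and> D \<le> c \<and> (w has_real_derivative D) (at r)"
      for s t c c'
    proof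
      have "t \<ge> 0" using st by simp
      show "w t - w s \<le> c * (t - s)"
        by (rule absolutely_continuous_increment_le[OF ac[OF \<open>t \<ge> 0\<close>] st(2) _ neg_st[of s t]])
           (use D st in force)+
      have "- w t - - w s \<le> - c' * (t - s)"
      proof (rule absolutely_continuous_increment_le[OF ac'[OF \<open>t \<ge> 0\<close>] st(2) _ neg_st[of s t]])
        fix r assume "r \<in> {s..t} - (N \<union> {s, t})"
        then obtain D where "c' \<le> D" "(w has_real_derivative D) (at r)" using D[of r] by force
        then show "\<exists>D\<le>- c'. ((\<lambda>t. - w t) has_real_derivative D) (at r)"
          by (intro exI[of _ "- D"]) (auto intro: DERIV_minus)
      qed (use st in auto)
      then show "c' * (t - s) \<le> w t - w s" by simp
    qed
    have dw_pos: "- q * (t - s) \<le> w t - w s \<and> w t - w s \<le> - p * (t - s)"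
      if "0 \<le> s" "s \<le> t" "\<And>r. s < r \<Longrightarrow> r < t \<Longrightarrow> \<sigma> r > 0" for s t
    proof -
      have "\<exists>D. - q \<le> D \<and> D \<le> - p \<and> (w has_real_derivative D) (at r)" if r: "r \<in> {s<..<t}" "r \<notin> N" for r
      proof -
        have "\<sigma> r > 0" "r \<ge> 0" using r(1) \<open>\<And>r. s < r \<Longrightarrow> r < t \<Longrightarrow> \<sigma> r > 0\<close> \<open>0 \<le> s\<close> by auto
        then show ?thesis
          using w'[of r] bd[of r] r(2) by (intro exI[of _ "b * deriv d r - \<beta>"]) (auto simp: ksign_def p_def q_def abs_le_iff)
      qed
      from increment[OF that(1,2) this] show ?thesis by simp
    qed
    have dw_neg: "p * (t - s) \<le> w t - w s \<and> w t - w s \<le> q * (t - s)"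
      if "0 \<le> s" "s \<le> t" "\<And>r. s < r \<Longrightarrow> r < t \<Longrightarrow> \<sigma> r < 0" for s t
    proof -
      have "\<exists>D. p \<le> D \<and> D \<le> q \<and> (w has_real_derivative D) (at r)" if r: "r \<in> {s<..<t}" "r \<notin> N" for r
      proof -
        have "\<sigma> r < 0" "r \<ge> 0" using r(1) \<open>\<And>r. s < r \<Longrightarrow> r < t \<Longrightarrow> \<sigma> r < 0\<close> \<open>0 \<le> s\<close> by auto
        then show ?thesis
          using w'[of r] bd[of r] r(2) by (intro exI[of _ "b * deriv d r + \<beta>"]) (auto simp: ksign_def p_def q_def abs_le_iff)
      qed
      from increment[OF that(1,2) this] show ?thesis by simp
    qed
    have "V (\<sigma> t) (w t) \<le> max 0 (V (\<sigma> 0) (w 0) - k * t)" if "t \<ge> 0" for t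
      unfolding V_def k_def
      by (rule super_twisting_extinction[OF par \<alpha> that \<sigma>_cont w_cont d\<sigma> dw_pos dw_neg])
    moreover have "\<sigma> 0 = \<phi> \<bullet> fst x0" using integrated_solution_initial[OF int_sol] by (simp add: \<sigma>_def)
    ultimately show ?thesis using int_sol w0 by (simp add: \<sigma>_def w_def)
  qed
  define t0 where "t0 x0 = V (\<phi> \<bullet> fst x0) (snd x0) / k" for x0 :: "'g \<times> real"
  have V_nonneg: "V \<sigma> w \<ge> 0" for \<sigma> w by (simp add: V_def)
  have t0: "t0 x0 \<ge> 0" for x0 using \<open>k > 0\<close> V_nonneg by (simp add: t0_def)
  have zero: "\<phi> \<bullet> fst (x t) = 0 \<and> snd (x t) = 0"
    if sol: "super_twisting_solution DA A B DL L S \<phi> ev \<alpha> \<beta> d x0 x" and t: "t \<ge> t0 x0" for x0 x t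
  proof -
    have "V (\<phi> \<bullet> fst x0) (snd x0) - k * t \<le> 0" using t \<open>k > 0\<close> by (simp add: t0_def field_simps)
    moreover have "V (\<phi> \<bullet> fst (x t)) (snd (x t)) \<le> max 0 (V (\<phi> \<bullet> fst x0) (snd x0) - k * t)"
      using loop[OF sol] order_trans[OF t0 t] by blast
    ultimately have "V (\<phi> \<bullet> fst (x t)) (snd (x t)) \<le> 0" by (simp only: max_absorb1)
    then have V0: "st_lyapunov \<alpha> (\<phi> \<bullet> fst (x t)) (snd (x t)) = 0" using V_nonneg by (simp add: V_def antisym)
    have "\<alpha>\<^sup>2 * \<bar>\<phi> \<bullet> fst (x t)\<bar> \<le> 0" using abs_le_st_lyapunov_square[of \<alpha> "\<phi> \<bullet> fst (x t)" "snd (x t)"] V0 by simp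
    moreover have "\<alpha>\<^sup>2 > 0" using \<alpha> by simp
    ultimately have "\<phi> \<bullet> fst (x t) = 0" by (simp add: mult_le_0_iff)
    then show ?thesis using abs_le_st_lyapunov[of "snd (x t)" \<alpha> "\<phi> \<bullet> fst (x t)"] V0 by simp
  qed
  obtain M where M: "M \<ge> 1" and early: "\<And>\<epsilon>. \<epsilon> > 0 \<Longrightarrow> \<exists>a>0. \<forall>z0 h z C t0 t. integrated_solution z0 h z \<longrightarrow> C \<ge> 0 \<longrightarrow> 0 \<le> t0 \<longrightarrow> t0 \<le> a \<longrightarrow>
     (AE s in lebesgue_on {0..t0}. norm (h s) \<le> C) \<longrightarrow> (\<forall>t\<ge>t0. \<phi> \<bullet> z t = 0) \<longrightarrow> t \<ge> 0 \<longrightarrow>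
     norm (z t) \<le> M * norm z0 + \<epsilon> * C"
    using bound_if_output_vanishes_early by blast
  define G where "G = (\<bar>ev\<bar> * (2 / \<alpha>\<^sup>2) + \<alpha> * sqrt (2 / \<alpha>\<^sup>2) + 1) / \<bar>b\<bar>"
  have "G \<ge> 0" using \<alpha> by (simp add: G_def)
  have u_bound: "norm (u \<sigma> w) \<le> G" if "V \<sigma> w \<le> 1" for \<sigma> w
  proof -
    have "(V \<sigma> w)\<^sup>2 \<le> 1" using that V_nonneg by (simp add: power_le_one)
    then have "\<alpha>\<^sup>2 * \<bar>\<sigma>\<bar> \<le> 2" using abs_le_st_lyapunov_square[of \<alpha> \<sigma> w] by (simp add: V_def)
    then have \<sigma>_le: "\<bar>\<sigma>\<bar> \<le> 2 / \<alpha>\<^sup>2" using \<alpha> by (simp add: field_simps)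
    have "\<bar>w\<bar> \<le> 1" using abs_le_st_lyapunov[of w \<alpha> \<sigma>] that by (simp add: V_def)
    moreover have "\<bar>- ev * \<sigma>\<bar> \<le> \<bar>ev\<bar> * (2 / \<alpha>\<^sup>2)" unfolding abs_mult abs_minus by (intro mult_left_mono \<sigma>_le) simp
    moreover have "\<bar>\<alpha> * sqrt \<bar>\<sigma>\<bar> * sgn \<sigma>\<bar> \<le> \<alpha> * sqrt (2 / \<alpha>\<^sup>2)"
    proof -
      have "\<bar>\<alpha> * sqrt \<bar>\<sigma>\<bar> * sgn \<sigma>\<bar> \<le> \<alpha> * sqrt \<bar>\<sigma>\<bar>" using \<alpha> by (simp add: abs_mult abs_sgn_eq)
      also have "\<dots> \<le> \<alpha> * sqrt (2 / \<alpha>\<^sup>2)" using \<alpha> \<sigma>_le by (intro mult_left_mono real_sqrt_le_mono) auto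
      finally show ?thesis .
    qed
    ultimately have "\<bar>- ev * \<sigma> - \<alpha> * sqrt \<bar>\<sigma>\<bar> * sgn \<sigma> + w\<bar> \<le> \<bar>ev\<bar> * (2 / \<alpha>\<^sup>2) + \<alpha> * sqrt (2 / \<alpha>\<^sup>2) + 1"
      by linarith
    then have "\<bar>- ev * \<sigma> - \<alpha> * sqrt \<bar>\<sigma>\<bar> * sgn \<sigma> + w\<bar> / \<bar>b\<bar> \<le> G" unfolding G_def by (rule divide_right_mono) simp
    then show ?thesis unfolding u_def by (simp add: abs_mult)
  qed
  show ?thesis
    unfolding globally_asymptotically_stable_def
  proof (intro conjI allI impI)
    fix \<epsilon> :: real assume "\<epsilon> > 0"
    define \<epsilon>' where "\<epsilon>' = \<epsilon> / (4 * (G + 1))"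
    have "\<epsilon>' > 0" "\<epsilon>' * G < \<epsilon> / 4"
      using \<open>\<epsilon> > 0\<close> \<open>G \<ge> 0\<close> by (auto simp: \<epsilon>'_def field_simps)
    then obtain a where a: "a > 0" "\<And>z0 h z C t0 t. integrated_solution z0 h z \<Longrightarrow> C \<ge> 0 \<Longrightarrow> 0 \<le> t0 \<Longrightarrow> t0 \<le> a \<Longrightarrow>
     (AE s in lebesgue_on {0..t0}. norm (h s) \<le> C) \<Longrightarrow> (\<forall>t\<ge>t0. \<phi> \<bullet> z t = 0) \<Longrightarrow> t \<ge> 0 \<Longrightarrow>
     norm (z t) \<le> M * norm z0 + \<epsilon>' * C" using early by blast
    define v where "v = min 1 (min (\<epsilon> / 4) (a * k))"
    have v: "v > 0" "v \<le> 1" "v \<le> \<epsilon> / 4" "v \<le> a * k"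
      using \<open>\<epsilon> > 0\<close> a \<open>k > 0\<close> by (auto simp: v_def)
    \<comment> \<open>For \<open>norm x0 \<le> 1\<close> the squared Lyapunov function is at most \<open>c * norm x0\<close> initially.\<close>
    define c where "c = 2 + 2 * \<alpha>\<^sup>2 * norm \<phi>"
    have "c > 0" by (simp add: c_def add_pos_nonneg)
    define \<delta> where "\<delta> = min 1 (min (\<epsilon> / (4 * M)) (v\<^sup>2 / c))"
    have "\<delta> > 0" using \<open>\<epsilon> > 0\<close> M v \<open>c > 0\<close> by (simp add: \<delta>_def)
    moreover have "norm (x t) < \<epsilon>"
      if sol: "super_twisting_solution DA A B DL L S \<phi> ev \<alpha> \<beta> d x0 x" and small: "norm x0 < \<delta>" and "t \<ge> 0" for x0 x t
    proof -
      note l = loop[OF sol]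
      have n: "norm (fst x0) \<le> norm x0" "\<bar>snd x0\<bar> \<le> norm x0"
        using norm_fst_le[of "fst x0" "snd x0"] norm_snd_le[of "snd x0" "fst x0"] by simp_all
      have "(V (\<phi> \<bullet> fst x0) (snd x0))\<^sup>2 \<le> 2 * (snd x0)\<^sup>2 + 2 * (\<alpha>\<^sup>2 * \<bar>\<phi> \<bullet> fst x0\<bar>)"
        unfolding V_def by (rule st_lyapunov_square_le)
      also have "\<dots> \<le> 2 * norm x0 + 2 * (\<alpha>\<^sup>2 * (norm \<phi> * norm x0))"
      proof (intro add_mono mult_left_mono)
        have "(snd x0)\<^sup>2 \<le> (norm x0)\<^sup>2" using n(2) by (simp add: abs_le_square_iff[symmetric])
        also have "\<dots> \<le> norm x0 * 1" unfolding power2_eq_square using small by (intro mult_left_mono) (auto simp: \<delta>_def)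
        finally show "(snd x0)\<^sup>2 \<le> norm x0" by simp
        have "\<bar>\<phi> \<bullet> fst x0\<bar> \<le> norm \<phi> * norm (fst x0)" by (rule Cauchy_Schwarz_ineq2)
        also have "\<dots> \<le> norm \<phi> * norm x0" using n(1) by (rule mult_left_mono) simp
        finally show "\<bar>\<phi> \<bullet> fst x0\<bar> \<le> norm \<phi> * norm x0" .
      qed auto
      also have "\<dots> = c * norm x0" by (simp add: c_def algebra_simps)
      also have "\<dots> \<le> v\<^sup>2" using small \<open>c > 0\<close> by (simp add: \<delta>_def pos_less_divide_eq mult.commute less_imp_le)
      finally have Vv: "V (\<phi> \<bullet> fst x0) (snd x0) \<le> v"
        by (rule power2_le_imp_le) (rule less_imp_le[OF v(1)])
      have V_le: "V (\<phi> \<bullet> fst (x s)) (snd (x s)) \<le> v" if "s \<ge> 0" for s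
      proof -
        have "V (\<phi> \<bullet> fst (x s)) (snd (x s)) \<le> max 0 (V (\<phi> \<bullet> fst x0) (snd x0) - k * s)" using l that by blast
        also have "\<dots> \<le> v" using Vv v(1) \<open>k > 0\<close> that by (simp add: add_increasing2 diff_le_eq)
        finally show ?thesis .
      qed
      have "t0 x0 \<le> a" using Vv v(4) \<open>k > 0\<close> by (simp add: t0_def pos_divide_le_eq)
      have "norm (fst (x t)) \<le> M * norm (fst x0) + \<epsilon>' * G"
      proof (rule a(2)[of "fst x0" "\<lambda>t. u (\<phi> \<bullet> fst (x t)) (snd (x t))" "\<lambda>t. fst (x t)" G "t0 x0" t])
        show "AE s in lebesgue_on {0..t0 x0}. norm (u (\<phi> \<bullet> fst (x s)) (snd (x s))) \<le> G"
          by (rule AE_I2) (use u_bound V_le v(2) order_trans in fastforce)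
      qed (use l \<open>G \<ge> 0\<close> t0 \<open>t0 x0 \<le> a\<close> zero[OF sol] \<open>t \<ge> 0\<close> in auto)
      moreover have "M * norm (fst x0) < \<epsilon> / 4"
      proof -
        have "norm (fst x0) < \<epsilon> / (4 * M)" using small n(1) by (simp add: \<delta>_def)
        then show ?thesis using M by (simp add: field_simps)
      qed
      moreover have "\<bar>snd (x t)\<bar> \<le> \<epsilon> / 4"
        using abs_le_st_lyapunov[of "snd (x t)" \<alpha> "\<phi> \<bullet> fst (x t)"] V_le[OF \<open>t \<ge> 0\<close>] v(3) by (simp add: V_def)
      moreover have "norm (x t) \<le> norm (fst (x t)) + \<bar>snd (x t)\<bar>"
        using norm_Pair_le[of "fst (x t)" "snd (x t)"] by simp
      ultimately show ?thesis using \<open>\<epsilon>' * G < \<epsilon> / 4\<close> \<open>\<epsilon> > 0\<close> by linarith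
    qed
    ultimately show "\<exists>\<delta>>0. \<forall>x0 x. super_twisting_solution DA A B DL L S \<phi> ev \<alpha> \<beta> d x0 x \<and> norm x0 < \<delta> \<longrightarrow>
        (\<forall>t\<ge>0. norm (x t) < \<epsilon>)" by blast
  next
    fix x0 x assume sol: "super_twisting_solution DA A B DL L S \<phi> ev \<alpha> \<beta> d x0 x"
    have "((\<lambda>t. fst (x t)) \<longlongrightarrow> 0) at_top"
      using convergence_if_output_vanishes[OF _ t0] loop[OF sol] zero[OF sol] by blast
    moreover have "((\<lambda>t. snd (x t)) \<longlongrightarrow> 0) at_top"
      by (rule Lim_transform_eventually[OF tendsto_const])
         (use eventually_ge_at_top[of "t0 x0"] in \<open>eventually_elim; simp add: zero[OF sol]\<close>)
    ultimately have "((\<lambda>t. (fst (x t), snd (x t))) \<longlongrightarrow> (0, 0)) at_top" by (rule tendsto_Pair)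
    then show "(x \<longlongrightarrow> 0) at_top" by (simp add: zero_prod_def)
  qed
qed

section \<open>Stability of both closed loops\<close>

theorem theorem2:
  fixes scaleK :: "'k::real_or_complex \<Rightarrow> 'h::banach \<Rightarrow> 'h" and ip :: "'h \<Rightarrow> 'h \<Rightarrow> 'k"
    and DA DL :: "'h set" and A :: "'h \<Rightarrow> 'h" and T S :: "real \<Rightarrow> 'h \<Rightarrow> 'h"
    and B :: "'k \<Rightarrow> 'h \<Rightarrow> 'k" and \<tau> :: real and L :: "'h \<Rightarrow> 'k" and \<phi> :: 'h and ev :: 'k
    and d :: "real \<Rightarrow> 'k" and K K\<^sub>d :: real
    and DA' DL' :: "('g::{real_inner,banach}) set" and A' :: "'g \<Rightarrow> 'g"
    and T' S' :: "real \<Rightarrow> 'g \<Rightarrow> 'g" and B' :: "real \<Rightarrow> 'g \<Rightarrow> real" and \<tau>' :: real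
    and L' :: "'g \<Rightarrow> real" and \<phi>' :: 'g and ev' :: real
    and d' :: "real \<Rightarrow> real" and \<alpha> \<beta> C :: real
  shows
    "(feedback_setting scaleK ip DA A T B \<tau> DL L S \<phi> ev \<and>
      d \<in> borel_measurable (lebesgue_on {0..}) \<and>
      K\<^sub>d > 0 \<and> (\<forall>t\<ge>0. norm (d t) \<le> K\<^sub>d) \<and>
      K > 0 \<and> K / norm (adjB B \<phi>) > K\<^sub>d
      \<longrightarrow> globally_asymptotically_stable
            (sliding_mode_solution scaleK ip DA A B DL L S \<phi> ev K d))
     \<and>
     (feedback_setting (*\<^sub>R) (\<bullet>) DA' A' T' B' \<tau>' DL' L' S' \<phi>' ev' \<and>
      (\<exists>M. M-lipschitz_on {0..} d') \<and>
      C > 0 \<and> (AE t in lebesgue_on {0..}. d' differentiable (at t) \<and> \<bar>deriv d' t\<bar> \<le> C) \<and>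
      \<alpha> > 0 \<and> \<beta> > 0 \<and> \<beta> > \<bar>adjB B' \<phi>'\<bar> * C \<and> \<alpha> > sqrt (\<beta> + \<bar>adjB B' \<phi>'\<bar> * C)
      \<longrightarrow> globally_asymptotically_stable
            (super_twisting_solution DA' A' B' DL' L' S' \<phi>' ev' \<alpha> \<beta> d'))"
proof (intro conjI impI)
  assume "feedback_setting scaleK ip DA A T B \<tau> DL L S \<phi> ev \<and>
      d \<in> borel_measurable (lebesgue_on {0..}) \<and>
      K\<^sub>d > 0 \<and> (\<forall>t\<ge>0. norm (d t) \<le> K\<^sub>d) \<and>
      K > 0 \<and> K / norm (adjB B \<phi>) > K\<^sub>d"
  then show "globally_asymptotically_stable (sliding_mode_solution scaleK ip DA A B DL L S \<phi> ev K d)"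
    by (intro sliding_mode_control_stable) auto
next
  assume *: "feedback_setting (*\<^sub>R) (\<bullet>) DA' A' T' B' \<tau>' DL' L' S' \<phi>' ev' \<and>
      (\<exists>M. M-lipschitz_on {0..} d') \<and>
      C > 0 \<and> (AE t in lebesgue_on {0..}. d' differentiable (at t) \<and> \<bar>deriv d' t\<bar> \<le> C) \<and>
      \<alpha> > 0 \<and> \<beta> > 0 \<and> \<beta> > \<bar>adjB B' \<phi>'\<bar> * C \<and> \<alpha> > sqrt (\<beta> + \<bar>adjB B' \<phi>'\<bar> * C)"
  then have "AE t in lebesgue_on {0..}. \<bar>deriv d' t\<bar> \<le> C" by (auto elim: eventually_mono)
  with * show "globally_asymptotically_stable (super_twisting_solution DA' A' B' DL' L' S' \<phi>' ev' \<alpha> \<beta> d')"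
    by (intro super_twisting_stable) auto
qed

end
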